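(* Let $\mathcal{C}$ be an abelian category, let $\mathcal{X}\subseteq\mathcal{C}$ be closed under extensions with $\mathcal{X}=\mathrm{smd}(\mathcal{X})$, and let $\mathcal{T}\subseteq\mathcal{C}$ be an $n$-$\mathcal{X}$-tilting class. Then: (a) ${}^{\perp}(\mathcal{T}^{\perp}\cap\mathcal{X})\cap\mathcal{X}={}^{\perp}(\mathcal{T}^{\perp})\cap\mathcal{X}=\mathcal{T}^{\vee}_{\mathcal{X}}\cap\mathcal{X}=(\mathcal{T}\cap\mathcal{X})^{\vee}_{\mathcal{X}}\cap\mathcal{X}$; (b) $\mathcal{T}^{\perp}\cap\mathcal{X}=\mathrm{Fac}^{\mathcal{X}}_k(\mathcal{T})\cap\mathcal{X}$ for all $k\ge\max\{1,\mathrm{pd}_{\mathcal{X}}(\mathcal{T})\}$; (c) the pair $({}^{\perp}(\mathcal{T}^{\perp}),\mathcal{T}^{\perp})$ is $\mathcal{X}$-complete and hereditary.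
   Context: $\mathcal{C}$ is an abelian category; $\mathrm{Ext}^i$ is Yoneda Ext. For a class $\mathcal{M}$: $\mathrm{smd}(\mathcal{M})$ is the class of direct summands of objects of $\mathcal{M}$; $\mathcal{M}^{\perp}=\{C:\mathrm{Ext}^i(M,C)=0\ \forall M\in\mathcal{M},\forall i\ge1\}$, ${}^{\perp}\mathcal{M}$ dually. $\mathrm{pd}_{\mathcal{X}}(C)=\min\{n:\mathrm{Ext}^k(C,X)=0\ \forall k>n,\forall X\in\mathcal{X}\}$, $\mathrm{pd}_{\mathcal{X}}(\mathcal{T})=\sup_{T\in\mathcal{T}}\mathrm{pd}_{\mathcal{X}}(T)$. Relative generator/cogenerator in $\mathcal{X}$: a class $\omega\subseteq\mathcal{X}$ such that every $X\in\mathcal{X}$ admits an exact sequence $0\to X'\to W\to X\to 0$ (resp. $0\to X\to W\to X'\to0$) with $W\in\omega$, $X'\in\mathcal{X}$. $\mathcal{T}$-precover: $f:T\to M$, $T\in\mathcal{T}$, with $\mathrm{Hom}(T',f)$ surjective for all $T'\in\mathcal{T}$. $\mathcal{Y}^{\vee}_{\mathcal{X}}$: objects $M$ with an exact sequence $0\to M\xrightarrow{f_0}Y_0\xrightarrow{f_1}\cdots\xrightarrow{f_m}Y_m\to0$, $m\ge0$, $Y_m\in\mathcal{X}\cap\mathcal{Y}$, all $Y_k\in\mathcal{Y}$, $\mathrm{Im}(f_i)\in\mathcal{X}$ for $1\le i\le m-1$. $\mathrm{Fac}^{\mathcal{X}}_k(\mathcal{T})$: objects $C$ with an exact sequence $0\to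 K\to T_k\xrightarrow{f_k}\cdots\xrightarrow{f_1}C\to0$, $T_i\in\mathcal{T}\cap\mathcal{X}$, $\mathrm{Ker}(f_i)\in\mathcal{X}$ for $i\in[1,k]$. A class $\mathcal{T}$ is $n$-$\mathcal{X}$-tilting ($n\in\mathbb{N}$) if: (T0) $\mathcal{T}=\mathrm{smd}(\mathcal{T})$; (T1) $\mathrm{pd}_{\mathcal{X}}(\mathcal{T})\le n$; (T2) $\mathcal{T}\cap\mathcal{X}\subseteq\mathcal{T}^{\perp}$; (T3) there is $\omega\subseteq\mathcal{T}^{\vee}_{\mathcal{X}}$ which is a relative generator in $\mathcal{X}$; (T4) there is $\alpha\subseteq\mathcal{X}^{\perp}\cap\mathcal{T}^{\perp}$ which is a relative cogenerator in $\mathcal{X}$; (T5) every $Z\in\mathcal{T}^{\perp}\cap\mathcal{X}$ admits a $\mathcal{T}$-precover $T'\to Z$ with $T'\in\mathcal{X}$. A pair $(\mathcal{A},\mathcal{B})$ is $\mathcal{X}$-complete if every $X\in\mathcal{X}$ admits exact sequences $0\to B\to A\to X\to0$ and $0\to X\to B'\to A'\to0$ with $A,A'\in\mathcal{A}\cap\mathcal{X}$ and $B,B'\in\mathcal{B}\cap\mathcal{X}$; it is hereditary if $\mathrm{Ext}^k(A,B)=0$ for all $A\in\mathcal{A}$, $B\in\mathcal{B}$, $k\ge1$. *)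

theory Defs
  imports Main "HOL-Library.Extended_Nat"
begin

record ('o, 'm) abcat =
  Ob  :: "'o set"
  Hom :: "'o \<Rightarrow> 'o \<Rightarrow> 'm set"
  cmp :: "'m \<Rightarrow> 'm \<Rightarrow> 'm"   (* cmp g f = g o f *)
  idm :: "'o \<Rightarrow> 'm"
  add :: "'m \<Rightarrow> 'm \<Rightarrow> 'm"
  zer :: "'o \<Rightarrow> 'o \<Rightarrow> 'm"

definition category :: "('o,'m) abcat \<Rightarrow> bool" where
  "category C \<equiv>
     (\<forall>a b f. f \<in> Hom C a b \<longrightarrow> a \<in> Ob C \<and> b \<in> Ob C) \<and>
     (\<forall>a b a' b'. Hom C a b \<inter> Hom C a' b' \<noteq> {} \<longrightarrow> a = a' \<and> b = b') \<and>
     (\<forall>a\<in>Ob C. idm C a \<in> Hom C a a) \<and>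
     (\<forall>a b c f g. f \<in> Hom C a b \<longrightarrow> g \<in> Hom C b c \<longrightarrow> cmp C g f \<in> Hom C a c) \<and>
     (\<forall>a b c d f g h. f \<in> Hom C a b \<longrightarrow> g \<in> Hom C b c \<longrightarrow> h \<in> Hom C c d \<longrightarrow>
         cmp C h (cmp C g f) = cmp C (cmp C h g) f) \<and>
     (\<forall>a b f. f \<in> Hom C a b \<longrightarrow> cmp C f (idm C a) = f \<and> cmp C (idm C b) f = f)"

definition preadditive :: "('o,'m) abcat \<Rightarrow> bool" where
  "preadditive C \<equiv> category C \<and>
     (\<forall>a\<in>Ob C. \<forall>b\<in>Ob C.
        zer C a b \<in> Hom C a b \<and>
        (\<forall>f\<in>Hom C a b. \<forall>g\<in>Hom C a b. add C f g \<in> Hom C a b) \<and>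
        (\<forall>f\<in>Hom C a b. \<forall>g\<in>Hom C a b. \<forall>h\<in>Hom C a b. add C (add C f g) h = add C f (add C g h)) \<and>
        (\<forall>f\<in>Hom C a b. \<forall>g\<in>Hom C a b. add C f g = add C g f) \<and>
        (\<forall>f\<in>Hom C a b. add C f (zer C a b) = f) \<and>
        (\<forall>f\<in>Hom C a b. \<exists>g\<in>Hom C a b. add C f g = zer C a b)) \<and>
     (\<forall>a b c f g h. f \<in> Hom C a b \<longrightarrow> g \<in> Hom C a b \<longrightarrow> h \<in> Hom C b c \<longrightarrow>
         cmp C h (add C f g) = add C (cmp C h f) (cmp C h g)) \<and>
     (\<forall>a b c f g h. f \<in> Hom C b c \<longrightarrow> g \<in> Hom C b c \<longrightarrow> h \<in> Hom C a b \<longrightarrow>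
         cmp C (add C f g) h = add C (cmp C f h) (cmp C g h))"

definition has_zero_object :: "('o,'m) abcat \<Rightarrow> bool" where
  "has_zero_object C \<equiv> \<exists>z\<in>Ob C. \<forall>a\<in>Ob C. Hom C a z = {zer C a z} \<and> Hom C z a = {zer C z a}"

definition has_biproducts :: "('o,'m) abcat \<Rightarrow> bool" where
  "has_biproducts C \<equiv> \<forall>a\<in>Ob C. \<forall>b\<in>Ob C. \<exists>p i1 i2 p1 p2.
     p \<in> Ob C \<and> i1 \<in> Hom C a p \<and> i2 \<in> Hom C b p \<and> p1 \<in> Hom C p a \<and> p2 \<in> Hom C p b \<and>
     cmp C p1 i1 = idm C a \<and> cmp C p2 i2 = idm C b \<and>
     add C (cmp C i1 p1) (cmp C i2 p2) = idm C p"

definition is_kernel :: "('o,'m) abcat \<Rightarrow> 'o \<Rightarrow> 'o \<Rightarrow> 'm \<Rightarrow> 'o \<Rightarrow> 'm \<Rightarrow> bool" where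
  "is_kernel C a b f K k \<equiv> f \<in> Hom C a b \<and> k \<in> Hom C K a \<and> cmp C f k = zer C K b \<and>
     (\<forall>X g. g \<in> Hom C X a \<longrightarrow> cmp C f g = zer C X b \<longrightarrow> (\<exists>!h. h \<in> Hom C X K \<and> cmp C k h = g))"

definition is_cokernel :: "('o,'m) abcat \<Rightarrow> 'o \<Rightarrow> 'o \<Rightarrow> 'm \<Rightarrow> 'o \<Rightarrow> 'm \<Rightarrow> bool" where
  "is_cokernel C a b f Q q \<equiv> f \<in> Hom C a b \<and> q \<in> Hom C b Q \<and> cmp C q f = zer C a Q \<and>
     (\<forall>Y g. g \<in> Hom C b Y \<longrightarrow> cmp C g f = zer C a Y \<longrightarrow> (\<exists>!h. h \<in> Hom C Q Y \<and> cmp C h q = g))"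

definition is_mono :: "('o,'m) abcat \<Rightarrow> 'o \<Rightarrow> 'o \<Rightarrow> 'm \<Rightarrow> bool" where
  "is_mono C a b f \<equiv> f \<in> Hom C a b \<and>
     (\<forall>X g h. g \<in> Hom C X a \<longrightarrow> h \<in> Hom C X a \<longrightarrow> cmp C f g = cmp C f h \<longrightarrow> g = h)"

definition is_epi :: "('o,'m) abcat \<Rightarrow> 'o \<Rightarrow> 'o \<Rightarrow> 'm \<Rightarrow> bool" where
  "is_epi C a b f \<equiv> f \<in> Hom C a b \<and>
     (\<forall>Y g h. g \<in> Hom C b Y \<longrightarrow> h \<in> Hom C b Y \<longrightarrow> cmp C g f = cmp C h f \<longrightarrow> g = h)"

definition abelian :: "('o,'m) abcat \<Rightarrow> bool" where
  "abelian C \<equiv> preadditive C \<and> has_zero_object C \<and> has_biproducts C \<and>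
     (\<forall>a b f. f \<in> Hom C a b \<longrightarrow> (\<exists>K k. is_kernel C a b f K k) \<and> (\<exists>Q q. is_cokernel C a b f Q q)) \<and>
     (\<forall>a b f. is_mono C a b f \<longrightarrow> (\<exists>c g. is_kernel C b c g a f)) \<and>
     (\<forall>a b f. is_epi C a b f \<longrightarrow> (\<exists>c g. is_cokernel C c a g b f))"

definition exact_at :: "('o,'m) abcat \<Rightarrow> 'o \<Rightarrow> 'o \<Rightarrow> 'o \<Rightarrow> 'm \<Rightarrow> 'm \<Rightarrow> bool" where
  "exact_at C a b c f g \<equiv> f \<in> Hom C a b \<and> g \<in> Hom C b c \<and> cmp C g f = zer C a c \<and>
     (\<forall>K k Q q. is_kernel C b c g K k \<longrightarrow> is_cokernel C a b f Q q \<longrightarrow> cmp C q k = zer C K Q)"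

definition exact_complex :: "('o,'m) abcat \<Rightarrow> nat \<Rightarrow> (nat \<Rightarrow> 'o) \<Rightarrow> (nat \<Rightarrow> 'm) \<Rightarrow> bool" where
  "exact_complex C n E d \<equiv> 1 \<le> n \<and>
     (\<forall>j<n. d j \<in> Hom C (E j) (E (Suc j))) \<and>
     is_mono C (E 0) (E 1) (d 0) \<and> is_epi C (E (n - 1)) (E n) (d (n - 1)) \<and>
     (\<forall>j. Suc j < n \<longrightarrow> exact_at C (E j) (E (Suc j)) (E (Suc (Suc j))) (d j) (d (Suc j)))"

definition short_exact :: "('o,'m) abcat \<Rightarrow> 'o \<Rightarrow> 'o \<Rightarrow> 'o \<Rightarrow> 'm \<Rightarrow> 'm \<Rightarrow> bool" where
  "short_exact C a b c f g \<equiv> is_mono C a b f \<and> is_epi C b c g \<and> exact_at C a b c f g"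

text \<open>An element of the Yoneda class of Ext^i(A,B), i \<ge> 1:
  an exact sequence 0 \<rightarrow> B = E 0 \<rightarrow> E 1 \<rightarrow> ... \<rightarrow> E i \<rightarrow> E (i+1) = A \<rightarrow> 0.\<close>
definition yext :: "('o,'m) abcat \<Rightarrow> nat \<Rightarrow> 'o \<Rightarrow> 'o \<Rightarrow> (nat \<Rightarrow> 'o) \<times> (nat \<Rightarrow> 'm) \<Rightarrow> bool" where
  "yext C i A B S \<equiv> exact_complex C (Suc i) (fst S) (snd S) \<and> fst S 0 = B \<and> fst S (Suc i) = A"

definition yext_mor :: "('o,'m) abcat \<Rightarrow> nat \<Rightarrow> 'o \<Rightarrow> 'o \<Rightarrow>
    (nat \<Rightarrow> 'o) \<times> (nat \<Rightarrow> 'm) \<Rightarrow> (nat \<Rightarrow> 'o) \<times> (nat \<Rightarrow> 'm) \<Rightarrow> bool" where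
  "yext_mor C i A B S S' \<equiv> yext C i A B S \<and> yext C i A B S' \<and>
     (\<exists>\<phi>. (\<forall>j\<le>Suc i. \<phi> j \<in> Hom C (fst S j) (fst S' j)) \<and>
          \<phi> 0 = idm C B \<and> \<phi> (Suc i) = idm C A \<and>
          (\<forall>j<Suc i. cmp C (snd S' j) (\<phi> j) = cmp C (\<phi> (Suc j)) (snd S j)))"

definition yoneda_equiv :: "('o,'m) abcat \<Rightarrow> nat \<Rightarrow> 'o \<Rightarrow> 'o \<Rightarrow>
    (nat \<Rightarrow> 'o) \<times> (nat \<Rightarrow> 'm) \<Rightarrow> (nat \<Rightarrow> 'o) \<times> (nat \<Rightarrow> 'm) \<Rightarrow> bool" where
  "yoneda_equiv C i A B = (\<lambda>S S'. yext_mor C i A B S S' \<or> yext_mor C i A B S' S)\<^sup>*\<^sup>*"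

text \<open>Ext^i(A,B) = 0 (i \<ge> 1): the set of Yoneda classes (a group, hence nonempty)
  has exactly one element, i.e. any two i-extensions of A by B are Yoneda equivalent.\<close>
definition Ext_zero :: "('o,'m) abcat \<Rightarrow> nat \<Rightarrow> 'o \<Rightarrow> 'o \<Rightarrow> bool" where
  "Ext_zero C i A B \<equiv> \<forall>S S'. yext C i A B S \<longrightarrow> yext C i A B S' \<longrightarrow> yoneda_equiv C i A B S S'"

definition perp_right :: "('o,'m) abcat \<Rightarrow> 'o set \<Rightarrow> 'o set" where
  "perp_right C M = {Y \<in> Ob C. \<forall>X\<in>M. \<forall>i\<ge>1. Ext_zero C i X Y}"

definition perp_left :: "('o,'m) abcat \<Rightarrow> 'o set \<Rightarrow> 'o set" where
  "perp_left C M = {Y \<in> Ob C. \<forall>X\<in>M. \<forall>i\<ge>1. Ext_zero C i Y X}"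

definition smd :: "('o,'m) abcat \<Rightarrow> 'o set \<Rightarrow> 'o set" where
  "smd C M = {X \<in> Ob C. \<exists>Mo\<in>M. \<exists>s r. s \<in> Hom C X Mo \<and> r \<in> Hom C Mo X \<and> cmp C r s = idm C X}"

definition ext_closed :: "('o,'m) abcat \<Rightarrow> 'o set \<Rightarrow> bool" where
  "ext_closed C X \<equiv> \<forall>a b c f g. short_exact C a b c f g \<longrightarrow> a \<in> X \<longrightarrow> c \<in> X \<longrightarrow> b \<in> X"

definition pd :: "('o,'m) abcat \<Rightarrow> 'o set \<Rightarrow> 'o \<Rightarrow> enat" where
  "pd C X M = Inf {enat n | n. \<forall>k>n. \<forall>Y\<in>X. Ext_zero C k M Y}"

definition pd_class :: "('o,'m) abcat \<Rightarrow> 'o set \<Rightarrow> 'o set \<Rightarrow> enat" where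
  "pd_class C X T = Sup (pd C X ` T)"

definition rel_generator :: "('o,'m) abcat \<Rightarrow> 'o set \<Rightarrow> 'o set \<Rightarrow> bool" where
  "rel_generator C \<omega> X \<equiv> \<omega> \<subseteq> X \<and>
     (\<forall>Y\<in>X. \<exists>X' W f g. W \<in> \<omega> \<and> X' \<in> X \<and> short_exact C X' W Y f g)"

definition rel_cogenerator :: "('o,'m) abcat \<Rightarrow> 'o set \<Rightarrow> 'o set \<Rightarrow> bool" where
  "rel_cogenerator C \<omega> X \<equiv> \<omega> \<subseteq> X \<and>
     (\<forall>Y\<in>X. \<exists>X' W f g. W \<in> \<omega> \<and> X' \<in> X \<and> short_exact C Y W X' f g)"

definition is_precover :: "('o,'m) abcat \<Rightarrow> 'o set \<Rightarrow> 'm \<Rightarrow> 'o \<Rightarrow> 'o \<Rightarrow> bool" where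
  "is_precover C T f T0 M \<equiv> T0 \<in> T \<and> f \<in> Hom C T0 M \<and>
     (\<forall>T'\<in>T. \<forall>g\<in>Hom C T' M. \<exists>h\<in>Hom C T' T0. cmp C f h = g)"

text \<open>Im(f) lies in X (images are determined up to isomorphism).\<close>
definition image_in :: "('o,'m) abcat \<Rightarrow> 'o \<Rightarrow> 'o \<Rightarrow> 'm \<Rightarrow> 'o set \<Rightarrow> bool" where
  "image_in C a b f X \<equiv> \<exists>I e m. is_epi C a I e \<and> is_mono C I b m \<and> cmp C m e = f \<and> I \<in> X"

definition kernel_in :: "('o,'m) abcat \<Rightarrow> 'o \<Rightarrow> 'o \<Rightarrow> 'm \<Rightarrow> 'o set \<Rightarrow> bool" where
  "kernel_in C a b f X \<equiv> \<exists>K k. is_kernel C a b f K k \<and> K \<in> X"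

text \<open>Y^\<or>_X: 0 \<rightarrow> M = E 0 \<rightarrow> Y_0 = E 1 \<rightarrow> ... \<rightarrow> Y_m = E (m+1) \<rightarrow> 0, f_i = d i.\<close>
definition coresol :: "('o,'m) abcat \<Rightarrow> 'o set \<Rightarrow> 'o set \<Rightarrow> 'o set" where
  "coresol C Y X = {M \<in> Ob C. \<exists>m E d. exact_complex C (Suc m) E d \<and> E 0 = M \<and>
      (\<forall>j\<in>{1..Suc m}. E j \<in> Y) \<and> E (Suc m) \<in> X \<and>
      (\<forall>i. 1 \<le> i \<and> i < m \<longrightarrow> image_in C (E i) (E (Suc i)) (d i) X)}"

text \<open>Fac^X_k(T): 0 \<rightarrow> K = E 0 \<rightarrow> T_k = E 1 \<rightarrow> ... \<rightarrow> T_1 = E k \<rightarrow> C = E (k+1) \<rightarrow> 0;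
  the map f_i : T_i \<rightarrow> T_(i-1) is d (k+1-i).\<close>
definition Fac :: "('o,'m) abcat \<Rightarrow> 'o set \<Rightarrow> nat \<Rightarrow> 'o set \<Rightarrow> 'o set" where
  "Fac C X k T = {M \<in> Ob C. \<exists>E d. exact_complex C (Suc k) E d \<and> E (Suc k) = M \<and>
      (\<forall>j\<in>{1..k}. E j \<in> T \<inter> X \<and> kernel_in C (E j) (E (Suc j)) (d j) X)}"

definition tilting :: "('o,'m) abcat \<Rightarrow> 'o set \<Rightarrow> nat \<Rightarrow> 'o set \<Rightarrow> bool" where
  "tilting C X n T \<equiv>
     T = smd C T \<and>
     pd_class C X T \<le> enat n \<and>
     T \<inter> X \<subseteq> perp_right C T \<and>
     (\<exists>\<omega>. \<omega> \<subseteq> coresol C T X \<and> rel_generator C \<omega> X) \<and>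
     (\<exists>\<alpha>. \<alpha> \<subseteq> perp_right C X \<inter> perp_right C T \<and> rel_cogenerator C \<alpha> X) \<and>
     (\<forall>Z\<in>perp_right C T \<inter> X. \<exists>T' f. T' \<in> X \<and> is_precover C T f T' Z)"

definition X_complete :: "('o,'m) abcat \<Rightarrow> 'o set \<Rightarrow> 'o set \<Rightarrow> 'o set \<Rightarrow> bool" where
  "X_complete C X A B \<equiv> \<forall>Y\<in>X.
     (\<exists>b a f g. a \<in> A \<inter> X \<and> b \<in> B \<inter> X \<and> short_exact C b a Y f g) \<and>
     (\<exists>b a f g. a \<in> A \<inter> X \<and> b \<in> B \<inter> X \<and> short_exact C Y b a f g)"

definition hereditary_pair :: "('o,'m) abcat \<Rightarrow> 'o set \<Rightarrow> 'o set \<Rightarrow> bool" where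
  "hereditary_pair C A B \<equiv> \<forall>a\<in>A. \<forall>b\<in>B. \<forall>k\<ge>1. Ext_zero C k a b"

end

theory Submission
  imports Defs
begin

text \<open>
  Only vanishing consequences of the long exact Ext sequences are needed. An \<open>n\<close>-extension of \<open>A\<close> by \<open>B\<close>
  is cut into short exact sequences, and its pushforward along \<open>g : B \<rightarrow> B'\<close> is called zero if \<open>g\<close>
  extends to a morphism into some \<open>n\<close>-extension by \<open>B'\<close> whose component at the \<open>A\<close> end is zero. This
  condition is additive in \<open>g\<close> and invariant under Yoneda equivalence, so that \<open>Ext^n(A, B) = 0\<close> says
  that it holds for \<open>g = id\<close> and every extension. Dimension shifting in the first variable is then
  obtained by modifying the last short exact sequence, and in the second variable by passing to the
  opposite category.

  Let \<open>Z \<in> \<T>\<^sup>\<bottom> \<inter> \<X>\<close>. A map \<open>W \<rightarrow> Z\<close> from the relative generator extends along \<open>W \<rightarrow> Y\<close> with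
  \<open>Y \<in> \<T> \<inter> \<X>\<close>, since the cokernel of \<open>W \<rightarrow> Y\<close> lies in \<open>\<^sup>\<bottom>(\<T>\<^sup>\<bottom>)\<close>; comparing \<open>Y \<rightarrow> Z\<close> with a precover
  gives \<open>0 \<rightarrow> K \<rightarrow> T\<^sub>0 \<rightarrow> Z \<rightarrow> 0\<close> with \<open>T\<^sub>0 \<in> \<T> \<inter> \<X>\<close> and \<open>K \<in> \<T>\<^sup>\<bottom> \<inter> \<X>\<close>. Descending along a coresolution by the
  relative cogenerator, which enters \<open>\<T>\<^sup>\<bottom>\<close> after \<open>n\<close> steps, yields for every \<open>M \<in> \<X>\<close> a sequence
  \<open>0 \<rightarrow> M \<rightarrow> B \<rightarrow> A \<rightarrow> 0\<close> with \<open>B \<in> \<T>\<^sup>\<bottom> \<inter> \<X>\<close> and \<open>A\<close> coresolved by \<open>\<T>\<close>. If \<open>M \<in> \<^sup>\<bottom>(\<T>\<^sup>\<bottom> \<inter> \<X>)\<close>, then \<open>B\<close> is a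
  direct summand of its approximation \<open>T\<^sub>0\<close>, so \<open>B \<in> \<T>\<close> and \<open>M\<close> is coresolved by \<open>\<T>\<close> as well.
\<close>

section \<open>Abelian categories\<close>

text \<open>A morphism of n-extensions with components g at the B end and h at the A end says that
  the pushforward of its source along g equals the pullback of its target along h. With h = 0 the
  common class is zero, so vanishing can be expressed without the group structure of Ext, and
  neither Baer sums nor connecting maps have to be defined. Enough projectives or injectives are not
  assumed, so dimension shifting has to work on the extensions themselves. The obstacle is that
  Yoneda equivalence is a zigzag. Against a morphism S -> S' a witness of vanishing is transported
  by composition. Along it, the witness is a family of maps out of S and has to be continued to S',
  which is possible only after enlarging its target; the discrepancy is a homotopy, and
  \<open>vanishes_ext_mor_id\<close> is devoted to removing it. The bound n is used for the
  coresolution by the cogenerator: Ext^i of a cosyzygy is controlled by Ext^(i+1) of the object, so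
  after n cosyzygies no positive degree is left.\<close>

definition opc :: "('o,'m) abcat \<Rightarrow> ('o,'m) abcat" where
  "opc C = \<lparr>Ob = Ob C, Hom = (\<lambda>a b. Hom C b a), cmp = (\<lambda>g f. cmp C f g), idm = idm C,
            add = add C, zer = (\<lambda>a b. zer C b a)\<rparr>"

lemma opc_simps [simp]:
  "Ob (opc C) = Ob C" "Hom (opc C) a b = Hom C b a" "cmp (opc C) g f = cmp C f g"
  "idm (opc C) = idm C" "add (opc C) = add C" "zer (opc C) a b = zer C b a"
  by (simp_all add: opc_def)

lemma opc_opc [simp]: "opc (opc C) = C"
  by (simp add: opc_def)

lemma is_kernel_opc [simp]: "is_kernel (opc C) a b f K k = is_cokernel C b a f K k"
  by (simp add: is_kernel_def is_cokernel_def)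

lemma is_cokernel_opc [simp]: "is_cokernel (opc C) a b f K k = is_kernel C b a f K k"
  by (simp add: is_kernel_def is_cokernel_def)

lemma is_mono_opc [simp]: "is_mono (opc C) a b f = is_epi C b a f"
  by (simp add: is_mono_def is_epi_def)

lemma is_epi_opc [simp]: "is_epi (opc C) a b f = is_mono C b a f"
  by (simp add: is_mono_def is_epi_def)

lemma exact_at_opc [simp]: "exact_at (opc C) a b c f g = exact_at C c b a g f"
  by (auto simp: exact_at_def)

lemma short_exact_opc [simp]: "short_exact (opc C) a b c f g = short_exact C c b a g f"
  by (auto simp: short_exact_def)

lemma category_opc: "category C \<Longrightarrow> category (opc C)"
  unfolding category_def opc_simps
  by (elim conjE, intro conjI) metis+

lemma preadditive_opc: "preadditive C \<Longrightarrow> preadditive (opc C)"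
  unfolding preadditive_def opc_simps
  apply (elim conjE)
  apply (intro conjI)
  subgoal by (rule category_opc)
  subgoal premises p
  proof (intro ballI)
    fix a b assume "a \<in> Ob C" "b \<in> Ob C"
    then show "zer C b a \<in> Hom C b a \<and>
        (\<forall>f\<in>Hom C b a. \<forall>g\<in>Hom C b a. add C f g \<in> Hom C b a) \<and>
        (\<forall>f\<in>Hom C b a. \<forall>g\<in>Hom C b a. \<forall>h\<in>Hom C b a. add C (add C f g) h = add C f (add C g h)) \<and>
        (\<forall>f\<in>Hom C b a. \<forall>g\<in>Hom C b a. add C f g = add C g f) \<and>
        (\<forall>f\<in>Hom C b a. add C f (zer C b a) = f) \<and>
        (\<forall>f\<in>Hom C b a. \<exists>g\<in>Hom C b a. add C f g = zer C b a)"
      by (rule p(2)[THEN bspec, THEN bspec, rotated])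
  qed
  subgoal by metis
  subgoal by metis
  done

section \<open>Arrows with endpoints and the additive structure of Hom\<close>

locale abelian_cat =
  fixes C :: "('o,'m) abcat"
  assumes abelian: "abelian C"
begin

abbreviation comp (infixr "\<bullet>" 70) where "g \<bullet> f \<equiv> cmp C g f"

lemma preadditive_C: "preadditive C" using abelian by (simp add: abelian_def)
lemma category_C: "category C" using preadditive_C by (simp add: preadditive_def)

lemmas category_conj = category_C[unfolded category_def]
lemmas category_axioms = category_conj[THEN conjunct1] category_conj[THEN conjunct2, THEN conjunct1]
  category_conj[THEN conjunct2, THEN conjunct2, THEN conjunct1]
  category_conj[THEN conjunct2, THEN conjunct2, THEN conjunct2, THEN conjunct1]
  category_conj[THEN conjunct2, THEN conjunct2, THEN conjunct2, THEN conjunct2, THEN conjunct1]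
  category_conj[THEN conjunct2, THEN conjunct2, THEN conjunct2, THEN conjunct2, THEN conjunct2]

text \<open>Hom sets are pairwise disjoint, so an arrow determines its ends. Having them as
  functions turns composability into equations that the simplifier can discharge.\<close>

definition arr where "arr f \<longleftrightarrow> (\<exists>a b. f \<in> Hom C a b)"
definition src where "src f = (THE a. \<exists>b. f \<in> Hom C a b)"
definition tgt where "tgt f = (THE b. \<exists>a. f \<in> Hom C a b)"

lemma Hom_unique: "f \<in> Hom C a b \<Longrightarrow> f \<in> Hom C a' b' \<Longrightarrow> a = a' \<and> b = b'"
  using category_axioms(2) by (metis IntI empty_iff)

lemma Hom_iff: "f \<in> Hom C a b \<longleftrightarrow> arr f \<and> src f = a \<and> tgt f = b"
proof
  assume f: "f \<in> Hom C a b"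
  have "src f = a" unfolding src_def using f Hom_unique by blast
  moreover have "tgt f = b" unfolding tgt_def using f Hom_unique by blast
  ultimately show "arr f \<and> src f = a \<and> tgt f = b" using f by (auto simp: arr_def)
next
  assume *: "arr f \<and> src f = a \<and> tgt f = b"
  then obtain a' b' where f: "f \<in> Hom C a' b'" by (auto simp: arr_def)
  have "src f = a'" unfolding src_def using f Hom_unique by blast
  moreover have "tgt f = b'" unfolding tgt_def using f Hom_unique by blast
  ultimately show "f \<in> Hom C a b" using f * by simp
qed

lemma Hom_Ob: "f \<in> Hom C a b \<Longrightarrow> a \<in> Ob C" "f \<in> Hom C a b \<Longrightarrow> b \<in> Ob C"
  using category_axioms(1) by metis+

lemma src_Ob [simp]: "arr f \<Longrightarrow> src f \<in> Ob C" and tgt_Ob [simp]: "arr f \<Longrightarrow> tgt f \<in> Ob C"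
  using Hom_Ob Hom_iff by blast+

lemma comp_Hom: "f \<in> Hom C a b \<Longrightarrow> g \<in> Hom C b c \<Longrightarrow> g \<bullet> f \<in> Hom C a c"
  using category_axioms(4) by metis

lemma comp_simps [simp]:
  assumes "arr f" "arr g" "src g = tgt f"
  shows "arr (g \<bullet> f)" "src (g \<bullet> f) = src f" "tgt (g \<bullet> f) = tgt g"
  using comp_Hom[of f "src f" "tgt f" g "tgt g"] assms by (auto simp: Hom_iff)

lemma assoc_simp [simp]:
  assumes "arr f" "arr g" "arr h" "src g = tgt f" "src h = tgt g"
  shows "(h \<bullet> g) \<bullet> f = h \<bullet> g \<bullet> f"
proof -
  have "f \<in> Hom C (src f) (tgt f)" "g \<in> Hom C (tgt f) (tgt g)" "h \<in> Hom C (tgt g) (tgt h)"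
    using assms by (auto simp: Hom_iff)
  then show ?thesis using category_axioms(5) by metis
qed

lemmas preadditive_conj = preadditive_C[unfolded preadditive_def]
lemmas preadditive_axioms = preadditive_conj[THEN conjunct2, THEN conjunct1]
  preadditive_conj[THEN conjunct2, THEN conjunct2, THEN conjunct1]
  preadditive_conj[THEN conjunct2, THEN conjunct2, THEN conjunct2]

lemma id_Hom: "a \<in> Ob C \<Longrightarrow> idm C a \<in> Hom C a a"
  using category_axioms(3) by metis

lemma id_simps [simp]:
  "a \<in> Ob C \<Longrightarrow> arr (idm C a)" "a \<in> Ob C \<Longrightarrow> src (idm C a) = a" "a \<in> Ob C \<Longrightarrow> tgt (idm C a) = a"
  using id_Hom Hom_iff by blast+

lemma id_comp [simp]: "arr f \<Longrightarrow> src f = a \<Longrightarrow> f \<bullet> idm C a = f"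
  "arr f \<Longrightarrow> tgt f = b \<Longrightarrow> idm C b \<bullet> f = f"
  using category_axioms(6) Hom_iff by metis+

lemma zer_Hom: "a \<in> Ob C \<Longrightarrow> b \<in> Ob C \<Longrightarrow> zer C a b \<in> Hom C a b"
  using preadditive_axioms(1) by metis

lemma zer_simps [simp]:
  "a \<in> Ob C \<Longrightarrow> b \<in> Ob C \<Longrightarrow> arr (zer C a b)"
  "a \<in> Ob C \<Longrightarrow> b \<in> Ob C \<Longrightarrow> src (zer C a b) = a"
  "a \<in> Ob C \<Longrightarrow> b \<in> Ob C \<Longrightarrow> tgt (zer C a b) = b"
  using zer_Hom Hom_iff by blast+

text \<open>Unlike \<open>Hom_iff\<close> this also exposes that the ends are objects, which are the
  side conditions of the simplification rules for identities and zero morphisms.\<close>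

lemma in_Hom_iff: "f \<in> Hom C a b \<longleftrightarrow> arr f \<and> src f = a \<and> tgt f = b \<and> a \<in> Ob C \<and> b \<in> Ob C"
  using Hom_Ob Hom_iff by blast

abbreviation plus (infixl "\<oplus>" 65) where "f \<oplus> g \<equiv> add C f g"

lemma Hom_group:
  assumes "a \<in> Ob C" "b \<in> Ob C"
  shows "f \<in> Hom C a b \<Longrightarrow> g \<in> Hom C a b \<Longrightarrow> f \<oplus> g \<in> Hom C a b"
    "f \<in> Hom C a b \<Longrightarrow> g \<in> Hom C a b \<Longrightarrow> h \<in> Hom C a b \<Longrightarrow> (f \<oplus> g) \<oplus> h = f \<oplus> (g \<oplus> h)"
    "f \<in> Hom C a b \<Longrightarrow> g \<in> Hom C a b \<Longrightarrow> f \<oplus> g = g \<oplus> f"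
    "f \<in> Hom C a b \<Longrightarrow> f \<oplus> zer C a b = f"
    "f \<in> Hom C a b \<Longrightarrow> \<exists>g\<in>Hom C a b. f \<oplus> g = zer C a b"
proof -
  have *: "(\<forall>f\<in>Hom C a b. \<forall>g\<in>Hom C a b. add C f g \<in> Hom C a b) \<and>
        (\<forall>f\<in>Hom C a b. \<forall>g\<in>Hom C a b. \<forall>h\<in>Hom C a b. add C (add C f g) h = add C f (add C g h)) \<and>
        (\<forall>f\<in>Hom C a b. \<forall>g\<in>Hom C a b. add C f g = add C g f) \<and>
        (\<forall>f\<in>Hom C a b. add C f (zer C a b) = f) \<and>
        (\<forall>f\<in>Hom C a b. \<exists>g\<in>Hom C a b. add C f g = zer C a b)"
    using assms by (intro preadditive_axioms(1)[THEN bspec, THEN bspec, THEN conjunct2])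
  show "f \<in> Hom C a b \<Longrightarrow> g \<in> Hom C a b \<Longrightarrow> f \<oplus> g \<in> Hom C a b"
    "f \<in> Hom C a b \<Longrightarrow> g \<in> Hom C a b \<Longrightarrow> h \<in> Hom C a b \<Longrightarrow> (f \<oplus> g) \<oplus> h = f \<oplus> (g \<oplus> h)"
    "f \<in> Hom C a b \<Longrightarrow> g \<in> Hom C a b \<Longrightarrow> f \<oplus> g = g \<oplus> f"
    "f \<in> Hom C a b \<Longrightarrow> f \<oplus> zer C a b = f"
    "f \<in> Hom C a b \<Longrightarrow> \<exists>g\<in>Hom C a b. f \<oplus> g = zer C a b"
    using * by blast+
qed

lemma plus_simps [simp]:
  assumes "arr f" "arr g" "src f = src g" "tgt f = tgt g"
  shows "arr (f \<oplus> g)" "src (f \<oplus> g) = src g" "tgt (f \<oplus> g) = tgt g"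
  using Hom_group(1)[of "src f" "tgt f" f g] assms by (auto simp: Hom_iff)

lemma plus_comm:
  assumes "arr f" "arr g" "src f = src g" "tgt f = tgt g" shows "f \<oplus> g = g \<oplus> f"
  using Hom_group(3)[of "src f" "tgt f" f g] assms by (auto simp: Hom_iff)

lemma plus_assoc:
  assumes "arr f" "arr g" "arr h" "src f = src g" "tgt f = tgt g" "src h = src g" "tgt h = tgt g"
  shows "(f \<oplus> g) \<oplus> h = f \<oplus> (g \<oplus> h)"
  using Hom_group(2)[of "src f" "tgt f" f g h] assms by (auto simp: Hom_iff)

lemma plus_zero [simp]:
  assumes "arr f" "src f = a" "tgt f = b"
  shows "f \<oplus> zer C a b = f" "zer C a b \<oplus> f = f"
proof -
  show 1: "f \<oplus> zer C a b = f" using Hom_group(4)[of a b f] assms by (auto simp: Hom_iff)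
  show "zer C a b \<oplus> f = f" using assms by (subst plus_comm) (use 1 in auto)
qed

text \<open>The axioms only assert that an inverse exists; \<open>neg_unique\<close> shows that the
  choice is no choice.\<close>

definition neg where "neg f = (SOME g. g \<in> Hom C (src f) (tgt f) \<and> f \<oplus> g = zer C (src f) (tgt f))"

lemma neg_ex:
  assumes "arr f"
  shows "neg f \<in> Hom C (src f) (tgt f) \<and> f \<oplus> neg f = zer C (src f) (tgt f)"
  unfolding neg_def
proof (rule someI_ex)
  show "\<exists>g. g \<in> Hom C (src f) (tgt f) \<and> f \<oplus> g = zer C (src f) (tgt f)"
    using Hom_group(5)[of "src f" "tgt f" f] assms by (auto simp: Hom_iff)
qed

lemma neg_simps [simp]:
  assumes "arr f" shows "arr (neg f)" "src (neg f) = src f" "tgt (neg f) = tgt f"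
    "f \<oplus> neg f = zer C (src f) (tgt f)" "neg f \<oplus> f = zer C (src f) (tgt f)"
proof -
  show 1: "arr (neg f)" "src (neg f) = src f" "tgt (neg f) = tgt f"
    "f \<oplus> neg f = zer C (src f) (tgt f)" using neg_ex[OF assms] by (auto simp: Hom_iff)
  then show "neg f \<oplus> f = zer C (src f) (tgt f)" using assms by (subst plus_comm) auto
qed

lemma neg_plus_cancel:
  assumes "arr f" "arr g" "src f = src g" "tgt f = tgt g"
  shows "neg f \<oplus> (f \<oplus> g) = g"
proof -
  have "neg f \<oplus> (f \<oplus> g) = (neg f \<oplus> f) \<oplus> g"
    by (rule plus_assoc[symmetric]) (use assms in simp_all)
  then show ?thesis using assms by simp
qed

lemma plus_cancel:
  assumes "f \<oplus> g = f \<oplus> h" "arr f" "arr g" "arr h" "src f = src g" "tgt f = tgt g" "src f = src h" "tgt f = tgt h"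
  shows "g = h"
  using neg_plus_cancel[of f g] neg_plus_cancel[of f h] assms by metis

lemma distrib_left [simp]:
  assumes "arr f" "arr g" "arr h" "src f = src g" "tgt f = tgt g" "src h = tgt g"
  shows "h \<bullet> (f \<oplus> g) = h \<bullet> f \<oplus> h \<bullet> g"
proof -
  have "f \<in> Hom C (src g) (tgt g)" "g \<in> Hom C (src g) (tgt g)" "h \<in> Hom C (tgt g) (tgt h)"
    using assms by (auto simp: Hom_iff)
  then show ?thesis using preadditive_axioms(2) by blast
qed

lemma distrib_right [simp]:
  assumes "arr f" "arr g" "arr h" "src f = src g" "tgt f = tgt g" "src g = tgt h"
  shows "(f \<oplus> g) \<bullet> h = f \<bullet> h \<oplus> g \<bullet> h"
proof -
  have "f \<in> Hom C (src g) (tgt g)" "g \<in> Hom C (src g) (tgt g)" "h \<in> Hom C (src h) (src g)"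
    using assms by (auto simp: Hom_iff)
  then show ?thesis using preadditive_axioms(3) by blast
qed

lemma plus_idem:
  assumes "f \<oplus> f = f" "arr f" "src f = a" "tgt f = b" shows "f = zer C a b"
proof (rule plus_cancel[of f f])
  show "f \<oplus> f = f \<oplus> zer C a b" using assms by simp
qed (use assms in auto)

lemma comp_zer [simp]:
  assumes "arr f" "src f = b" "a \<in> Ob C" shows "f \<bullet> zer C a b = zer C a (tgt f)"
proof -
  have b: "b \<in> Ob C" using assms by auto
  have "f \<bullet> zer C a b \<oplus> f \<bullet> zer C a b = f \<bullet> (zer C a b \<oplus> zer C a b)"
    using assms b by (subst distrib_left) auto
  also have "\<dots> = f \<bullet> zer C a b" using assms b by simp
  finally show ?thesis by (rule plus_idem) (use assms b in auto)
qed

lemma zer_comp [simp]: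
  assumes "arr f" "tgt f = b" "c \<in> Ob C" shows "zer C b c \<bullet> f = zer C (src f) c"
proof -
  have b: "b \<in> Ob C" using assms by auto
  have "zer C b c \<bullet> f \<oplus> zer C b c \<bullet> f = (zer C b c \<oplus> zer C b c) \<bullet> f"
    using assms b by (subst distrib_right) auto
  also have "\<dots> = zer C b c \<bullet> f" using assms b by simp
  finally show ?thesis by (rule plus_idem) (use assms b in auto)
qed

lemma neg_unique:
  assumes "f \<oplus> g = zer C (src f) (tgt f)" "arr f" "arr g" "src f = src g" "tgt f = tgt g"
  shows "g = neg f"
  by (rule plus_cancel[of f g "neg f"]) (use assms in simp_all)

lemma comp_neg [simp]:
  assumes "arr f" "arr g" "src g = tgt f"
  shows "g \<bullet> neg f = neg (g \<bullet> f)" "neg g \<bullet> f = neg (g \<bullet> f)"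
proof -
  have "g \<bullet> f \<oplus> g \<bullet> neg f = g \<bullet> (f \<oplus> neg f)"
    using assms by (subst distrib_left) auto
  then have "g \<bullet> f \<oplus> g \<bullet> neg f = zer C (src f) (tgt g)" using assms by simp
  then show "g \<bullet> neg f = neg (g \<bullet> f)" using neg_unique[of "g \<bullet> f" "g \<bullet> neg f"] assms by simp
  have "g \<bullet> f \<oplus> neg g \<bullet> f = (g \<oplus> neg g) \<bullet> f"
    using assms by (subst distrib_right) auto
  then have "g \<bullet> f \<oplus> neg g \<bullet> f = zer C (src f) (tgt g)" using assms by simp
  then show "neg g \<bullet> f = neg (g \<bullet> f)" using neg_unique[of "g \<bullet> f" "neg g \<bullet> f"] assms by simp
qed

lemma minus_eq_zero:
  assumes "f \<oplus> neg g = zer C a b" "arr f" "arr g" "src f = src g" "tgt f = tgt g" "src f = a" "tgt f = b"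
  shows "f = g"
proof (rule plus_cancel[of "neg g"])
  show "neg g \<oplus> f = neg g \<oplus> g" using assms by (simp add: plus_comm[of "neg g" f])
qed (use assms in simp_all)

lemma neg_zer [simp]: "a \<in> Ob C \<Longrightarrow> b \<in> Ob C \<Longrightarrow> neg (zer C a b) = zer C a b"
  by (rule neg_unique[of "zer C a b" "zer C a b", symmetric]) simp_all

end


text \<open>Kernels and cokernels, monos and epis trade places, and a biproduct keeps its object
  while injections and projections are swapped. From here on a statement is proved on one side and
  read off in \<open>opc C\<close> on the other.\<close>

lemma abelian_opc: "abelian C \<Longrightarrow> abelian (opc C)"
  unfolding abelian_def
proof (elim conjE, intro conjI)
  assume pre: "preadditive C" and zero: "has_zero_object C" and bip: "has_biproducts C"
    and kc: "\<forall>a b f. f \<in> Hom C a b \<longrightarrow> (\<exists>K k. is_kernel C a b f K k) \<and> (\<exists>Q q. is_cokernel C a b f Q q)"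
    and mono: "\<forall>a b f. is_mono C a b f \<longrightarrow> (\<exists>c g. is_kernel C b c g a f)"
    and epi: "\<forall>a b f. is_epi C a b f \<longrightarrow> (\<exists>c g. is_cokernel C c a g b f)"
  show "preadditive (opc C)" using pre by (rule preadditive_opc)
  show "has_zero_object (opc C)" using zero by (auto simp: has_zero_object_def)
  show "has_biproducts (opc C)"
    unfolding has_biproducts_def opc_simps
  proof (intro ballI)
    fix a b assume "a \<in> Ob C" "b \<in> Ob C"
    with bip obtain p i1 i2 p1 p2 where "p \<in> Ob C" "i1 \<in> Hom C a p" "i2 \<in> Hom C b p"
      "p1 \<in> Hom C p a" "p2 \<in> Hom C p b" "cmp C p1 i1 = idm C a" "cmp C p2 i2 = idm C b"
      "add C (cmp C i1 p1) (cmp C i2 p2) = idm C p" unfolding has_biproducts_def by meson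
    then show "\<exists>p i1 i2 p1 p2. p \<in> Ob C \<and> i1 \<in> Hom C p a \<and> i2 \<in> Hom C p b \<and> p1 \<in> Hom C a p \<and>
        p2 \<in> Hom C b p \<and> cmp C i1 p1 = idm C a \<and> cmp C i2 p2 = idm C b \<and>
        add C (cmp C p1 i1) (cmp C p2 i2) = idm C p"
      by (intro exI[of _ p] exI[of _ p1] exI[of _ p2] exI[of _ i1] exI[of _ i2] conjI)
  qed
qed (simp_all)

lemma (in abelian_cat) abelian_cat_opc: "abelian_cat (opc C)"
  using abelian_opc[OF abelian] by unfold_locales

context abelian_cat begin

section \<open>Kernels and cokernels, monomorphisms and epimorphisms\<close>

lemma comp_assoc:
  "f \<in> Hom C a b \<Longrightarrow> g \<in> Hom C b c \<Longrightarrow> h \<in> Hom C c d \<Longrightarrow> (h \<bullet> g) \<bullet> f = h \<bullet> g \<bullet> f"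
  by (simp add: in_Hom_iff)

lemma minus_Hom:
  assumes "f \<in> Hom C a b" "g \<in> Hom C a b"
  shows "f \<oplus> neg g \<in> Hom C a b" "f \<oplus> neg g = zer C a b \<longleftrightarrow> f = g"
    "h \<in> Hom C b c \<Longrightarrow> h \<bullet> (f \<oplus> neg g) = h \<bullet> f \<oplus> neg (h \<bullet> g)"
    "k \<in> Hom C d a \<Longrightarrow> (f \<oplus> neg g) \<bullet> k = f \<bullet> k \<oplus> neg (g \<bullet> k)"
  using assms by (auto simp: in_Hom_iff intro: minus_eq_zero)

lemma is_kernelD:
  assumes "is_kernel C a b f K k"
  shows "f \<in> Hom C a b" "k \<in> Hom C K a" "f \<bullet> k = zer C K b"
    "g \<in> Hom C X a \<Longrightarrow> f \<bullet> g = zer C X b \<Longrightarrow> \<exists>h\<in>Hom C X K. k \<bullet> h = g"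
    "is_mono C K a k"
proof -
  show f: "f \<in> Hom C a b" and k: "k \<in> Hom C K a" and fk: "f \<bullet> k = zer C K b"
    using assms by (auto simp: is_kernel_def)
  have ex1: "\<exists>!h. h \<in> Hom C X K \<and> k \<bullet> h = g" if "g \<in> Hom C X a" "f \<bullet> g = zer C X b" for g X
    using assms that unfolding is_kernel_def by blast
  then show "g \<in> Hom C X a \<Longrightarrow> f \<bullet> g = zer C X b \<Longrightarrow> \<exists>h\<in>Hom C X K. k \<bullet> h = g" by blast
  show "is_mono C K a k" unfolding is_mono_def
  proof (intro conjI allI impI k)
    fix X g h assume g: "g \<in> Hom C X K" and h: "h \<in> Hom C X K" and e: "k \<bullet> g = k \<bullet> h"
    have "k \<bullet> g \<in> Hom C X a" using g k by (rule comp_Hom)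
    moreover have "f \<bullet> k \<bullet> g = zer C X b"
      using comp_assoc[OF g k f] fk g k f Hom_Ob(2)[OF f] by (simp add: in_Hom_iff)
    ultimately show "g = h" using ex1[of "k \<bullet> g" X] g h e by metis
  qed
qed

lemma is_kernelI:
  assumes "f \<in> Hom C a b" "is_mono C K a k" "f \<bullet> k = zer C K b"
    "\<And>X g. g \<in> Hom C X a \<Longrightarrow> f \<bullet> g = zer C X b \<Longrightarrow> \<exists>h\<in>Hom C X K. k \<bullet> h = g"
  shows "is_kernel C a b f K k"
  using assms unfolding is_kernel_def is_mono_def by blast

lemma is_monoI:
  assumes k: "k \<in> Hom C a b" and *: "\<And>X g. g \<in> Hom C X a \<Longrightarrow> k \<bullet> g = zer C X b \<Longrightarrow> g = zer C X a"
  shows "is_mono C a b k"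
  unfolding is_mono_def
proof (intro conjI allI impI k)
  fix X g h assume g: "g \<in> Hom C X a" and h: "h \<in> Hom C X a" and e: "k \<bullet> g = k \<bullet> h"
  have "k \<bullet> (g \<oplus> neg h) = zer C X b"
    using minus_Hom(3)[OF g h k] e minus_Hom(2)[OF comp_Hom[OF g k] comp_Hom[OF h k]] by simp
  then show "g = h" using *[OF minus_Hom(1)[OF g h]] minus_Hom(2)[OF g h] by blast
qed

lemma is_monoD:
  assumes "is_mono C a b k"
  shows "k \<in> Hom C a b" "g \<in> Hom C X a \<Longrightarrow> h \<in> Hom C X a \<Longrightarrow> k \<bullet> g = k \<bullet> h \<Longrightarrow> g = h"
    "g \<in> Hom C X a \<Longrightarrow> k \<bullet> g = zer C X b \<Longrightarrow> g = zer C X a"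
proof -
  show k: "k \<in> Hom C a b" and *: "g \<in> Hom C X a \<Longrightarrow> h \<in> Hom C X a \<Longrightarrow> k \<bullet> g = k \<bullet> h \<Longrightarrow> g = h" for g h
    using assms unfolding is_mono_def by blast+
  assume g: "g \<in> Hom C X a" "k \<bullet> g = zer C X b"
  have z: "zer C X a \<in> Hom C X a" using Hom_Ob[OF g(1)] by (simp add: in_Hom_iff)
  show "g = zer C X a" by (rule *[OF g(1) z]) (use g k Hom_Ob[OF g(1)] in \<open>simp add: in_Hom_iff\<close>)
qed

lemma mono_of_comp:
  assumes "is_mono C a c (g \<bullet> f)" "f \<in> Hom C a b" "g \<in> Hom C b c"
  shows "is_mono C a b f"
proof (rule is_monoI[OF assms(2)])
  fix X h assume h: "h \<in> Hom C X a" "f \<bullet> h = zer C X b"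
  have "(g \<bullet> f) \<bullet> h = zer C X c" using h assms Hom_Ob[OF h(1)] by (simp add: in_Hom_iff)
  then show "h = zer C X a" using is_monoD(3)[OF assms(1) h(1)] by blast
qed

lemma mono_comp:
  assumes "is_mono C a b f" "is_mono C b c g"
  shows "is_mono C a c (g \<bullet> f)"
proof (rule is_monoI)
  note h = is_monoD(1)[OF assms(1)] is_monoD(1)[OF assms(2)]
  show "g \<bullet> f \<in> Hom C a c" using comp_Hom[OF h] .
  fix X k assume k: "k \<in> Hom C X a" "(g \<bullet> f) \<bullet> k = zer C X c"
  have "g \<bullet> f \<bullet> k = zer C X c" using k comp_assoc[OF k(1) h] by simp
  then show "k = zer C X a" using is_monoD(3)[OF assms(2) comp_Hom[OF k(1) h(1)]] is_monoD(3)[OF assms(1) k(1)] by blast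
qed

lemmas is_cokernelD = abelian_cat.is_kernelD[OF abelian_cat_opc, simplified]
lemmas is_epiI = abelian_cat.is_monoI[OF abelian_cat_opc, simplified]
lemmas is_epiD = abelian_cat.is_monoD[OF abelian_cat_opc, simplified]

lemma epi_of_comp:
  assumes "is_epi C a c (g \<bullet> f)" "f \<in> Hom C a b" "g \<in> Hom C b c"
  shows "is_epi C b c g"
  using abelian_cat.mono_of_comp[OF abelian_cat_opc, of c a f g b] assms by simp

lemma epi_comp: "is_epi C a b f \<Longrightarrow> is_epi C b c g \<Longrightarrow> is_epi C a c (g \<bullet> f)"
  using abelian_cat.mono_comp[OF abelian_cat_opc, of c b g a f] by simp


section \<open>Image factorisation and exactness\<close>

lemma kernel_ex: "f \<in> Hom C a b \<Longrightarrow> \<exists>K k. is_kernel C a b f K k"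
  and cokernel_ex: "f \<in> Hom C a b \<Longrightarrow> \<exists>K k. is_cokernel C a b f K k"
  and mono_normal: "is_mono C a b f \<Longrightarrow> \<exists>c g. is_kernel C b c g a f"
  using abelian unfolding abelian_def by blast+

text \<open>The mono f is the kernel of some g. As g kills f, it factors through the cokernel q, so
  whatever q kills is killed by g and lifts to a.\<close>

lemma mono_kernel_coker:
  assumes "is_mono C a b f" "is_cokernel C a b f Q q"
  shows "is_kernel C b Q q a f"
proof (rule is_kernelI)
  show q: "q \<in> Hom C b Q" "q \<bullet> f = zer C a Q" using is_cokernelD[OF assms(2)] by auto
  show "is_mono C a b f" by fact
  fix X h assume h: "h \<in> Hom C X b" "q \<bullet> h = zer C X Q"
  obtain c g where g: "is_kernel C b c g a f" using mono_normal[OF assms(1)] by blast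
  note gH = is_kernelD(1)[OF g] and fH = is_kernelD(2)[OF g]
  obtain t where t: "t \<in> Hom C Q c" "t \<bullet> q = g"
    using is_cokernelD(4)[OF assms(2) is_kernelD(1)[OF g] is_kernelD(3)[OF g]] by blast
  have "g \<bullet> h = t \<bullet> q \<bullet> h" using comp_assoc[OF h(1) q(1) t(1)] t by simp
  also have "\<dots> = zer C X c" using h t Hom_Ob[OF h(1)] by (simp add: in_Hom_iff)
  finally show "\<exists>k\<in>Hom C X a. f \<bullet> k = h" using is_kernelD(4)[OF g h(1)] by blast
qed

lemmas epi_coker_kernel = abelian_cat.mono_kernel_coker[OF abelian_cat_opc, simplified]

text \<open>The image is the kernel of the cokernel. If w kills e, then f factors through the
  smaller subobject m n, where n is the kernel of w. Since m n is the kernel of its own cokernel, m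
  factors through it; so n has a section and w = 0.\<close>

lemma image_factor:
  assumes f: "f \<in> Hom C a b" and q: "is_cokernel C a b f Q q" and m: "is_kernel C b Q q I m"
  shows "\<exists>e. is_epi C a I e \<and> m \<bullet> e = f"
proof -
  note qH = is_cokernelD(2)[OF q] note mH = is_kernelD(2)[OF m]
  obtain e where e: "e \<in> Hom C a I" "m \<bullet> e = f"
    using is_kernelD(4)[OF m f is_cokernelD(3)[OF q]] by blast
  have "is_epi C a I e"
  proof (rule is_epiI[OF e(1)])
    fix X w assume w: "w \<in> Hom C I X" "w \<bullet> e = zer C a X"
    obtain N n where n: "is_kernel C I X w N n" using kernel_ex[OF w(1)] by blast
    note nH = is_kernelD(2)[OF n]
    obtain e' where e': "e' \<in> Hom C a N" "n \<bullet> e' = e" using is_kernelD(4)[OF n e(1) w(2)] by blast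
    have mn: "is_mono C N b (m \<bullet> n)" using mono_comp[OF is_kernelD(5)[OF n] is_kernelD(5)[OF m]] .
    obtain R r where r: "is_cokernel C N b (m \<bullet> n) R r" using cokernel_ex[OF is_monoD(1)[OF mn]] by blast
    note rH = is_cokernelD(2)[OF r]
    have "m \<bullet> n \<bullet> e' = f" using e e' by simp
    then have "r \<bullet> f = (r \<bullet> m \<bullet> n) \<bullet> e'" using e' nH mH rH by (auto simp: in_Hom_iff)
    then have "r \<bullet> f = zer C a R" using is_cokernelD(3)[OF r] e' Hom_Ob[OF rH] by (simp add: in_Hom_iff)
    then obtain t where t: "t \<in> Hom C Q R" "t \<bullet> q = r" using is_cokernelD(4)[OF q rH] by blast
    have "r \<bullet> m = t \<bullet> q \<bullet> m" using comp_assoc[OF mH qH t(1)] t by simp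
    then have "r \<bullet> m = zer C I R" using is_kernelD(3)[OF m] t Hom_Ob[OF mH] by (simp add: in_Hom_iff)
    then obtain s where s: "s \<in> Hom C I N" "(m \<bullet> n) \<bullet> s = m"
      using is_kernelD(4)[OF mono_kernel_coker[OF mn r] mH] by blast
    have "n \<bullet> s = idm C I"
      by (rule is_monoD(2)[where X = I, OF is_kernelD(5)[OF m]]) (use nH mH s in \<open>simp_all add: in_Hom_iff\<close>)
    then have "w = w \<bullet> n \<bullet> s" using w by (simp add: in_Hom_iff)
    also have "\<dots> = (w \<bullet> n) \<bullet> s" using w nH s by (simp add: in_Hom_iff)
    also have "\<dots> = zer C I X" using is_kernelD(3)[OF n] s Hom_Ob[OF w(1)] by (simp add: in_Hom_iff)
    finally show "w = zer C I X" .
  qed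
  then show ?thesis using e by blast
qed

text \<open>Passes from exactness in the form q k = 0 to the usual one. The equation q k = 0 puts
  the kernel of g inside the image of f, and g f = 0 gives the other inclusion, so the two
  subobjects agree.\<close>

lemma exact_at_epi:
  assumes x: "exact_at C a b c f g" and k: "is_kernel C b c g K k" and e: "e \<in> Hom C a K" "k \<bullet> e = f"
  shows "is_epi C a K e"
proof (rule is_epiI[OF e(1)])
  fix X w assume w: "w \<in> Hom C K X" "w \<bullet> e = zer C a X"
  have f: "f \<in> Hom C a b" and g: "g \<in> Hom C b c" and gf: "g \<bullet> f = zer C a c"
    using x by (auto simp: exact_at_def)
  obtain Q q where q: "is_cokernel C a b f Q q" using cokernel_ex[OF f] by blast
  note qH = is_cokernelD(2)[OF q] note kH = is_kernelD(2)[OF k]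
  obtain I m where m: "is_kernel C b Q q I m" using kernel_ex[OF qH] by blast
  note mH = is_kernelD(2)[OF m]
  obtain e0 where e0: "is_epi C a I e0" "m \<bullet> e0 = f" using image_factor[OF f q m] by blast
  note e0H = is_epiD(1)[OF e0(1)]
  have "q \<bullet> k = zer C K Q" using x k q by (auto simp: exact_at_def)
  then obtain t where t: "t \<in> Hom C K I" "m \<bullet> t = k" using is_kernelD(4)[OF m kH] by blast
  have "(g \<bullet> m) \<bullet> e0 = zer C a c" using comp_assoc[OF e0H mH g] e0 gf by simp
  then have "g \<bullet> m = zer C I c" using is_epiD(3)[OF e0(1) comp_Hom[OF mH g]] by blast
  then obtain u where u: "u \<in> Hom C I K" "k \<bullet> u = m" using is_kernelD(4)[OF k mH] by blast
  have ut: "u \<bullet> t = idm C K"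
    by (rule is_monoD(2)[where X = K, OF is_kernelD(5)[OF k]])
      (use u t kH comp_assoc[OF t(1) u(1) kH] in \<open>simp_all add: in_Hom_iff\<close>)
  have ue: "u \<bullet> e0 = e"
    by (rule is_monoD(2)[where X = a, OF is_kernelD(5)[OF k]])
      (use u t kH e0H e0 e comp_assoc[OF e0H u(1) kH] in \<open>simp_all add: in_Hom_iff\<close>)
  have "(w \<bullet> u) \<bullet> e0 = zer C a X" using w ue comp_assoc[OF e0H u(1) w(1)] by simp
  then have wu: "w \<bullet> u = zer C I X" using is_epiD(3)[OF e0(1) comp_Hom[OF u(1) w(1)]] by blast
  have "w = (w \<bullet> u) \<bullet> t" using comp_assoc[OF t(1) u(1) w(1)] ut w by (simp add: in_Hom_iff)
  then show "w = zer C K X" using wu t Hom_Ob[OF w(1)] by (simp add: in_Hom_iff)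
qed

lemma exact_atI:
  assumes g: "g \<in> Hom C b c" and k: "is_kernel C b c g K k" and e: "is_epi C a K e"
  shows "exact_at C a b c (k \<bullet> e) g"
  unfolding exact_at_def
proof (intro conjI allI impI g)
  note kH = is_kernelD(2)[OF k] note eH = is_epiD(1)[OF e]
  show "k \<bullet> e \<in> Hom C a b" using comp_Hom[OF eH kH] .
  have "g \<bullet> k \<bullet> e = (g \<bullet> k) \<bullet> e" using comp_assoc[OF eH kH g] by simp
  then show "g \<bullet> k \<bullet> e = zer C a c" using is_kernelD(3)[OF k] eH Hom_Ob[OF g] by (simp add: in_Hom_iff)
  fix K' k' Q q assume k': "is_kernel C b c g K' k'" and q: "is_cokernel C a b (k \<bullet> e) Q q"
  note qH = is_cokernelD(2)[OF q]
  obtain s where s: "s \<in> Hom C K' K" "k \<bullet> s = k'"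
    using is_kernelD(4)[OF k is_kernelD(2)[OF k'] is_kernelD(3)[OF k']] by blast
  have "(q \<bullet> k) \<bullet> e = zer C a Q" using is_cokernelD(3)[OF q] comp_assoc[OF eH kH qH] by simp
  then have qk: "q \<bullet> k = zer C K Q" using is_epiD(3)[OF e comp_Hom[OF kH qH]] by blast
  have "q \<bullet> k' = (q \<bullet> k) \<bullet> s" using s comp_assoc[OF s(1) kH qH] by simp
  then show "q \<bullet> k' = zer C K' Q" using qk s Hom_Ob[OF qH] by (simp add: in_Hom_iff)
qed

text \<open>A mono is the kernel of its cokernel, which is zero when the mono is also epi; hence the
  identity of b factors through e.\<close>

lemma mono_epi_iso:
  assumes e: "is_mono C a b e" "is_epi C a b e"
  shows "\<exists>s\<in>Hom C b a. e \<bullet> s = idm C b \<and> s \<bullet> e = idm C a"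
proof -
  note eH = is_monoD(1)[OF e(1)]
  obtain Q q where q: "is_cokernel C a b e Q q" using cokernel_ex[OF eH] by blast
  note qH = is_cokernelD(2)[OF q]
  have "q = zer C b Q" using is_epiD(3)[OF e(2) qH is_cokernelD(3)[OF q]] .
  then have "q \<bullet> idm C b = zer C b Q" using Hom_Ob[OF eH] Hom_Ob[OF qH] by simp
  then obtain s where s: "s \<in> Hom C b a" "e \<bullet> s = idm C b"
    using is_kernelD(4)[OF mono_kernel_coker[OF e(1) q], of "idm C b" b] id_Hom Hom_Ob[OF eH] by blast
  have "s \<bullet> e = idm C a"
    by (rule is_monoD(2)[OF e(1) comp_Hom[OF eH s(1)]])
      (use s eH comp_assoc[OF eH s(1) eH] id_Hom Hom_Ob[OF eH] in \<open>simp_all add: in_Hom_iff\<close>)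
  then show ?thesis using s by blast
qed

lemma kernel_iso_cong:
  assumes e: "is_kernel C b c g K k" "s \<in> Hom C K a" "e \<in> Hom C a K" "s \<bullet> e = idm C a" "e \<bullet> s = idm C K"
  shows "is_kernel C b c g a (k \<bullet> e)"
proof (rule is_kernelI)
  note kH = is_kernelD(2)[OF e(1)]
  show g: "g \<in> Hom C b c" using is_kernelD(1)[OF e(1)] .
  show z: "g \<bullet> k \<bullet> e = zer C a c"
    using is_kernelD(3)[OF e(1)] comp_assoc[OF e(3) kH g, symmetric] e Hom_Ob[OF g] by (simp add: in_Hom_iff)
  have "is_mono C a a (s \<bullet> e)" unfolding e(4) using Hom_Ob[OF e(3)] by (auto simp: is_mono_def in_Hom_iff)
  then have "is_mono C a K e" by (rule mono_of_comp[OF _ e(3,2)])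
  then show "is_mono C a b (k \<bullet> e)" using is_kernelD(5)[OF e(1)] by (rule mono_comp)
  fix X h assume h: "h \<in> Hom C X b" "g \<bullet> h = zer C X c"
  then obtain w where w: "w \<in> Hom C X K" "k \<bullet> w = h" using is_kernelD(4)[OF e(1)] by blast
  have "e \<bullet> s \<bullet> w = (e \<bullet> s) \<bullet> w" using comp_assoc[OF w(1) e(2) e(3)] by simp
  then have "(k \<bullet> e) \<bullet> s \<bullet> w = h" using w e kH by (simp add: in_Hom_iff)
  then show "\<exists>x\<in>Hom C X a. (k \<bullet> e) \<bullet> x = h" using comp_Hom[OF w(1) e(2)] by blast
qed

section \<open>Short exact sequences as kernel-cokernel pairs\<close>

lemma short_exactD:
  assumes "short_exact C a b c f g"
  shows "is_kernel C b c g a f" "is_cokernel C a b f c g"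
proof -
  have f: "is_mono C a b f" and g: "is_epi C b c g" and x: "exact_at C a b c f g"
    using assms by (auto simp: short_exact_def)
  note gH = is_epiD(1)[OF g] note fH = is_monoD(1)[OF f]
  have gf: "g \<bullet> f = zer C a c" using x by (auto simp: exact_at_def)
  obtain K k where k: "is_kernel C b c g K k" using kernel_ex[OF gH] by blast
  obtain e where e: "e \<in> Hom C a K" "k \<bullet> e = f" using is_kernelD(4)[OF k fH gf] by blast
  have "is_epi C a K e" using exact_at_epi[OF x k e] .
  moreover have "is_mono C a K e" using mono_of_comp[of a b k e K] f e is_kernelD(2)[OF k] by simp
  ultimately obtain s where s: "s \<in> Hom C K a" "e \<bullet> s = idm C K" "s \<bullet> e = idm C a"
    using mono_epi_iso by blast
  show ker: "is_kernel C b c g a f" using kernel_iso_cong[OF k s(1) e(1) s(3) s(2)] e by simp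
  show "is_cokernel C a b f c g" using epi_coker_kernel[OF g ker] .
qed

lemma short_exactI:
  assumes g: "is_epi C b c g" and k: "is_kernel C b c g a f"
  shows "short_exact C a b c f g"
proof -
  note fH = is_kernelD(2)[OF k]
  have "is_epi C a a (idm C a)" using Hom_Ob[OF fH] by (auto simp: is_epi_def in_Hom_iff)
  then have "exact_at C a b c (f \<bullet> idm C a) g" using exact_atI[OF is_epiD(1)[OF g] k] by blast
  then have "exact_at C a b c f g" using fH by (simp add: in_Hom_iff)
  then show ?thesis using g is_kernelD(5)[OF k] by (simp add: short_exact_def)
qed

lemmas short_exact_cokernelI = abelian_cat.short_exactI[OF abelian_cat_opc, simplified]

end


section \<open>Pullbacks and pushouts\<close>

text \<open>\<open>h'\<close> and \<open>g'\<close> are the base changes of \<open>h : b' \<rightarrow> c\<close> and \<open>g : b \<rightarrow> c\<close>, so \<open>g h' = h g'\<close>; likewise for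
  pushouts.\<close>

definition is_pullback ::
  "('o,'m) abcat \<Rightarrow> 'o \<Rightarrow> 'o \<Rightarrow> 'o \<Rightarrow> 'm \<Rightarrow> 'm \<Rightarrow> 'o \<Rightarrow> 'm \<Rightarrow> 'm \<Rightarrow> bool" where
  "is_pullback C c b b' g h P h' g' \<equiv> g \<in> Hom C b c \<and> h \<in> Hom C b' c \<and> h' \<in> Hom C P b \<and> g' \<in> Hom C P b' \<and>
     cmp C g h' = cmp C h g' \<and>
     (\<forall>X u v. u \<in> Hom C X b \<longrightarrow> v \<in> Hom C X b' \<longrightarrow> cmp C g u = cmp C h v \<longrightarrow>
        (\<exists>w\<in>Hom C X P. cmp C h' w = u \<and> cmp C g' w = v)) \<and>
     (\<forall>X w w'. w \<in> Hom C X P \<longrightarrow> w' \<in> Hom C X P \<longrightarrow> cmp C h' w = cmp C h' w' \<longrightarrow>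
        cmp C g' w = cmp C g' w' \<longrightarrow> w = w')"

definition is_pushout ::
  "('o,'m) abcat \<Rightarrow> 'o \<Rightarrow> 'o \<Rightarrow> 'o \<Rightarrow> 'm \<Rightarrow> 'm \<Rightarrow> 'o \<Rightarrow> 'm \<Rightarrow> 'm \<Rightarrow> bool" where
  "is_pushout C c b b' g h P h' g' \<equiv> g \<in> Hom C c b \<and> h \<in> Hom C c b' \<and> h' \<in> Hom C b P \<and> g' \<in> Hom C b' P \<and>
     cmp C h' g = cmp C g' h \<and>
     (\<forall>X u v. u \<in> Hom C b X \<longrightarrow> v \<in> Hom C b' X \<longrightarrow> cmp C u g = cmp C v h \<longrightarrow>
        (\<exists>w\<in>Hom C P X. cmp C w h' = u \<and> cmp C w g' = v)) \<and>
     (\<forall>X w w'. w \<in> Hom C P X \<longrightarrow> w' \<in> Hom C P X \<longrightarrow> cmp C w h' = cmp C w' h' \<longrightarrow>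
        cmp C w g' = cmp C w' g' \<longrightarrow> w = w')"

lemma is_pullback_opc [simp]: "is_pullback (opc C) c b b' g h P h' g' = is_pushout C c b b' g h P h' g'"
  by (simp add: is_pullback_def is_pushout_def)

context abelian_cat begin

lemma short_exact_props:
  assumes "short_exact C a b c f g"
  shows "f \<in> Hom C a b" "g \<in> Hom C b c" "g \<bullet> f = zer C a c"
    "is_mono C a b f" "is_epi C b c g"
    "h \<in> Hom C X b \<Longrightarrow> g \<bullet> h = zer C X c \<Longrightarrow> \<exists>k\<in>Hom C X a. f \<bullet> k = h"
    "h \<in> Hom C b X \<Longrightarrow> h \<bullet> f = zer C a X \<Longrightarrow> \<exists>k\<in>Hom C c X. k \<bullet> g = h"
  using is_kernelD[OF short_exactD(1)[OF assms]] is_cokernelD[OF short_exactD(2)[OF assms]] by blast+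

lemma short_exact_Ob:
  assumes "short_exact C a b c f g" shows "a \<in> Ob C" "b \<in> Ob C" "c \<in> Ob C"
  using Hom_Ob[OF short_exact_props(1)[OF assms]] Hom_Ob[OF short_exact_props(2)[OF assms]] by auto

lemma epi_cancel:
  assumes "is_epi C a b e" "g \<in> Hom C b X" "h \<in> Hom C b X" "g \<bullet> e = h \<bullet> e" shows "g = h"
  using assms unfolding is_epi_def by blast

lemma mono_cancel:
  assumes "is_mono C a b e" "g \<in> Hom C X a" "h \<in> Hom C X a" "e \<bullet> g = e \<bullet> h" shows "g = h"
  using assms unfolding is_mono_def by blast

lemma epi_retract: 
  assumes "r \<in> Hom C b a" "s \<in> Hom C a b" "r \<bullet> s = idm C a"
  shows "is_epi C b a r" "is_mono C a b s"
proof -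
  have 1: "is_epi C a a (idm C a)" "is_mono C a a (idm C a)"
    using Hom_Ob[OF assms(1)] by (auto simp: is_epi_def is_mono_def in_Hom_iff)
  show "is_epi C b a r" by (rule epi_of_comp[of a a r s b]) (use 1 assms in simp_all)
  show "is_mono C a b s" by (rule mono_of_comp[of a a r s b]) (use 1 assms in simp_all)
qed

text \<open>\<open>has_biproducts\<close> does not say that the mixed composites vanish. Composing
  i1 p1 + i2 p2 = 1 with p1 gives p1 + p1 i2 p2 = p1, and the epi p2 cancels from p1 i2 p2 = 0;
  symmetrically for p2 i1.\<close>

lemma biprod:
  assumes "a \<in> Ob C" "b \<in> Ob C"
  obtains p i1 i2 p1 p2 where "i1 \<in> Hom C a p" "i2 \<in> Hom C b p" "p1 \<in> Hom C p a" "p2 \<in> Hom C p b"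
    "p1 \<bullet> i1 = idm C a" "p2 \<bullet> i2 = idm C b" "p1 \<bullet> i2 = zer C b a" "p2 \<bullet> i1 = zer C a b"
    "i1 \<bullet> p1 \<oplus> i2 \<bullet> p2 = idm C p" "short_exact C a p b i1 p2" "short_exact C b p a i2 p1"
proof -
  have "has_biproducts C" using abelian by (simp add: abelian_def)
  then obtain p i1 i2 p1 p2 where H: "i1 \<in> Hom C a p" "i2 \<in> Hom C b p" "p1 \<in> Hom C p a" "p2 \<in> Hom C p b"
    and pi: "p1 \<bullet> i1 = idm C a" "p2 \<bullet> i2 = idm C b" and s: "i1 \<bullet> p1 \<oplus> i2 \<bullet> p2 = idm C p"
    using assms unfolding has_biproducts_def by meson
  note e1 = epi_retract[OF H(3,1) pi(1)] and e2 = epi_retract[OF H(4,2) pi(2)]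
  have "p1 = p1 \<bullet> (i1 \<bullet> p1 \<oplus> i2 \<bullet> p2)" unfolding s using H by (simp add: in_Hom_iff)
  also have "\<dots> = p1 \<bullet> i1 \<bullet> p1 \<oplus> p1 \<bullet> i2 \<bullet> p2" using H by (simp add: in_Hom_iff)
  also have "p1 \<bullet> i1 \<bullet> p1 = p1" using H pi comp_assoc[OF H(3) H(1) H(3), symmetric] by (simp add: in_Hom_iff)
  finally have "p1 \<oplus> p1 \<bullet> i2 \<bullet> p2 = p1 \<oplus> zer C p a" using H by (simp add: in_Hom_iff)
  then have "p1 \<bullet> i2 \<bullet> p2 = zer C p a" by (rule plus_cancel) (use H in \<open>simp_all add: in_Hom_iff\<close>)
  then have "(p1 \<bullet> i2) \<bullet> p2 = zer C b a \<bullet> p2" using H by (simp add: in_Hom_iff)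
  then have z1: "p1 \<bullet> i2 = zer C b a"
    using epi_cancel[OF e2(1) comp_Hom[OF H(2,3)] zer_Hom] assms by blast
  have "p2 = p2 \<bullet> (i1 \<bullet> p1 \<oplus> i2 \<bullet> p2)" unfolding s using H by (simp add: in_Hom_iff)
  also have "\<dots> = p2 \<bullet> i1 \<bullet> p1 \<oplus> p2 \<bullet> i2 \<bullet> p2" using H by (simp add: in_Hom_iff)
  also have "p2 \<bullet> i2 \<bullet> p2 = p2" using H pi comp_assoc[OF H(4) H(2) H(4), symmetric] by (simp add: in_Hom_iff)
  also have "p2 \<bullet> i1 \<bullet> p1 \<oplus> p2 = p2 \<oplus> p2 \<bullet> i1 \<bullet> p1" by (rule plus_comm) (use H in \<open>simp_all add: in_Hom_iff\<close>)
  finally have "p2 \<oplus> p2 \<bullet> i1 \<bullet> p1 = p2 \<oplus> zer C p b" using H by (simp add: in_Hom_iff)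
  then have "p2 \<bullet> i1 \<bullet> p1 = zer C p b" by (rule plus_cancel) (use H in \<open>simp_all add: in_Hom_iff\<close>)
  then have "(p2 \<bullet> i1) \<bullet> p1 = zer C a b \<bullet> p1" using H by (simp add: in_Hom_iff)
  then have z2: "p2 \<bullet> i1 = zer C a b"
    using epi_cancel[OF e1(1) comp_Hom[OF H(1,4)] zer_Hom] assms by blast
  have "is_kernel C p b p2 a i1"
  proof (rule is_kernelI[OF H(4) e1(2) z2])
    fix X g assume g: "g \<in> Hom C X p" "p2 \<bullet> g = zer C X b"
    have "g = (i1 \<bullet> p1 \<oplus> i2 \<bullet> p2) \<bullet> g" unfolding s using g by (simp add: in_Hom_iff)
    also have "\<dots> = i1 \<bullet> p1 \<bullet> g \<oplus> i2 \<bullet> p2 \<bullet> g" using H g(1) by (simp add: in_Hom_iff)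
    also have "\<dots> = i1 \<bullet> p1 \<bullet> g" using H g by (simp add: in_Hom_iff)
    finally show "\<exists>h\<in>Hom C X a. i1 \<bullet> h = g" using comp_Hom[OF g(1) H(3)] by metis
  qed
  moreover have "is_kernel C p a p1 b i2"
  proof (rule is_kernelI[OF H(3) e2(2) z1])
    fix X g assume g: "g \<in> Hom C X p" "p1 \<bullet> g = zer C X a"
    have "g = (i1 \<bullet> p1 \<oplus> i2 \<bullet> p2) \<bullet> g" unfolding s using g by (simp add: in_Hom_iff)
    also have "\<dots> = i1 \<bullet> p1 \<bullet> g \<oplus> i2 \<bullet> p2 \<bullet> g" using H g(1) by (simp add: in_Hom_iff)
    also have "\<dots> = i2 \<bullet> p2 \<bullet> g" using H g by (simp add: in_Hom_iff)
    finally show "\<exists>h\<in>Hom C X b. i2 \<bullet> h = g" using comp_Hom[OF g(1) H(4)] by metis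
  qed
  ultimately have "short_exact C a p b i1 p2" "short_exact C b p a i2 p1"
    using short_exactI e1(1) e2(1) by auto
  then show thesis using that[OF H pi z1 z2 s] by blast
qed

section \<open>Base change of epimorphisms and short exact sequences\<close>

lemma is_pullbackD:
  assumes "is_pullback C c b b' g h P h' g'"
  shows "g \<in> Hom C b c" "h \<in> Hom C b' c" "h' \<in> Hom C P b" "g' \<in> Hom C P b'" "g \<bullet> h' = h \<bullet> g'"
    "u \<in> Hom C X b \<Longrightarrow> v \<in> Hom C X b' \<Longrightarrow> g \<bullet> u = h \<bullet> v \<Longrightarrow> \<exists>w\<in>Hom C X P. h' \<bullet> w = u \<and> g' \<bullet> w = v"
    "w \<in> Hom C X P \<Longrightarrow> w' \<in> Hom C X P \<Longrightarrow> h' \<bullet> w = h' \<bullet> w' \<Longrightarrow> g' \<bullet> w = g' \<bullet> w' \<Longrightarrow> w = w'"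
    "is_pullback C c b' b h g P g' h'"
  using assms unfolding is_pullback_def by ((elim conjE, blast) | metis)+

text \<open>P is the kernel of d = g p1 - h p2 on the biproduct. If g is epi, so is d, because d i1
  = g. A map u that kills p2 k gives u p2 = t d; composing with i1 yields t g = 0, so t = 0 and u =
  0. The argument needs this particular pullback; \<open>pullback_epi\<close> carries it to all
  others.\<close>

lemma pullback_ex_epi:
  assumes g: "g \<in> Hom C b c" and h: "h \<in> Hom C b' c"
  shows "\<exists>P h' g'. is_pullback C c b b' g h P h' g' \<and> (is_epi C b c g \<longrightarrow> is_epi C P b' g')"
proof -
  obtain p i1 i2 p1 p2 where H: "i1 \<in> Hom C b p" "i2 \<in> Hom C b' p" "p1 \<in> Hom C p b" "p2 \<in> Hom C p b'"
    and pi: "p1 \<bullet> i1 = idm C b" "p2 \<bullet> i2 = idm C b'" "p1 \<bullet> i2 = zer C b' b" "p2 \<bullet> i1 = zer C b b'"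
    and s: "i1 \<bullet> p1 \<oplus> i2 \<bullet> p2 = idm C p"
    using biprod[OF Hom_Ob(1)[OF g] Hom_Ob(1)[OF h]] by metis
  define d where "d = g \<bullet> p1 \<oplus> neg (h \<bullet> p2)"
  have dH: "d \<in> Hom C p c" unfolding d_def by (rule minus_Hom(1)) (use H g h in \<open>auto intro: comp_Hom\<close>)
  obtain P k where k: "is_kernel C p c d P k" using kernel_ex[OF dH] by blast
  note kH = is_kernelD(2)[OF k]
  have dx: "d \<bullet> x = (g \<bullet> p1 \<bullet> x) \<oplus> neg (h \<bullet> p2 \<bullet> x)" if "x \<in> Hom C X p" for x X
    unfolding d_def using that H g h by (simp add: in_Hom_iff)
  have pb: "is_pullback C c b b' g h P (p1 \<bullet> k) (p2 \<bullet> k)"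
    unfolding is_pullback_def
  proof (intro conjI allI impI g h)
    show H1: "p1 \<bullet> k \<in> Hom C P b" and H2: "p2 \<bullet> k \<in> Hom C P b'" using comp_Hom[OF kH] H by auto
    have "(g \<bullet> p1 \<bullet> k) \<oplus> neg (h \<bullet> p2 \<bullet> k) = zer C P c" using dx[OF kH] is_kernelD(3)[OF k] by simp
    then show "g \<bullet> p1 \<bullet> k = h \<bullet> p2 \<bullet> k" using minus_Hom(2)[OF comp_Hom[OF H1 g] comp_Hom[OF H2 h]] by blast
    {
      fix X u v assume u: "u \<in> Hom C X b" and v: "v \<in> Hom C X b'" and e: "g \<bullet> u = h \<bullet> v"
      let ?x = "i1 \<bullet> u \<oplus> i2 \<bullet> v"
      have x: "?x \<in> Hom C X p" using u v H by (simp add: in_Hom_iff)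
      have "p1 \<bullet> ?x = (p1 \<bullet> i1) \<bullet> u \<oplus> (p1 \<bullet> i2) \<bullet> v" using u v H by (simp add: in_Hom_iff)
      then have x1: "p1 \<bullet> ?x = u" using u v pi H by (simp add: in_Hom_iff del: assoc_simp)
      have "p2 \<bullet> ?x = (p2 \<bullet> i1) \<bullet> u \<oplus> (p2 \<bullet> i2) \<bullet> v" using u v H by (simp add: in_Hom_iff)
      then have x2: "p2 \<bullet> ?x = v" using u v pi H by (simp add: in_Hom_iff del: assoc_simp)
      have "d \<bullet> ?x = zer C X c" unfolding dx[OF x] x1 x2 e using v h by (simp add: in_Hom_iff)
      then obtain w where w: "w \<in> Hom C X P" "k \<bullet> w = ?x" using is_kernelD(4)[OF k x] by blast
      have "(p1 \<bullet> k) \<bullet> w = u" "(p2 \<bullet> k) \<bullet> w = v"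
        using comp_assoc[OF w(1) kH H(3)] comp_assoc[OF w(1) kH H(4)] w x1 x2 by auto
      then show "\<exists>w\<in>Hom C X P. (p1 \<bullet> k) \<bullet> w = u \<and> (p2 \<bullet> k) \<bullet> w = v" using w by blast
    }
    {
      fix X w w' assume w: "w \<in> Hom C X P" "w' \<in> Hom C X P" "(p1 \<bullet> k) \<bullet> w = (p1 \<bullet> k) \<bullet> w'"
        "(p2 \<bullet> k) \<bullet> w = (p2 \<bullet> k) \<bullet> w'"
      have *: "k \<bullet> w = i1 \<bullet> (p1 \<bullet> k) \<bullet> w \<oplus> i2 \<bullet> (p2 \<bullet> k) \<bullet> w" if "w \<in> Hom C X P" for w
      proof -
        have "k \<bullet> w = (i1 \<bullet> p1 \<oplus> i2 \<bullet> p2) \<bullet> k \<bullet> w" unfolding s using that kH by (simp add: in_Hom_iff)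
        then show ?thesis using that kH H by (simp add: in_Hom_iff)
      qed
      have "k \<bullet> w = k \<bullet> w'" using *[OF w(1)] *[OF w(2)] w by simp
      then show "w = w'" using mono_cancel[OF is_kernelD(5)[OF k]] w by blast
    }
  qed
  moreover have "is_epi C P b' (p2 \<bullet> k)" if ge: "is_epi C b c g"
  proof (rule is_epiI)
    show "p2 \<bullet> k \<in> Hom C P b'" using comp_Hom[OF kH H(4)] .
    fix X u assume u: "u \<in> Hom C b' X" "u \<bullet> p2 \<bullet> k = zer C P X"
    have di: "d \<bullet> i1 = g" unfolding dx[OF H(1)] pi using g h by (simp add: in_Hom_iff)
    then have de: "is_epi C p c d" using epi_of_comp[of b c d i1 p] ge H dH by simp
    have "(u \<bullet> p2) \<bullet> k = zer C P X" using comp_assoc[OF kH H(4) u(1)] u by simp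
    then obtain t where t: "t \<in> Hom C c X" "t \<bullet> d = u \<bullet> p2"
      using is_cokernelD(4)[OF epi_coker_kernel[OF de k] comp_Hom[OF H(4) u(1)]] by blast
    have "t \<bullet> g = (u \<bullet> p2) \<bullet> i1" using t(2)[symmetric] comp_assoc[OF H(1) dH t(1)] di by simp
    then have "t \<bullet> g = zer C b X" using comp_assoc[OF H(1) H(4) u(1)] pi u(1) Hom_Ob[OF g] by (simp add: in_Hom_iff)
    then have "t = zer C c X" using is_epiD(3)[OF ge t(1)] by blast
    then have up: "u \<bullet> p2 = zer C p X" using t dH by (simp add: in_Hom_iff)
    have "u = (u \<bullet> p2) \<bullet> i2" using comp_assoc[OF H(2) H(4) u(1)] pi u(1) by (simp add: in_Hom_iff)
    then show "u = zer C b' X" unfolding up using H u(1) by (simp add: in_Hom_iff)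
  qed
  ultimately show ?thesis by blast
qed

lemma pullback_ex:
  assumes "g \<in> Hom C b c" "h \<in> Hom C b' c"
  shows "\<exists>P h' g'. is_pullback C c b b' g h P h' g'"
  using pullback_ex_epi[OF assms] by blast

lemma pullback_epi:
  assumes pb: "is_pullback C c b b' g h P h' g'" and g: "is_epi C b c g"
  shows "is_epi C P b' g'"
proof -
  obtain Q h1 g1 where Q: "is_pullback C c b b' g h Q h1 g1" "is_epi C Q b' g1"
    using pullback_ex_epi[OF is_pullbackD(1,2)[OF pb]] g by blast
  obtain w where w: "w \<in> Hom C Q P" "g' \<bullet> w = g1"
    using is_pullbackD(6)[OF pb is_pullbackD(3,4,5)[OF Q(1)]] by blast
  show ?thesis by (rule epi_of_comp[of Q b' g' w P]) (use w Q is_pullbackD(4)[OF pb] in simp_all)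
qed

lemma pullback_short_exact:
  assumes pb: "is_pullback C c b b' g h P h' g'" and se: "short_exact C a b c f g"
  shows "\<exists>f'. short_exact C a P b' f' g' \<and> h' \<bullet> f' = f"
proof -
  note H = is_pullbackD[OF pb] note S = short_exact_props[OF se] note O = short_exact_Ob[OF se]
  have z: "zer C a b' \<in> Hom C a b'" using Hom_Ob[OF H(2)] O zer_Hom by blast
  have "g \<bullet> f = h \<bullet> zer C a b'" using S(3) H(2) O by (simp add: in_Hom_iff)
  then obtain f' where f': "f' \<in> Hom C a P" "h' \<bullet> f' = f" "g' \<bullet> f' = zer C a b'"
    using H(6)[OF S(1) z] by blast
  have "is_kernel C P b' g' a f'"
  proof (rule is_kernelI[OF H(4) _ f'(3)])
    show "is_mono C a P f'" by (rule mono_of_comp[of a b h' f' P]) (use f' S H in simp_all)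
    fix X x assume x: "x \<in> Hom C X P" "g' \<bullet> x = zer C X b'"
    have "g \<bullet> h' \<bullet> x = (g \<bullet> h') \<bullet> x" using comp_assoc[OF x(1) H(3) H(1)] by simp
    also have "\<dots> = h \<bullet> g' \<bullet> x" using comp_assoc[OF x(1) H(4) H(2)] H(5) by simp
    also have "\<dots> = zer C X c" unfolding x(2) using H(2) Hom_Ob[OF x(1)] by (simp add: in_Hom_iff)
    finally obtain y where y: "y \<in> Hom C X a" "f \<bullet> y = h' \<bullet> x"
      using S(6)[OF comp_Hom[OF x(1) H(3)]] by blast
    have "f' \<bullet> y = x"
    proof (rule H(7)[OF comp_Hom[OF y(1) f'(1)] x(1)])
      show "h' \<bullet> f' \<bullet> y = h' \<bullet> x" using comp_assoc[OF y(1) f'(1) H(3)] f' y by simp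
      show "g' \<bullet> f' \<bullet> y = g' \<bullet> x" using comp_assoc[OF y(1) f'(1) H(4)] f'(3) x y(1) z by (simp add: in_Hom_iff)
    qed
    then show "\<exists>y\<in>Hom C X a. f' \<bullet> y = x" using y by blast
  qed
  then show ?thesis using short_exactI[OF pullback_epi[OF pb S(5)]] f' by blast
qed

lemma pullback_mono:
  assumes pb: "is_pullback C c b b' g h P h' g'" and h: "is_mono C b' c h"
  shows "is_mono C P b h'"
  unfolding is_mono_def
proof (intro conjI allI impI)
  note H = is_pullbackD[OF pb]
  show "h' \<in> Hom C P b" by (rule H)
  fix X x y assume x: "x \<in> Hom C X P" and y: "y \<in> Hom C X P" and e: "h' \<bullet> x = h' \<bullet> y"
  have "h \<bullet> g' \<bullet> x = (h \<bullet> g') \<bullet> x" using x H by (simp add: in_Hom_iff)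
  also have "\<dots> = g \<bullet> h' \<bullet> x" using comp_assoc[OF x H(3) H(1)] H(5) by simp
  also have "\<dots> = (h \<bullet> g') \<bullet> y" using comp_assoc[OF y H(3) H(1)] H(5) e by simp
  also have "\<dots> = h \<bullet> g' \<bullet> y" using y H by (simp add: in_Hom_iff)
  finally have "g' \<bullet> x = g' \<bullet> y" using mono_cancel[OF h comp_Hom[OF x H(4)] comp_Hom[OF y H(4)]] by blast
  then show "x = y" using H(7)[OF x y e] by blast
qed

text \<open>P is the preimage under the epi g of the subobject b' of c, so the quotient d does not
  change.\<close>

lemma pullback_short_exact_mono:
  assumes pb: "is_pullback C c b b' g h P h' g'" and se: "short_exact C b' c d h k" and g: "is_epi C b c g"
  shows "short_exact C P b d h' (k \<bullet> g)"
proof (rule short_exactI)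
  note H = is_pullbackD[OF pb] note S = short_exact_props[OF se] note O = short_exact_Ob[OF se]
  show "is_epi C b d (k \<bullet> g)" using epi_comp[OF g S(5)] .
  show "is_kernel C b d (k \<bullet> g) P h'"
  proof (rule is_kernelI[OF comp_Hom[OF H(1) S(2)] pullback_mono[OF pb S(4)]])
    have "(k \<bullet> g) \<bullet> h' = (k \<bullet> h) \<bullet> g'" using comp_assoc[OF H(3,1) S(2)] comp_assoc[OF H(4,2) S(2)] H(5) by simp
    then show "(k \<bullet> g) \<bullet> h' = zer C P d" using S(3) H(4) O by (simp add: in_Hom_iff)
    fix X x assume x: "x \<in> Hom C X b" "(k \<bullet> g) \<bullet> x = zer C X d"
    then obtain v where v: "v \<in> Hom C X b'" "h \<bullet> v = g \<bullet> x"
      using S(6)[OF comp_Hom[OF x(1) H(1)]] comp_assoc[OF x(1) H(1) S(2)] by auto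
    then show "\<exists>y\<in>Hom C X P. h' \<bullet> y = x" using H(6)[OF x(1) v(1)] by metis
  qed
qed

lemmas is_pushoutD = abelian_cat.is_pullbackD[OF abelian_cat_opc, simplified]
lemmas pushout_ex = abelian_cat.pullback_ex[OF abelian_cat_opc, simplified]
lemmas pushout_mono = abelian_cat.pullback_epi[OF abelian_cat_opc, simplified]
lemmas pushout_short_exact = abelian_cat.pullback_short_exact[OF abelian_cat_opc, simplified]
lemmas pushout_short_exact_epi = abelian_cat.pullback_short_exact_mono[OF abelian_cat_opc, simplified]

text \<open>The idempotent 1 - f r kills f and therefore factors as s g; this s is a section of g
  and the kernel of r.\<close>

lemma split_retraction:
  assumes se: "short_exact C a b c f g" and r: "r \<in> Hom C b a" "r \<bullet> f = idm C a"
  shows "\<exists>s. short_exact C c b a s r \<and> g \<bullet> s = idm C c"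
proof -
  note S = short_exact_props[OF se] note O = short_exact_Ob[OF se]
  have fr: "f \<bullet> r \<in> Hom C b b" using comp_Hom[OF r(1) S(1)] .
  let ?d = "idm C b \<oplus> neg (f \<bullet> r)"
  have d: "?d \<in> Hom C b b" using minus_Hom(1)[OF id_Hom fr] O by blast
  have "?d \<bullet> f = f \<oplus> neg (f \<bullet> r \<bullet> f)" using S(1) r(1) O by (simp add: in_Hom_iff)
  then have "?d \<bullet> f = zer C a b" unfolding r(2) using S(1) O by (simp add: in_Hom_iff)
  then obtain s where s: "s \<in> Hom C c b" "s \<bullet> g = ?d" using S(7)[OF d] by blast
  have "(g \<bullet> s) \<bullet> g = g \<bullet> ?d" using comp_assoc[OF S(2) s(1) S(2)] s(2) by simp
  also have "\<dots> = g \<oplus> neg ((g \<bullet> f) \<bullet> r)" using S(1,2) r(1) O by (simp add: in_Hom_iff)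
  also have "\<dots> = idm C c \<bullet> g" unfolding S(3) using S(2) r(1) O by (simp add: in_Hom_iff)
  finally have gs: "g \<bullet> s = idm C c"
    using epi_cancel[OF S(5) comp_Hom[OF s(1) S(2)] id_Hom] O by blast
  have "(r \<bullet> s) \<bullet> g = r \<bullet> ?d" using comp_assoc[OF S(2) s(1) r(1)] s(2) by simp
  also have "\<dots> = r \<oplus> neg ((r \<bullet> f) \<bullet> r)" using S(1,2) r(1) O by (simp add: in_Hom_iff)
  also have "\<dots> = zer C c a \<bullet> g" unfolding r(2) using S(2) r(1) O by (simp add: in_Hom_iff)
  finally have rs: "r \<bullet> s = zer C c a"
    using epi_cancel[OF S(5) comp_Hom[OF s(1) r(1)] zer_Hom] O by blast
  have "is_kernel C b a r c s"
  proof (rule is_kernelI[OF r(1) epi_retract(2)[OF S(2) s(1) gs] rs])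
    fix X h assume h: "h \<in> Hom C X b" "r \<bullet> h = zer C X a"
    have "s \<bullet> g \<bullet> h = ?d \<bullet> h" using comp_assoc[OF h(1) S(2) s(1)] s(2) by simp
    also have "\<dots> = h \<oplus> neg (f \<bullet> r \<bullet> h)" using h(1) S(1) r(1) O by (simp add: in_Hom_iff)
    also have "\<dots> = h" unfolding h(2) using h(1) S(1) O by (simp add: in_Hom_iff)
    finally show "\<exists>k\<in>Hom C X c. s \<bullet> k = h" using comp_Hom[OF h(1) S(2)] by blast
  qed
  then show ?thesis using short_exactI[OF epi_retract(1)[OF r(1) S(1) r(2)]] gs by blast
qed

lemmas split_section = abelian_cat.split_retraction[OF abelian_cat_opc, simplified]

lemma zero_object:
  obtains z where "z \<in> Ob C" "\<And>a. a \<in> Ob C \<Longrightarrow> short_exact C a a z (idm C a) (zer C a z)"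
    "\<And>a. a \<in> Ob C \<Longrightarrow> short_exact C z a a (zer C z a) (idm C a)"
    "\<And>a f. f \<in> Hom C a z \<Longrightarrow> f = zer C a z"
    "\<And>a f. f \<in> Hom C z a \<Longrightarrow> f = zer C z a"
proof -
  have "has_zero_object C" using abelian by (simp add: abelian_def)
  then obtain z where z: "z \<in> Ob C" "\<forall>a\<in>Ob C. Hom C a z = {zer C a z} \<and> Hom C z a = {zer C z a}"
    unfolding has_zero_object_def by blast
  have za: "f = zer C a z" if "f \<in> Hom C a z" for f a using that z Hom_Ob(1)[OF that] by blast
  have az: "f = zer C z a" if "f \<in> Hom C z a" for f a using that z Hom_Ob(2)[OF that] by blast
  have i: "is_epi C a a (idm C a)" "is_mono C a a (idm C a)" if "a \<in> Ob C" for a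
    using that by (auto simp: is_epi_def is_mono_def in_Hom_iff)
  have "is_kernel C a z (zer C a z) a (idm C a)" if "a \<in> Ob C" for a
    using that i[OF that] z(1) by (intro is_kernelI) (auto simp: in_Hom_iff)
  moreover have "is_epi C a z (zer C a z)" if "a \<in> Ob C" for a
    using that z(1) az by (intro is_epiI) (auto simp: in_Hom_iff)
  moreover have "is_kernel C a a (idm C a) z (zer C z a)" if "a \<in> Ob C" for a
  proof (rule is_kernelI)
    show "is_mono C z a (zer C z a)" using that z(1) za by (intro is_monoI) (auto simp: in_Hom_iff)
    fix X g assume "g \<in> Hom C X a" "idm C a \<bullet> g = zer C X a"
    then have "zer C z a \<bullet> zer C X z = g" using z(1) that by (simp add: in_Hom_iff)
    then show "\<exists>h\<in>Hom C X z. zer C z a \<bullet> h = g" using z(1) Hom_Ob[OF \<open>g \<in> _\<close>] zer_Hom by blast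
  qed (use that z(1) in \<open>auto simp: in_Hom_iff\<close>)
  ultimately show thesis using that[OF z(1)] short_exactI i za az by metis
qed

end


section \<open>Zero classes of Yoneda extensions\<close>

text \<open>An extension is read from the \<open>B\<close> end: \<open>(E,K,i,p)\<close> stands for \<open>0 \<rightarrow> B \<rightarrow> E \<rightarrow> K \<rightarrow> 0\<close>, and the rest
  of the list is an extension of \<open>A\<close> by \<open>K\<close>.\<close>

fun ext_list :: "('o,'m) abcat \<Rightarrow> 'o \<Rightarrow> ('o \<times> 'o \<times> 'm \<times> 'm) list \<Rightarrow> 'o \<Rightarrow> bool" where
  "ext_list C B [] A \<longleftrightarrow> B = A \<and> B \<in> Ob C"
| "ext_list C B ((E,K,i,p) # S) A \<longleftrightarrow> short_exact C B E K i p \<and> ext_list C K S A"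

text \<open>The pushforward of \<open>S\<close> along \<open>g : B \<rightarrow> B'\<close> has zero class.\<close>

fun vanishes :: "('o,'m) abcat \<Rightarrow> ('o \<times> 'o \<times> 'm \<times> 'm) list \<Rightarrow> 'o \<Rightarrow> 'o \<Rightarrow> 'm \<Rightarrow> bool" where
  "vanishes C [] B B' g \<longleftrightarrow> g = zer C B B'"
| "vanishes C ((E,K,i,p) # S) B B' g \<longleftrightarrow>
     (\<exists>R J j q \<phi> g'. short_exact C B' R J j q \<and> \<phi> \<in> Hom C E R \<and> cmp C \<phi> i = cmp C j g \<and>
        g' \<in> Hom C K J \<and> cmp C g' p = cmp C q \<phi> \<and> vanishes C S K J g')"

text \<open>With identities at both ends this is an elementary step of Yoneda equivalence, see
  \<open>yext_mor_iff\<close>. General end components are what pushouts and pullbacks of extensions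
  produce.\<close>

fun ext_mor :: "('o,'m) abcat \<Rightarrow> ('o \<times> 'o \<times> 'm \<times> 'm) list \<Rightarrow> ('o \<times> 'o \<times> 'm \<times> 'm) list \<Rightarrow>
    'm \<Rightarrow> 'm \<Rightarrow> bool" where
  "ext_mor C [] [] k h \<longleftrightarrow> k = h"
| "ext_mor C ((E,K,i,p) # S) ((E',K',i',p') # S') k h \<longleftrightarrow>
     (\<exists>\<phi>\<in>Hom C E E'. \<exists>m\<in>Hom C K K'. cmp C \<phi> i = cmp C i' k \<and> cmp C m p = cmp C p' \<phi> \<and>
        ext_mor C S S' m h)"
| "ext_mor C _ _ k h \<longleftrightarrow> False"

context abelian_cat begin

text \<open>Composition is kept nested to the right, so a known product g f is not a subterm of g f
  h; this applies the equation there.\<close>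

lemma comp_reassoc:
  "g \<bullet> f = x \<Longrightarrow> f \<in> Hom C a b \<Longrightarrow> g \<in> Hom C b c \<Longrightarrow> h \<in> Hom C d a \<Longrightarrow> g \<bullet> f \<bullet> h = x \<bullet> h"
  using comp_assoc by metis

lemma pull_back:
  assumes "short_exact C a b c f g" "h \<in> Hom C c' c"
  obtains P h' g' f' where "is_pullback C c b c' g h P h' g'" "short_exact C a P c' f' g'"
    "h' \<in> Hom C P b" "h' \<bullet> f' = f" "g \<bullet> h' = h \<bullet> g'"
  using pullback_ex[OF short_exact_props(2)[OF assms(1)] assms(2)] pullback_short_exact[OF _ assms(1)] is_pullbackD(3,5) by metis

lemma push_out:
  assumes "short_exact C a b c f g" "l \<in> Hom C a a'"
  obtains P l' f' g' where "is_pushout C a b a' f l P l' f'" "short_exact C a' P c f' g'"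
    "l' \<in> Hom C b P" "g' \<bullet> l' = g" "l' \<bullet> f = f' \<bullet> l"
  using pushout_ex[OF short_exact_props(1)[OF assms(1)] assms(2)] pushout_short_exact[OF _ assms(1)] is_pushoutD(3,5) by metis

section \<open>Composites and sums of vanishing classes\<close>

lemma ext_list_Ob: "ext_list C B S A \<Longrightarrow> B \<in> Ob C \<and> A \<in> Ob C"
proof (induction S arbitrary: B)
  case (Cons s S)
  then show ?case by (cases s) (auto dest: short_exact_Ob)
qed simp

lemma vanishes_ConsI:
  assumes "short_exact C B' R J j q" "\<phi> \<in> Hom C E R" "\<phi> \<bullet> i = j \<bullet> g"
    "g' \<in> Hom C K J" "g' \<bullet> p = q \<bullet> \<phi>" "vanishes C S K J g'"
  shows "vanishes C ((E,K,i,p) # S) B B' g"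
  unfolding vanishes.simps using assms by blast

lemma ext_list_append:
  "ext_list C B (S @ S') A \<longleftrightarrow> (\<exists>K. ext_list C B S K \<and> ext_list C K S' A)"
proof (induction S arbitrary: B)
  case (Cons s S)
  then show ?case by (cases s) auto
qed (auto dest: ext_list_Ob)

text \<open>Only the first row of the witness changes: it is pushed out along h, which preserves its
  cokernel J and with it the remaining rows.\<close>

lemma vanishes_comp:
  assumes "vanishes C S B B' g" "g \<in> Hom C B B'" "h \<in> Hom C B' B''" "ext_list C B S A"
  shows "vanishes C S B B'' (h \<bullet> g)"
proof (cases S)
  case Nil
  then show ?thesis using assms by (simp add: in_Hom_iff)
next
  case (Cons s S0)
  obtain E K i p where s: "s = (E,K,i,p)" by (cases s)
  obtain R J j q \<phi> g' where R: "short_exact C B' R J j q" "\<phi> \<in> Hom C E R" "\<phi> \<bullet> i = j \<bullet> g"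
    "g' \<in> Hom C K J" "g' \<bullet> p = q \<bullet> \<phi>" "vanishes C S0 K J g'"
    using assms(1) unfolding Cons s by auto
  have iH: "i \<in> Hom C B E" using assms(4) unfolding Cons s by (auto dest: short_exact_props)
  note SR = short_exact_props[OF R(1)]
  obtain P l' f' g1 where P: "short_exact C B'' P J f' g1" "l' \<in> Hom C R P" "g1 \<bullet> l' = q" "l' \<bullet> j = f' \<bullet> h"
    using push_out[OF R(1) assms(3)] by metis
  note SP = short_exact_props[OF P(1)]
  have "(l' \<bullet> \<phi>) \<bullet> i = l' \<bullet> j \<bullet> g" using comp_assoc[OF iH R(2) P(2)] R(3) by simp
  also have "\<dots> = f' \<bullet> h \<bullet> g" using comp_reassoc[OF P(4) SR(1) P(2) assms(2)] comp_assoc[OF assms(2,3) SP(1)] by simp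
  finally have 1: "(l' \<bullet> \<phi>) \<bullet> i = f' \<bullet> h \<bullet> g" .
  have 2: "g' \<bullet> p = g1 \<bullet> l' \<bullet> \<phi>" using comp_reassoc[OF P(3) P(2) SP(2) R(2)] R(5) by simp
  show ?thesis unfolding Cons s using vanishes_ConsI[OF P(1) comp_Hom[OF R(2) P(2)] 1 R(4) 2 R(6)] .
qed

lemma vanishes_zero:
  assumes "ext_list C B S A" "B' \<in> Ob C"
  shows "vanishes C S B B' (zer C B B')"
  using assms
proof (induction S arbitrary: B B')
  case (Cons s S)
  obtain E K i p where s: "s = (E,K,i,p)" by (cases s)
  have se: "short_exact C B E K i p" and S: "ext_list C K S A" using Cons.prems(1) s by auto
  note H = short_exact_props[OF se] and O = short_exact_Ob[OF se]
  obtain z where z: "z \<in> Ob C" "short_exact C B' B' z (idm C B') (zer C B' z)"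
    using zero_object Cons.prems(2) by metis
  have "vanishes C S K z (zer C K z)" using Cons.IH[OF S z(1)] .
  then show ?case unfolding s
    by (rule vanishes_ConsI[OF z(2), where \<phi> = "zer C E B'" and g' = "zer C K z", rotated -1])
      (use z(1) H(1,2) O Cons.prems(2) in \<open>simp_all add: in_Hom_iff\<close>)
qed simp

text \<open>If the map on B extends over E by u, the row B' = B' -> 0 with vertical map u is a
  witness, and all later components are zero. This is the main source of vanishing classes.\<close>

lemma vanishes_extends:
  assumes x: "ext_list C B ((E,K,i,p) # S) A" and u: "u \<in> Hom C E B'"
  shows "vanishes C ((E,K,i,p) # S) B B' (u \<bullet> i)"
proof -
  have se: "short_exact C B E K i p" and S: "ext_list C K S A" using x by auto
  note H = short_exact_props[OF se] and O = short_exact_Ob[OF se]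
  have B': "B' \<in> Ob C" using Hom_Ob[OF u] by simp
  obtain z where z: "z \<in> Ob C" "short_exact C B' B' z (idm C B') (zer C B' z)"
    using zero_object B' by metis
  have "vanishes C S K z (zer C K z)" using vanishes_zero[OF S z(1)] .
  then show ?thesis
    by (rule vanishes_ConsI[OF z(2) u, where g' = "zer C K z", rotated -1])
      (use z(1) H(1,2) O B' u in \<open>simp_all add: in_Hom_iff\<close>)
qed

text \<open>The two witnesses begin with different extensions R1 and R2 of B'. The pushout of j1 and
  j2 amalgamates them over B' into one row whose cokernel J receives J1 and J2, and there the
  vertical maps can be added.\<close>

lemma vanishes_plus:
  assumes "ext_list C B S A" "g1 \<in> Hom C B B'" "g2 \<in> Hom C B B'" "vanishes C S B B' g1" "vanishes C S B B' g2"
  shows "vanishes C S B B' (g1 \<oplus> g2)"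
  using assms
proof (induction S arbitrary: B B' g1 g2)
  case Nil
  then show ?case by (simp add: in_Hom_iff)
next
  case (Cons s S)
  obtain E K i p where s: "s = (E,K,i,p)" by (cases s)
  have se: "short_exact C B E K i p" and S: "ext_list C K S A" using Cons.prems(1) s by auto
  note H = short_exact_props[OF se]
  obtain R1 J1 j1 q1 \<phi>1 h1 where R1: "short_exact C B' R1 J1 j1 q1" "\<phi>1 \<in> Hom C E R1" "\<phi>1 \<bullet> i = j1 \<bullet> g1"
    "h1 \<in> Hom C K J1" "h1 \<bullet> p = q1 \<bullet> \<phi>1" "vanishes C S K J1 h1"
    using Cons.prems(4) unfolding s by auto
  obtain R2 J2 j2 q2 \<phi>2 h2 where R2: "short_exact C B' R2 J2 j2 q2" "\<phi>2 \<in> Hom C E R2" "\<phi>2 \<bullet> i = j2 \<bullet> g2"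
    "h2 \<in> Hom C K J2" "h2 \<bullet> p = q2 \<bullet> \<phi>2" "vanishes C S K J2 h2"
    using Cons.prems(5) unfolding s by auto
  note S1 = short_exact_props[OF R1(1)] and S2 = short_exact_props[OF R2(1)]
  obtain R r1 r2 where po: "is_pushout C B' R1 R2 j1 j2 R r1 r2" using pushout_ex[OF S1(1) S2(1)] by metis
  note P = is_pushoutD[OF po]
  define j where "j = r1 \<bullet> j1"
  have j2: "j = r2 \<bullet> j2" using P(5) j_def by simp
  have "is_mono C R1 R r1" using pushout_mono[OF P(8) S2(4)] .
  then have jm: "is_mono C B' R j" unfolding j_def using mono_comp[OF S1(4)] by blast
  obtain J q where q: "is_cokernel C B' R j J q" using cokernel_ex[OF is_monoD(1)[OF jm]] by metis
  have sj: "short_exact C B' R J j q" using short_exact_cokernelI[OF jm q] .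
  note SJ = short_exact_props[OF sj]
  have "(q \<bullet> r1) \<bullet> j1 = zer C B' J" "(q \<bullet> r2) \<bullet> j2 = zer C B' J"
    using SJ(3) comp_assoc[OF S1(1) P(3) SJ(2)] comp_assoc[OF S2(1) P(4) SJ(2)] j_def j2 by auto
  then obtain u1 u2 where u: "u1 \<in> Hom C J1 J" "u1 \<bullet> q1 = q \<bullet> r1" "u2 \<in> Hom C J2 J" "u2 \<bullet> q2 = q \<bullet> r2"
    using S1(7)[OF comp_Hom[OF P(3) SJ(2)]] S2(7)[OF comp_Hom[OF P(4) SJ(2)]] by metis
  let ?\<phi> = "r1 \<bullet> \<phi>1 \<oplus> r2 \<bullet> \<phi>2" and ?h = "u1 \<bullet> h1 \<oplus> u2 \<bullet> h2"
  have \<phi>H: "?\<phi> \<in> Hom C E R" using R1(2) R2(2) P(3,4) by (simp add: in_Hom_iff)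
  have hH: "?h \<in> Hom C K J" using R1(4) R2(4) u by (simp add: in_Hom_iff)
  have "?\<phi> \<bullet> i = r1 \<bullet> \<phi>1 \<bullet> i \<oplus> r2 \<bullet> \<phi>2 \<bullet> i" using R1(2) R2(2) P(3,4) H(1) by (simp add: in_Hom_iff)
  also have "\<dots> = (r1 \<bullet> j1) \<bullet> g1 \<oplus> (r2 \<bullet> j2) \<bullet> g2"
    unfolding R1(3) R2(3) using comp_assoc[OF _ S1(1) P(3)] comp_assoc[OF _ S2(1) P(4)] Cons.prems(2,3) by metis
  also have "\<dots> = j \<bullet> (g1 \<oplus> g2)"
    unfolding j_def[symmetric] j2[symmetric] using SJ(1) Cons.prems(2,3) by (simp add: in_Hom_iff)
  finally have 1: "?\<phi> \<bullet> i = j \<bullet> (g1 \<oplus> g2)" .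
  have "?h \<bullet> p = u1 \<bullet> h1 \<bullet> p \<oplus> u2 \<bullet> h2 \<bullet> p" using R1(4) R2(4) u(1,3) H(2) by (simp add: in_Hom_iff)
  also have "\<dots> = (u1 \<bullet> q1) \<bullet> \<phi>1 \<oplus> (u2 \<bullet> q2) \<bullet> \<phi>2"
    unfolding R1(5) R2(5) using comp_assoc[OF R1(2) S1(2) u(1)] comp_assoc[OF R2(2) S2(2) u(3)] by metis
  also have "\<dots> = q \<bullet> ?\<phi>"
    unfolding u(2,4) using SJ(2) R1(2) R2(2) P(3,4) by (simp add: in_Hom_iff)
  finally have 2: "?h \<bullet> p = q \<bullet> ?\<phi>" .
  have "vanishes C S K J ?h"
    by (rule Cons.IH[OF S]) (use vanishes_comp[OF R1(6,4) u(1) S] vanishes_comp[OF R2(6,4) u(3) S]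
        comp_Hom[OF R1(4) u(1)] comp_Hom[OF R2(4) u(3)] in simp_all)
  then show ?case unfolding s vanishes.simps using sj \<phi>H 1 hH 2 by blast
qed

section \<open>Transport of vanishing along morphisms of extensions\<close>

lemma ext_mor_Nil: "ext_mor C [] S' k h \<longleftrightarrow> S' = [] \<and> k = h"
  by (cases S') auto

lemma ext_mor_Cons:
  "ext_mor C ((E,K,i,p) # S) S' k h \<longleftrightarrow>
    (\<exists>E' K' i' p' S0' \<phi> m. S' = (E',K',i',p') # S0' \<and> \<phi> \<in> Hom C E E' \<and> m \<in> Hom C K K' \<and>
       \<phi> \<bullet> i = i' \<bullet> k \<and> m \<bullet> p = p' \<bullet> \<phi> \<and> ext_mor C S S0' m h)"
proof (cases S')
  case (Cons s S0)
  then show ?thesis by (cases s) (simp, blast)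
qed simp

text \<open>A witness out of S' composed with S -> S' is a witness out of S. The right component h
  may be arbitrary, since the zero component of the witness at that end absorbs it.\<close>

lemma vanishes_ext_mor:
  assumes "ext_mor C S S' k h" "ext_list C B S A" "ext_list C B' S' A'" "k \<in> Hom C B B'"
    "f \<in> Hom C B' B0" "vanishes C S' B' B0 f"
  shows "vanishes C S B B0 (f \<bullet> k)"
  using assms
proof (induction S arbitrary: S' B B' B0 f k)
  case Nil
  then show ?case by (auto simp: ext_mor_Nil in_Hom_iff)
next
  case (Cons s S)
  obtain E K i p where s: "s = (E,K,i,p)" by (cases s)
  obtain E' K' i' p' S0 \<phi> m where m: "S' = (E',K',i',p') # S0" "\<phi> \<in> Hom C E E'" "m \<in> Hom C K K'"
    "\<phi> \<bullet> i = i' \<bullet> k" "m \<bullet> p = p' \<bullet> \<phi>" "ext_mor C S S0 m h"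
    using Cons.prems(1) unfolding s ext_mor_Cons by metis
  have se: "short_exact C B E K i p" "short_exact C B' E' K' i' p'"
    and S: "ext_list C K S A" "ext_list C K' S0 A'" using Cons.prems(2,3) s m(1) by auto
  note H = short_exact_props[OF se(1)] and H' = short_exact_props[OF se(2)]
  obtain R J j q \<psi> g' where R: "short_exact C B0 R J j q" "\<psi> \<in> Hom C E' R" "\<psi> \<bullet> i' = j \<bullet> f"
    "g' \<in> Hom C K' J" "g' \<bullet> p' = q \<bullet> \<psi>" "vanishes C S0 K' J g'"
    using Cons.prems(6) unfolding m(1) by auto
  note SR = short_exact_props[OF R(1)]
  have "(\<psi> \<bullet> \<phi>) \<bullet> i = \<psi> \<bullet> i' \<bullet> k" using comp_assoc[OF H(1) m(2) R(2)] m(4) by simp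
  also have "\<dots> = j \<bullet> f \<bullet> k"
    using comp_reassoc[OF R(3) H'(1) R(2) Cons.prems(4)] comp_assoc[OF Cons.prems(4,5) SR(1)] by simp
  finally have 1: "(\<psi> \<bullet> \<phi>) \<bullet> i = j \<bullet> f \<bullet> k" .
  have "(g' \<bullet> m) \<bullet> p = g' \<bullet> p' \<bullet> \<phi>" using comp_assoc[OF H(2) m(3) R(4)] m(5) by simp
  also have "\<dots> = q \<bullet> \<psi> \<bullet> \<phi>"
    using comp_reassoc[OF R(5) H'(2) R(4) m(2)] comp_assoc[OF m(2) R(2) SR(2)] by simp
  finally have 2: "(g' \<bullet> m) \<bullet> p = q \<bullet> \<psi> \<bullet> \<phi>" .
  have "vanishes C S K J (g' \<bullet> m)" using Cons.IH[OF m(6) S m(3) R(4) R(6)] .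
  then show ?case unfolding s vanishes.simps
    using R(1) comp_Hom[OF m(2) R(2)] 1 comp_Hom[OF m(3) R(4)] 2 by blast
qed

text \<open>Here \<open>s\<close> is a homotopy between the two ways around the square. It is killed by enlarging \<open>P\<close>
  so that \<open>s\<close> extends over the next step of \<open>S\<close>, or, when there is no next step, by correcting \<open>e\<close>.\<close>

lemma vanishes_ext_mor_id_step:
  assumes se: "short_exact C B E K i p" "short_exact C B' E' K' i' p'"
    and S: "ext_list C K S A" "ext_list C K' S' A" "ext_mor C S S' m (idm C A)"
    and m: "\<phi> \<in> Hom C E E'" "m \<in> Hom C K K'" "\<phi> \<bullet> i = i' \<bullet> k" "m \<bullet> p = p' \<bullet> \<phi>" "k \<in> Hom C B B'"
    and R: "f \<in> Hom C B' R" "\<psi> \<in> Hom C E R" "\<psi> \<bullet> i = f \<bullet> k"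
  obtains P e r s where "e \<in> Hom C E' P" "is_mono C R P r" "s \<in> Hom C K P" "e \<bullet> i' = r \<bullet> f"
    "e \<bullet> \<phi> = s \<bullet> p \<oplus> r \<bullet> \<psi>" "\<And>c Q. c \<in> Hom C P Q \<Longrightarrow> vanishes C S K Q (c \<bullet> s)"
proof -
  note H = short_exact_props[OF se(1)] and H' = short_exact_props[OF se(2)] and O = short_exact_Ob[OF se(1)]
  obtain P e r p1 where P: "short_exact C R P K' r p1" "e \<in> Hom C E' P" "p1 \<bullet> e = p'" "e \<bullet> i' = r \<bullet> f"
    using push_out[OF se(2) R(1)] by metis
  note SP = short_exact_props[OF P(1)]
  note eH = comp_Hom[OF m(1) P(2)] and rH = comp_Hom[OF R(2) SP(1)]
  have "(e \<bullet> \<phi>) \<bullet> i = e \<bullet> i' \<bullet> k" using comp_assoc[OF H(1) m(1) P(2)] m(3) by simp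
  also have "\<dots> = r \<bullet> f \<bullet> k" using comp_reassoc[OF P(4) H'(1) P(2) m(5)] comp_assoc[OF m(5) R(1) SP(1)] by simp
  also have "\<dots> = (r \<bullet> \<psi>) \<bullet> i" using comp_assoc[OF H(1) R(2) SP(1)] R(3) by simp
  finally have "(e \<bullet> \<phi> \<oplus> neg (r \<bullet> \<psi>)) \<bullet> i = zer C B P"
    using minus_Hom(4)[OF eH rH H(1)] minus_Hom(2)[OF comp_Hom[OF H(1) eH] comp_Hom[OF H(1) rH]] by simp
  then obtain s where s: "s \<in> Hom C K P" "s \<bullet> p = e \<bullet> \<phi> \<oplus> neg (r \<bullet> \<psi>)"
    using H(7)[OF minus_Hom(1)[OF eH rH]] by blast
  have "s \<bullet> p \<oplus> r \<bullet> \<psi> = e \<bullet> \<phi> \<oplus> (neg (r \<bullet> \<psi>) \<oplus> r \<bullet> \<psi>)"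
    unfolding s(2) by (rule plus_assoc) (use eH rH in \<open>simp_all add: in_Hom_iff\<close>)
  also have "\<dots> = e \<bullet> \<phi>" using eH rH by (simp add: in_Hom_iff)
  finally have s': "e \<bullet> \<phi> = s \<bullet> p \<oplus> r \<bullet> \<psi>" by simp
  show thesis
  proof (cases S)
    case Nil
    then have S': "S' = []" "m = idm C A" "K = A" "K' = A" using S by (simp_all add: ext_mor_Nil)
    \<comment> \<open>Here m is the identity, so s p' phi = s p: subtracting s p' from e cancels the
      homotopy and leaves e i' unchanged.\<close>
    let ?e = "e \<oplus> neg (s \<bullet> p')"
    have sp: "s \<bullet> p' \<in> Hom C E' P" using comp_Hom[OF H'(2)] s S' by simp
    have "(s \<bullet> p') \<bullet> i' = zer C B' P" using comp_assoc[OF H'(1,2), of s P] s S' H'(3) short_exact_Ob[OF se(2)]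
      by (simp add: in_Hom_iff)
    then have 1: "?e \<bullet> i' = r \<bullet> f" using minus_Hom(4)[OF P(2) sp H'(1)] P(2,4) H'(1) R(1) SP(1)
      by (simp add: in_Hom_iff)
    have "(s \<bullet> p') \<bullet> \<phi> = s \<bullet> m \<bullet> p" using comp_assoc[OF m(1) H'(2), of s P] m(4) s S' by simp
    then have "(s \<bullet> p') \<bullet> \<phi> = s \<bullet> p" unfolding S'(2) using H(2) S' by (simp add: in_Hom_iff)
    then have "?e \<bullet> \<phi> = (s \<bullet> p \<oplus> r \<bullet> \<psi>) \<oplus> neg (s \<bullet> p)" using minus_Hom(4)[OF P(2) sp m(1)] s' by simp
    also have "\<dots> = (r \<bullet> \<psi> \<oplus> s \<bullet> p) \<oplus> neg (s \<bullet> p)"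
      using plus_comm[of "s \<bullet> p" "r \<bullet> \<psi>"] s(1) rH H(2) by (simp add: in_Hom_iff)
    also have "\<dots> = r \<bullet> \<psi> \<oplus> (s \<bullet> p \<oplus> neg (s \<bullet> p))"
      by (rule plus_assoc) (use s(1) rH H(2) in \<open>simp_all add: in_Hom_iff\<close>)
    also have "\<dots> = zer C K P \<bullet> p \<oplus> r \<bullet> \<psi>" using s(1) rH H(2) by (simp add: in_Hom_iff)
    finally have 2: "?e \<bullet> \<phi> = zer C K P \<bullet> p \<oplus> r \<bullet> \<psi>" .
    show ?thesis
      by (rule that[OF minus_Hom(1)[OF P(2) sp] SP(4) _ 1 2]) (use s(1) Nil in \<open>auto simp: in_Hom_iff\<close>)
  next
    case (Cons s2 S2)
    obtain E2 K2 i2 p2 where s2: "s2 = (E2,K2,i2,p2)" by (cases s2)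
    have se2: "short_exact C K E2 K2 i2 p2" using S(1) Cons s2 by simp
    note H2 = short_exact_props[OF se2]
    \<comment> \<open>After the pushout along s the composite t s = x i2 extends over E2, so
      \<open>vanishes_extends\<close> applies to it and to every further composite.\<close>
    obtain P' x t p3 where P': "short_exact C P P' K2 t p3" "x \<in> Hom C E2 P'" "x \<bullet> i2 = t \<bullet> s"
      using push_out[OF se2 s(1)] by metis
    note SP' = short_exact_props[OF P'(1)]
    have 1: "(t \<bullet> e) \<bullet> i' = (t \<bullet> r) \<bullet> f"
      using comp_assoc[OF H'(1) P(2) SP'(1)] comp_assoc[OF R(1) SP(1) SP'(1)] P(4) by simp
    have "(t \<bullet> e) \<bullet> \<phi> = t \<bullet> (s \<bullet> p \<oplus> r \<bullet> \<psi>)" using comp_assoc[OF m(1) P(2) SP'(1)] s' by simp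
    also have "\<dots> = (t \<bullet> s) \<bullet> p \<oplus> (t \<bullet> r) \<bullet> \<psi>"
      using SP'(1) s(1) H(2) SP(1) R(2) by (simp add: in_Hom_iff)
    finally have 2: "(t \<bullet> e) \<bullet> \<phi> = (t \<bullet> s) \<bullet> p \<oplus> (t \<bullet> r) \<bullet> \<psi>" .
    have 3: "vanishes C S K Q (c \<bullet> t \<bullet> s)" if c: "c \<in> Hom C P' Q" for c Q
      using vanishes_extends[OF S(1)[unfolded Cons s2] comp_Hom[OF P'(2) c]] comp_assoc[OF H2(1) P'(2) c] P'(3)
      unfolding Cons s2 by simp
    show ?thesis
      by (rule that[OF comp_Hom[OF P(2) SP'(1)] mono_comp[OF SP(4) SP'(4)] comp_Hom[OF s(1) SP'(1)] 1 2 3])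
  qed
qed

text \<open>The direction against composition. The first row R of the witness is enlarged to P so
  that E' maps to it, with L the cokernel of B0 in P. On the cokernels this gives g1 : K' -> L, and
  g1 m is the sum of u g', which vanishes by the old witness, and of q1 s, which vanishes by the
  choice of P. The induction hypothesis for m then applies to g1.\<close>

lemma vanishes_ext_mor_id:
  assumes "ext_mor C S S' k (idm C A)" "ext_list C B S A" "ext_list C B' S' A" "k \<in> Hom C B B'"
    "f \<in> Hom C B' B0" "vanishes C S B B0 (f \<bullet> k)"
  shows "vanishes C S' B' B0 f"
  using assms
proof (induction S arbitrary: S' B B' B0 f k)
  case Nil
  then show ?case by (auto simp: ext_mor_Nil in_Hom_iff)
next
  case (Cons s S)
  obtain E K i p where s: "s = (E,K,i,p)" by (cases s)
  obtain E' K' i' p' S0 \<phi> m where m: "S' = (E',K',i',p') # S0" "\<phi> \<in> Hom C E E'" "m \<in> Hom C K K'"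
    "\<phi> \<bullet> i = i' \<bullet> k" "m \<bullet> p = p' \<bullet> \<phi>" "ext_mor C S S0 m (idm C A)"
    using Cons.prems(1) unfolding s ext_mor_Cons by metis
  have se: "short_exact C B E K i p" "short_exact C B' E' K' i' p'"
    and S: "ext_list C K S A" "ext_list C K' S0 A" using Cons.prems(2,3) s m(1) by auto
  note H = short_exact_props[OF se(1)] and H' = short_exact_props[OF se(2)]
  note kH = Cons.prems(4) and fH = Cons.prems(5)
  obtain R J j q \<psi> g' where R: "short_exact C B0 R J j q" "\<psi> \<in> Hom C E R" "\<psi> \<bullet> i = j \<bullet> f \<bullet> k"
    "g' \<in> Hom C K J" "g' \<bullet> p = q \<bullet> \<psi>" "vanishes C S K J g'"
    using Cons.prems(6) unfolding s by auto
  note SR = short_exact_props[OF R(1)]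
  have Rk: "\<psi> \<bullet> i = (j \<bullet> f) \<bullet> k" using R(3) comp_assoc[OF kH fH SR(1)] by simp
  obtain P e r s where P: "e \<in> Hom C E' P" "is_mono C R P r" "s \<in> Hom C K P" "e \<bullet> i' = r \<bullet> j \<bullet> f"
    "e \<bullet> \<phi> = s \<bullet> p \<oplus> r \<bullet> \<psi>" "\<And>c Q. c \<in> Hom C P Q \<Longrightarrow> vanishes C S K Q (c \<bullet> s)"
    using vanishes_ext_mor_id_step[OF se S m(6) m(2-5) kH comp_Hom[OF fH SR(1)] R(2) Rk] by metis
  note rH = is_monoD(1)[OF P(2)]
  have jm: "is_mono C B0 P (r \<bullet> j)" using mono_comp[OF SR(4) P(2)] .
  obtain L q1 where q1: "is_cokernel C B0 P (r \<bullet> j) L q1" using cokernel_ex[OF is_monoD(1)[OF jm]] by metis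
  have sj: "short_exact C B0 P L (r \<bullet> j) q1" using short_exact_cokernelI[OF jm q1] .
  note SJ = short_exact_props[OF sj] and OJ = short_exact_Ob[OF sj]
  have "(q1 \<bullet> e) \<bullet> i' = (q1 \<bullet> r \<bullet> j) \<bullet> f"
    using comp_assoc[OF H'(1) P(1) SJ(2)] P(4) comp_assoc[OF fH SR(1) rH] comp_assoc[OF fH SJ(1) SJ(2)] by simp
  then have "(q1 \<bullet> e) \<bullet> i' = zer C B' L" unfolding SJ(3) using fH OJ by (simp add: in_Hom_iff)
  then obtain g1 where g1: "g1 \<in> Hom C K' L" "g1 \<bullet> p' = q1 \<bullet> e" using H'(7)[OF comp_Hom[OF P(1) SJ(2)]] by blast
  have "(q1 \<bullet> r) \<bullet> j = zer C B0 L" using SJ(3) comp_assoc[OF SR(1) rH SJ(2)] by simp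
  then obtain u where u: "u \<in> Hom C J L" "u \<bullet> q = q1 \<bullet> r" using SR(7)[OF comp_Hom[OF rH SJ(2)]] by blast
  have "(g1 \<bullet> m) \<bullet> p = g1 \<bullet> p' \<bullet> \<phi>" using comp_assoc[OF H(2) m(3) g1(1)] m(5) by simp
  also have "\<dots> = q1 \<bullet> e \<bullet> \<phi>" using comp_reassoc[OF g1(2) H'(2) g1(1) m(2)] comp_assoc[OF m(2) P(1) SJ(2)] by simp
  also have "\<dots> = (q1 \<bullet> s) \<bullet> p \<oplus> (q1 \<bullet> r) \<bullet> \<psi>"
    unfolding P(5) using SJ(2) P(3) H(2) rH R(2) by (simp add: in_Hom_iff)
  also have "(q1 \<bullet> r) \<bullet> \<psi> = (u \<bullet> g') \<bullet> p"
    using u(2)[symmetric] comp_assoc[OF R(2) SR(2) u(1)] comp_assoc[OF H(2) R(4) u(1)] R(5) by simp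
  also have "(q1 \<bullet> s) \<bullet> p \<oplus> (u \<bullet> g') \<bullet> p = (q1 \<bullet> s \<oplus> u \<bullet> g') \<bullet> p"
    using SJ(2) P(3) H(2) u(1) R(4) by (simp add: in_Hom_iff)
  finally have "(g1 \<bullet> m) \<bullet> p = (q1 \<bullet> s \<oplus> u \<bullet> g') \<bullet> p" .
  moreover have sH: "q1 \<bullet> s \<in> Hom C K L" "u \<bullet> g' \<in> Hom C K L"
    using comp_Hom[OF P(3) SJ(2)] comp_Hom[OF R(4) u(1)] by auto
  moreover have "q1 \<bullet> s \<oplus> u \<bullet> g' \<in> Hom C K L" using sH by (simp add: in_Hom_iff)
  ultimately have "g1 \<bullet> m = q1 \<bullet> s \<oplus> u \<bullet> g'" using epi_cancel[OF H(5) comp_Hom[OF m(3) g1(1)]] by blast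
  then have "vanishes C S K L (g1 \<bullet> m)"
    using vanishes_plus[OF S(1) sH P(6)[OF SJ(2)] vanishes_comp[OF R(6) R(4) u(1) S(1)]] by simp
  then have "vanishes C S0 K' L g1" using Cons.IH[OF m(6) S m(3) g1(1)] by blast
  moreover have "e \<bullet> i' = (r \<bullet> j) \<bullet> f" using P(4) comp_assoc[OF fH SR(1) rH] by simp
  ultimately show ?case unfolding m(1) vanishes.simps using sj P(1) g1 by blast
qed

end


section \<open>Dimension shifting\<close>

definition ext_vanishes :: "('o,'m) abcat \<Rightarrow> nat \<Rightarrow> 'o \<Rightarrow> 'o \<Rightarrow> bool" where
  "ext_vanishes C n A B \<longleftrightarrow>
     (\<forall>S. ext_list C B S A \<longrightarrow> length S = n \<longrightarrow> vanishes C S B B (idm C B))"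

context abelian_cat begin

section \<open>Extensions read from the A end\<close>

lemma ext_mor_refl:
  assumes "ext_list C B S A" shows "ext_mor C S S (idm C B) (idm C A)"
  using assms
proof (induction S arbitrary: B)
  case (Cons s S)
  obtain E K i p where s: "s = (E,K,i,p)" by (cases s)
  have se: "short_exact C B E K i p" and S: "ext_list C K S A" using Cons.prems s by auto
  note H = short_exact_props[OF se] and O = short_exact_Ob[OF se]
  show ?case unfolding s ext_mor.simps
    by (rule bexI[of _ "idm C E"], rule bexI[of _ "idm C K"])
      (use Cons.IH[OF S] H(1,2) O in \<open>simp_all add: in_Hom_iff\<close>)
qed simp

text \<open>The lists recurse from the B end, whereas shifting in the first variable alters the step
  next to A; this gives access to morphisms from that end.\<close>

lemma ext_mor_snoc:
  "ext_mor C S (R @ [(E',A',i',p')]) k h \<longleftrightarrow>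
    (\<exists>S0 E A i p \<phi> m. S = S0 @ [(E,A,i,p)] \<and> ext_mor C S0 R k m \<and> \<phi> \<in> Hom C E E' \<and> h \<in> Hom C A A' \<and>
       \<phi> \<bullet> i = i' \<bullet> m \<and> h \<bullet> p = p' \<bullet> \<phi>)" (is "?L S R k \<longleftrightarrow> ?R S R k")
proof
  show "?L S R k \<Longrightarrow> ?R S R k"
  proof (induction R arbitrary: S k)
    case Nil
    then obtain E A i p S1 where S: "S = (E,A,i,p) # S1" by (cases S) auto
    with Nil obtain \<phi> m where "\<phi> \<in> Hom C E E'" "m \<in> Hom C A A'" "\<phi> \<bullet> i = i' \<bullet> k" "m \<bullet> p = p' \<bullet> \<phi>"
      "ext_mor C S1 [] m h" by auto
    moreover from this have "S1 = []" "m = h" by (cases S1; simp)+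
    ultimately show ?case using S ext_mor.simps(1)
      by (intro exI[of _ "[]"] exI[of _ E] exI[of _ A] exI[of _ i] exI[of _ p] exI[of _ \<phi>] exI[of _ k]) simp
  next
    case (Cons r R)
    obtain F L a b where r: "r = (F,L,a,b)" by (cases r)
    from Cons.prems obtain E A i p S1 where S: "S = (E,A,i,p) # S1" by (cases S) auto
    with Cons.prems r obtain \<phi> m where m: "\<phi> \<in> Hom C E F" "m \<in> Hom C A L" "\<phi> \<bullet> i = a \<bullet> k" "m \<bullet> p = b \<bullet> \<phi>"
      "ext_mor C S1 (R @ [(E',A',i',p')]) m h" by auto
    obtain S0 E2 A2 i2 p2 \<phi>2 m2 where 2: "S1 = S0 @ [(E2,A2,i2,p2)]" "ext_mor C S0 R m m2"
      "\<phi>2 \<in> Hom C E2 E'" "h \<in> Hom C A2 A'" "\<phi>2 \<bullet> i2 = i' \<bullet> m2" "h \<bullet> p2 = p' \<bullet> \<phi>2"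
      using Cons.IH[OF m(5)] by metis
    have "ext_mor C ((E,A,i,p) # S0) (r # R) k m2" unfolding r using m(1-4) 2(2) by auto
    moreover have "S = ((E,A,i,p) # S0) @ [(E2,A2,i2,p2)]" using S 2(1) by simp
    ultimately show ?case using 2(3-6) by blast
  qed
  have "ext_mor C S0 R k m \<Longrightarrow> \<phi> \<in> Hom C E E' \<Longrightarrow> h \<in> Hom C A A' \<Longrightarrow> \<phi> \<bullet> i = i' \<bullet> m \<Longrightarrow>
      h \<bullet> p = p' \<bullet> \<phi> \<Longrightarrow> ext_mor C (S0 @ [(E,A,i,p)]) (R @ [(E',A',i',p')]) k h" for S0 E A i p \<phi> m
  proof (induction S0 arbitrary: R k)
    case Nil
    then show ?case by (auto simp: ext_mor_Nil)
  next
    case (Cons s S0)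
    obtain E K i p where s: "s = (E,K,i,p)" by (cases s)
    with Cons.prems(1) obtain E2 K2 i2 p2 R0 \<phi> m2 where R: "R = (E2,K2,i2,p2) # R0" "\<phi> \<in> Hom C E E2" "m2 \<in> Hom C K K2"
      "\<phi> \<bullet> i = i2 \<bullet> k" "m2 \<bullet> p = p2 \<bullet> \<phi>" "ext_mor C S0 R0 m2 m"
      using ext_mor_Cons[of E K i p S0 R k m] by auto
    then show ?case unfolding s R(1) append_Cons ext_mor.simps
      using Cons.IH[OF R(6) Cons.prems(2-5)] R(2-5) by blast
  qed
  then show "?R S R k \<Longrightarrow> ?L S R k" by blast
qed

lemma ext_mor_Hom:
  assumes "ext_mor C S S' k h" "ext_list C B S A" "ext_list C B' S' A'" "k \<in> Hom C B B'"
  shows "h \<in> Hom C A A'"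
  using assms
proof (induction S arbitrary: S' B B' k)
  case Nil
  then show ?case by (auto simp: ext_mor_Nil)
next
  case (Cons s S)
  obtain E K i p where s: "s = (E,K,i,p)" by (cases s)
  then show ?case using Cons.prems Cons.IH by (auto simp: ext_mor_Cons)
qed

text \<open>A zero component at A forces the last map out of E into the kernel of q, so it comes
  from some l : E -> J. Thus a vanishing class yields a morphism from the shorter extension S whose
  right component factors through i. This is exactness at the source of the connecting map, the
  starting point of all shifting lemmas.\<close>

lemma vanishes_snoc:
  assumes "ext_list C B S K" "short_exact C K E A i p" "g \<in> Hom C B B'"
    "vanishes C (S @ [(E,A,i,p)]) B B' g"
  shows "\<exists>R J l. ext_list C B' R J \<and> length R = length S \<and> l \<in> Hom C E J \<and> ext_mor C S R g (l \<bullet> i)"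
  using assms
proof (induction S arbitrary: B B' g)
  case Nil
  then have K: "K = B" by simp
  note H = short_exact_props[OF Nil(2)] and O = short_exact_Ob[OF Nil(2)]
  obtain R J j q \<phi> where R: "short_exact C B' R J j q" "\<phi> \<in> Hom C E R" "\<phi> \<bullet> i = j \<bullet> g"
    "zer C A J \<bullet> p = q \<bullet> \<phi>"
    using Nil(4) by auto
  note SR = short_exact_props[OF R(1)] and OR = short_exact_Ob[OF R(1)]
  have "q \<bullet> \<phi> = zer C E J" using R(4) H(2) OR by (simp add: in_Hom_iff)
  then obtain l where l: "l \<in> Hom C E B'" "j \<bullet> l = \<phi>" using SR(6)[OF R(2)] by blast
  have "j \<bullet> l \<bullet> i = j \<bullet> g" using comp_assoc[OF H(1) l(1) SR(1)] l(2) R(3) by simp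
  then have "l \<bullet> i = g" using mono_cancel[OF SR(4) comp_Hom[OF H(1) l(1)]] Nil(3) K by blast
  then show ?case using l(1) OR(1) by (intro exI[of _ "[]"] exI[of _ B'] exI[of _ l]) simp
next
  case (Cons s S)
  obtain F L a b where s: "s = (F,L,a,b)" by (cases s)
  have se: "short_exact C B F L a b" and S: "ext_list C L S K" using Cons.prems(1) s by auto
  obtain R J j q \<phi> g' where R: "short_exact C B' R J j q" "\<phi> \<in> Hom C F R" "\<phi> \<bullet> a = j \<bullet> g"
    "g' \<in> Hom C L J" "g' \<bullet> b = q \<bullet> \<phi>" "vanishes C (S @ [(E,A,i,p)]) L J g'"
    using Cons.prems(4) unfolding s by auto
  obtain R1 J1 l where 1: "ext_list C J R1 J1" "length R1 = length S" "l \<in> Hom C E J1" "ext_mor C S R1 g' (l \<bullet> i)"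
    using Cons.IH[OF S Cons.prems(2) R(4,6)] by blast
  have "ext_list C B' ((R,J,j,q) # R1) J1" using R(1) 1(1) by simp
  moreover have "ext_mor C (s # S) ((R,J,j,q) # R1) g (l \<bullet> i)" unfolding s using R(2-5) 1(4) by auto
  ultimately show ?case using 1(2,3) by (metis length_Cons)
qed

lemma vanishes_append:
  assumes "vanishes C S B B' g" "ext_list C B (S @ S') A" "g \<in> Hom C B B'"
  shows "vanishes C (S @ S') B B' g"
  using assms
proof (induction S arbitrary: B B' g)
  case Nil
  then show ?case using vanishes_zero Hom_Ob by auto
next
  case (Cons s S)
  obtain E K i p where s: "s = (E,K,i,p)" by (cases s)
  obtain R J j q \<phi> g' where R: "short_exact C B' R J j q" "\<phi> \<in> Hom C E R" "\<phi> \<bullet> i = j \<bullet> g"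
    "g' \<in> Hom C K J" "g' \<bullet> p = q \<bullet> \<phi>" "vanishes C S K J g'"
    using Cons.prems(1) unfolding s by auto
  have "ext_list C K (S @ S') A" using Cons.prems(2) s by simp
  then have "vanishes C (S @ S') K J g'" using Cons.IH R(4,6) by blast
  then show ?case unfolding s append_Cons using vanishes_ConsI R(1-5) by blast
qed

lemma ext_list_snocE:
  assumes "ext_list C B S A" "S \<noteq> []"
  obtains S0 E i p K where "S = S0 @ [(E,A,i,p)]" "ext_list C B S0 K" "short_exact C K E A i p"
proof -
  obtain S0 s where S: "S = S0 @ [s]" using assms(2) by (cases S rule: rev_cases) auto
  obtain E A' i p where s: "s = (E,A',i,p)" by (cases s)
  show thesis using that assms(1) unfolding S s by (auto simp: ext_list_append)
qed

lemma ext_list_snocI: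
  assumes "ext_list C B S K" "short_exact C K E A i p"
  shows "ext_list C B (S @ [(E,A,i,p)]) A"
  using assms short_exact_Ob[OF assms(2)] by (auto simp: ext_list_append)

text \<open>Only the step next to the right end is pulled back. The last property is its
  universality: a morphism into R whose right component factors through l comes from one into R1.
  With R empty there is no step to pull back, which is why degree zero is treated separately
  later.\<close>

lemma ext_list_pull_back:
  assumes R: "ext_list C B' R J" "R \<noteq> []" and l: "l \<in> Hom C A J"
  obtains R1 where "ext_list C B' R1 A" "length R1 = length R" "ext_mor C R1 R (idm C B') l"
    "\<And>S B A' f g. ext_list C B S A' \<Longrightarrow> g \<in> Hom C B B' \<Longrightarrow> f \<in> Hom C A' A \<Longrightarrow>
       ext_mor C S R g (l \<bullet> f) \<Longrightarrow> ext_mor C S R1 g f"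
proof -
  obtain R0 E i p K where R0: "R = R0 @ [(E,J,i,p)]" "ext_list C B' R0 K" "short_exact C K E J i p"
    using ext_list_snocE[OF R] by metis
  note SR = short_exact_props[OF R0(3)] and OR = short_exact_Ob[OF R0(3)]
  obtain P h' p' i' where P: "is_pullback C J E A p l P h' p'" "short_exact C K P A i' p'" "h' \<in> Hom C P E"
    "h' \<bullet> i' = i" "p \<bullet> h' = l \<bullet> p'" using pull_back[OF R0(3) l] by metis
  note SP = short_exact_props[OF P(2)]
  let ?R1 = "R0 @ [(P,A,i',p')]"
  show thesis
  proof
    show "ext_list C B' ?R1 A" using ext_list_snocI[OF R0(2) P(2)] .
    show "length ?R1 = length R" using R0(1) by simp
    have "h' \<bullet> i' = i \<bullet> idm C K" using P(4) SR(1) by (simp add: in_Hom_iff)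
    then show "ext_mor C ?R1 R (idm C B') l"
      unfolding R0(1) ext_mor_snoc using ext_mor_refl[OF R0(2)] P(3) P(5)[symmetric] l by blast
    fix S B A' f g assume S: "ext_list C B S A'" and g: "g \<in> Hom C B B'" and f: "f \<in> Hom C A' A"
      and "ext_mor C S R g (l \<bullet> f)"
    then obtain S0 E2 A2 i2 p2 \<phi> m where m: "S = S0 @ [(E2,A2,i2,p2)]" "ext_mor C S0 R0 g m"
      "\<phi> \<in> Hom C E2 E" "\<phi> \<bullet> i2 = i \<bullet> m" "(l \<bullet> f) \<bullet> p2 = p \<bullet> \<phi>"
      unfolding R0(1) ext_mor_snoc by metis
    obtain K2 where K2: "ext_list C B S0 K2" "short_exact C K2 E2 A' i2 p2" and A2: "A2 = A'"
      using S unfolding m(1) by (auto simp: ext_list_append)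
    note S2 = short_exact_props[OF K2(2)] and O2 = short_exact_Ob[OF K2(2)]
    have mH: "m \<in> Hom C K2 K" using ext_mor_Hom[OF m(2) K2(1) R0(2) g] .
    have "p \<bullet> \<phi> = l \<bullet> f \<bullet> p2" using m(5) comp_assoc[OF S2(2) f l] by simp
    then obtain w where w: "w \<in> Hom C E2 P" "h' \<bullet> w = \<phi>" "p' \<bullet> w = f \<bullet> p2"
      using is_pullbackD(6)[OF P(1) m(3) comp_Hom[OF S2(2) f]] by blast
    have "w \<bullet> i2 = i' \<bullet> m"
    proof (rule is_pullbackD(7)[OF P(1) comp_Hom[OF S2(1) w(1)] comp_Hom[OF mH SP(1)]])
      show "h' \<bullet> w \<bullet> i2 = h' \<bullet> i' \<bullet> m"
        using comp_assoc[OF S2(1) w(1) P(3)] comp_assoc[OF mH SP(1) P(3)] w(2) m(4) P(4) by simp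
      have "p' \<bullet> w \<bullet> i2 = f \<bullet> p2 \<bullet> i2"
        using comp_assoc[OF S2(1) w(1) SP(2)] w(3) comp_assoc[OF S2(1) S2(2) f] by simp
      also have "\<dots> = (p' \<bullet> i') \<bullet> m" unfolding S2(3) SP(3) using f mH O2 by (simp add: in_Hom_iff)
      finally show "p' \<bullet> w \<bullet> i2 = p' \<bullet> i' \<bullet> m" using comp_assoc[OF mH SP(1) SP(2)] by simp
    qed
    then show "ext_mor C S ?R1 g f" unfolding ext_mor_snoc using m(1,2) w(1,3) f A2 by metis
  qed
qed

section \<open>Exactness of the long sequence in the first variable\<close>

lemma vanishes_snoc_id:
  assumes "ext_list C B S K" "short_exact C K E A i p" "ext_vanishes C n A B" "n = Suc (length S)"
  obtains R J l where "ext_list C B R J" "length R = length S" "l \<in> Hom C E J"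
    "ext_mor C S R (idm C B) (l \<bullet> i)"
proof -
  have "vanishes C (S @ [(E,A,i,p)]) B B (idm C B)"
    using assms(3,4) ext_list_snocI[OF assms(1,2)] unfolding ext_vanishes_def by auto
  then show thesis
    using vanishes_snoc[OF assms(1,2) id_Hom] ext_list_Ob[OF assms(1)] that by blast
qed

lemma vanishes_id_ext_mor:
  assumes "ext_mor C S S' (idm C B) h" "ext_list C B S A" "ext_list C B S' A'"
    "vanishes C S' B B (idm C B)"
  shows "vanishes C S B B (idm C B)"
proof -
  have B: "B \<in> Ob C" using ext_list_Ob assms(2) by blast
  show ?thesis using vanishes_ext_mor[OF assms(1-3) id_Hom[OF B] id_Hom[OF B] assms(4)] B by simp
qed

lemma vanishes_id_ext_mor_id:
  assumes "ext_mor C S S' (idm C B) (idm C A)" "ext_list C B S A" "ext_list C B S' A"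
    "vanishes C S B B (idm C B)"
  shows "vanishes C S' B B (idm C B)"
proof -
  have B: "B \<in> Ob C" using ext_list_Ob assms(2) by blast
  show ?thesis
    by (rule vanishes_ext_mor_id[OF assms(1-3) id_Hom[OF B] id_Hom[OF B]]) (use assms(4) B in simp)
qed

text \<open>The segment Ext^n(A,B) -> Ext^n(A',B) -> Ext^(n+1)(A'',B). Splicing S with the given
  sequence produces a vanishing class, so S maps with right component f to an extension of A by B,
  and that one vanishes.\<close>

lemma ext_vanishes_kernel:
  assumes se: "short_exact C A' A A'' f g" and "n \<ge> 1"
    and 1: "ext_vanishes C n A B" and 2: "ext_vanishes C (Suc n) A'' B"
  shows "ext_vanishes C n A' B"
  unfolding ext_vanishes_def
proof (intro allI impI)
  fix S assume S: "ext_list C B S A'" "length S = n"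
  note H = short_exact_props[OF se] and B = ext_list_Ob[OF S(1)]
  obtain R J l where R: "ext_list C B R J" "length R = length S" "l \<in> Hom C A J"
    "ext_mor C S R (idm C B) (l \<bullet> f)" using vanishes_snoc_id[OF S(1) se 2] S(2) by metis
  have "R \<noteq> []" using R(2) S(2) assms(2) by auto
  then obtain R1 where R1: "ext_list C B R1 A" "length R1 = length R" "ext_mor C S R1 (idm C B) f"
    using ext_list_pull_back[OF R(1) _ R(3)] S(1) H(1) R(4) id_Hom B by metis
  then have "vanishes C R1 B B (idm C B)" using 1 R(2) S(2) unfolding ext_vanishes_def by simp
  then show "vanishes C S B B (idm C B)" using vanishes_id_ext_mor R1 S(1) by blast
qed

text \<open>The pullback of S along f vanishes, which gives l from the pulled back object P to J.
  Now P lies in E with quotient A''; pushing out along l produces an extension of A'' by B to which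
  S maps with right component g.\<close>

lemma ext_vanishes_extension:
  assumes se: "short_exact C A' A A'' f g" and "n \<ge> 1"
    and 1: "ext_vanishes C n A' B" and 2: "ext_vanishes C n A'' B"
  shows "ext_vanishes C n A B"
  unfolding ext_vanishes_def
proof (intro allI impI)
  fix S assume S: "ext_list C B S A" "length S = n"
  note H = short_exact_props[OF se] and B = ext_list_Ob[OF S(1)]
  have "S \<noteq> []" using S(2) assms(2) by auto
  then obtain S0 E i p K where S0: "S = S0 @ [(E,A,i,p)]" "ext_list C B S0 K" "short_exact C K E A i p"
    using ext_list_snocE[OF S(1)] by metis
  note SE = short_exact_props[OF S0(3)]
  obtain P h' p1 i1 where P: "is_pullback C A E A' p f P h' p1" "short_exact C K P A' i1 p1" "h' \<in> Hom C P E"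
    "h' \<bullet> i1 = i" using pull_back[OF S0(3) H(1)] by metis
  note SP = short_exact_props[OF P(2)]
  have PE: "short_exact C P E A'' h' (g \<bullet> p)" using pullback_short_exact_mono[OF P(1) se SE(5)] .
  obtain R J l where R: "ext_list C B R J" "length R = length S0" "l \<in> Hom C P J"
    "ext_mor C S0 R (idm C B) (l \<bullet> i1)" using vanishes_snoc_id[OF S0(2) P(2) 1] S(2) S0(1) by auto
  obtain V l' j v where V: "short_exact C J V A'' j v" "l' \<in> Hom C E V" "v \<bullet> l' = g \<bullet> p" "l' \<bullet> h' = j \<bullet> l"
    using push_out[OF PE R(3)] by metis
  note SV = short_exact_props[OF V(1)]
  let ?U = "R @ [(V,A'',j,v)]"
  have U: "ext_list C B ?U A''" using ext_list_snocI[OF R(1) V(1)] .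
  moreover have "length ?U = n" using R(2) S(2) S0(1) by simp
  ultimately have "vanishes C ?U B B (idm C B)" using 2 unfolding ext_vanishes_def by simp
  moreover have "l' \<bullet> i = j \<bullet> l \<bullet> i1"
    using comp_reassoc[OF V(4) P(3) V(2) SP(1)] P(4) comp_assoc[OF SP(1) R(3) SV(1)] by simp
  then have "ext_mor C S ?U (idm C B) g"
    unfolding ext_mor_snoc S0(1) using R(4) V(2,3) H(2) by metis
  ultimately show "vanishes C S B B (idm C B)" using vanishes_id_ext_mor S(1) U by blast
qed

text \<open>The segment Ext^n(A',B) -> Ext^(n+1)(A'',B) -> Ext^(n+1)(A,B). The pullback of S along g
  vanishes, which gives l : N -> J. Restricting l to the kernel A' of N -> E yields an n-extension
  R1 of A', which vanishes. Its splice W with the given sequence maps, with identities at both ends,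
  to an extension U built from R and l c, so U vanishes. It remains to map S to U.\<close>

lemma ext_vanishes_cokernel:
  assumes se: "short_exact C A' A A'' f g" and "n \<ge> 1"
    and 1: "ext_vanishes C n A' B" and 2: "ext_vanishes C (Suc n) A B"
  shows "ext_vanishes C (Suc n) A'' B"
  unfolding ext_vanishes_def
proof (intro allI impI)
  fix S assume S: "ext_list C B S A''" "length S = Suc n"
  note H = short_exact_props[OF se] and O = short_exact_Ob[OF se] and B = ext_list_Ob[OF S(1)]
  have "S \<noteq> []" using S(2) by auto
  then obtain S0 E i p K where S0: "S = S0 @ [(E,A'',i,p)]" "ext_list C B S0 K" "short_exact C K E A'' i p"
    using ext_list_snocE[OF S(1)] by metis
  note SE = short_exact_props[OF S0(3)]
  obtain N \<phi> p1 i1 where N: "is_pullback C A'' E A p g N \<phi> p1" "short_exact C K N A i1 p1" "\<phi> \<in> Hom C N E"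
    "\<phi> \<bullet> i1 = i" "p \<bullet> \<phi> = g \<bullet> p1" using pull_back[OF S0(3) H(2)] by metis
  obtain c where c: "short_exact C A' N E c \<phi>" "p1 \<bullet> c = f"
    using pullback_short_exact[OF is_pullbackD(8)[OF N(1)] se] by metis
  note SN = short_exact_props[OF N(2)] and SC = short_exact_props[OF c(1)]
  obtain R J l where R: "ext_list C B R J" "length R = length S0" "l \<in> Hom C N J"
    "ext_mor C S0 R (idm C B) (l \<bullet> i1)" using vanishes_snoc_id[OF S0(2) N(2) 2] S(2) S0(1) by auto
  have kH: "l \<bullet> i1 \<in> Hom C K J" using comp_Hom[OF SN(1) R(3)] .
  note lc = comp_Hom[OF SC(1) R(3)]
  have len: "length R = n" using R(2) S(2) S0(1) by simp
  then have "R \<noteq> []" using assms(2) by auto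
  then obtain R1 where R1: "ext_list C B R1 A'" "length R1 = length R" "ext_mor C R1 R (idm C B) (l \<bullet> c)"
    using ext_list_pull_back[OF R(1) _ lc] by metis
  let ?W = "R1 @ [(A,A'',f,g)]"
  have W: "ext_list C B ?W A''" using ext_list_snocI[OF R1(1) se] .
  have "vanishes C R1 B B (idm C B)" using 1 R1(1,2) len unfolding ext_vanishes_def by simp
  then have vW: "vanishes C ?W B B (idm C B)" using vanishes_append[OF _ W id_Hom] B by blast
  obtain V t j v where V: "short_exact C J V A'' j v" "t \<in> Hom C A V" "v \<bullet> t = g" "t \<bullet> f = j \<bullet> l \<bullet> c"
    using push_out[OF se lc] by metis
  note SV = short_exact_props[OF V(1)]
  let ?U = "R @ [(V,A'',j,v)]"
  have U: "ext_list C B ?U A''" using ext_list_snocI[OF R(1) V(1)] .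
  have "idm C A'' \<bullet> g = v \<bullet> t" using V(3) H(2) by (simp add: in_Hom_iff)
  then have "ext_mor C ?W ?U (idm C B) (idm C A'')"
    unfolding ext_mor_snoc using R1(3) V(2,4) id_Hom[OF O(3)] by metis
  then have vU: "vanishes C ?U B B (idm C B)" using vanishes_id_ext_mor_id W U vW by blast
  note jl = comp_Hom[OF R(3) SV(1)] and tp = comp_Hom[OF SN(2) V(2)]
  \<comment> \<open>The two maps from N to V agree on A', so their difference descends to E.\<close>
  let ?d = "j \<bullet> l \<oplus> neg (t \<bullet> p1)"
  have "(j \<bullet> l) \<bullet> c = (t \<bullet> p1) \<bullet> c"
    using comp_assoc[OF SC(1) R(3) SV(1)] comp_assoc[OF SC(1) SN(2) V(2)] c(2) V(4) by simp
  then have "?d \<bullet> c = zer C A' V" using minus_Hom(4)[OF jl tp SC(1)] minus_Hom(2)[OF comp_Hom[OF SC(1) jl] comp_Hom[OF SC(1) tp]]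
    by simp
  then obtain e where e: "e \<in> Hom C E V" "e \<bullet> \<phi> = ?d" using SC(7)[OF minus_Hom(1)[OF jl tp]] by blast
  have "e \<bullet> i = ?d \<bullet> i1" using comp_reassoc[OF e(2) N(3) e(1) SN(1)] N(4) by simp
  also have "\<dots> = j \<bullet> l \<bullet> i1 \<oplus> neg (t \<bullet> p1 \<bullet> i1)"
    using minus_Hom(4)[OF jl tp SN(1)] comp_assoc[OF SN(1) R(3) SV(1)] comp_assoc[OF SN(1,2) V(2)] by simp
  also have "\<dots> = j \<bullet> l \<bullet> i1" unfolding SN(3) using V(2) SV(1) kH by (simp add: in_Hom_iff)
  finally have ei: "e \<bullet> i = j \<bullet> l \<bullet> i1" .
  have "(v \<bullet> e) \<bullet> i = (v \<bullet> j) \<bullet> l \<bullet> i1" using comp_assoc[OF SE(1) e(1) SV(2)] comp_assoc[OF kH SV(1,2)] ei by simp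
  then have "(v \<bullet> e) \<bullet> i = zer C K A''" unfolding SV(3) using kH O by (simp add: in_Hom_iff)
  \<comment> \<open>Vanishing pulls back along any right component, so h need not be identified; it
    is minus the identity.\<close>
  then obtain h where h: "h \<in> Hom C A'' A''" "h \<bullet> p = v \<bullet> e" using SE(7)[OF comp_Hom[OF e(1) SV(2)]] by blast
  have "ext_mor C S ?U (idm C B) h" unfolding ext_mor_snoc S0(1) using R(4) e(1) ei h by metis
  then show "vanishes C S B B (idm C B)" using vanishes_id_ext_mor S(1) U vU by blast
qed

lemma ext_vanishes_retraction:
  assumes "ext_vanishes C 1 A B" "short_exact C B E A i p"
  shows "\<exists>r\<in>Hom C E B. r \<bullet> i = idm C B"
proof -
  have "ext_list C B [] B" using short_exact_Ob[OF assms(2)] by simp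
  then obtain R J l where "ext_list C B R J" "length R = length ([] :: ('a\<times>'a\<times>'b\<times>'b) list)" "l \<in> Hom C E J"
    "ext_mor C [] R (idm C B) (l \<bullet> i)" using vanishes_snoc_id[OF _ assms(2,1)] by (metis One_nat_def list.size(3))
  then show ?thesis by auto
qed

text \<open>Push the sequence out along h and compose with a splitting of the result.\<close>

lemma ext_vanishes_extend:
  assumes "ext_vanishes C 1 c x" "short_exact C a b c f g" "h \<in> Hom C a x"
  shows "\<exists>h'\<in>Hom C b x. h' \<bullet> f = h"
proof -
  obtain P l f' g' where P: "short_exact C x P c f' g'" "l \<in> Hom C b P" "l \<bullet> f = f' \<bullet> h"
    using push_out[OF assms(2,3)] by metis
  obtain r where r: "r \<in> Hom C P x" "r \<bullet> f' = idm C x" using ext_vanishes_retraction[OF assms(1) P(1)] by blast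
  have "(r \<bullet> l) \<bullet> f = r \<bullet> f' \<bullet> h" using comp_assoc[OF short_exact_props(1)[OF assms(2)] P(2) r(1)] P(3) by simp
  also have "\<dots> = h" using comp_reassoc[OF r(2) short_exact_props(1)[OF P(1)] r(1) assms(3)] assms(3) by (simp add: in_Hom_iff)
  finally show ?thesis using comp_Hom[OF P(2) r(1)] by blast
qed

text \<open>The degree zero case of \<open>ext_vanishes_cokernel\<close>: instead of a vanishing Ext
  group of A' it needs surjectivity of Hom(A,B) -> Hom(A',B). Its dual is the place where precovers
  act.\<close>

lemma ext_vanishes_cokernel_1:
  assumes se: "short_exact C A' A A'' f g"
    and 1: "\<And>h. h \<in> Hom C A' B \<Longrightarrow> \<exists>h'\<in>Hom C A B. h' \<bullet> f = h" and 2: "ext_vanishes C 1 A B"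
  shows "ext_vanishes C 1 A'' B"
  unfolding ext_vanishes_def
proof (intro allI impI)
  fix S assume S: "ext_list C B S A''" "length S = 1"
  note H = short_exact_props[OF se] and O = short_exact_Ob[OF se] and B = ext_list_Ob[OF S(1)]
  obtain E i p where S0: "S = [(E,A'',i,p)]" and sB: "short_exact C B E A'' i p"
    using S by (auto simp: length_Suc_conv)
  note SE = short_exact_props[OF sB]
  obtain N \<phi> p1 i1 where N: "is_pullback C A'' E A p g N \<phi> p1" "short_exact C B N A i1 p1" "\<phi> \<in> Hom C N E"
    "\<phi> \<bullet> i1 = i" using pull_back[OF sB H(2)] by metis
  obtain c where c: "short_exact C A' N E c \<phi>" "p1 \<bullet> c = f"
    using pullback_short_exact[OF is_pullbackD(8)[OF N(1)] se] by metis
  note SN = short_exact_props[OF N(2)] and SC = short_exact_props[OF c(1)]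
  obtain l where l: "l \<in> Hom C N B" "l \<bullet> i1 = idm C B" using ext_vanishes_retraction[OF 2 N(2)] by blast
  obtain t where t: "t \<in> Hom C A B" "t \<bullet> f = l \<bullet> c" using 1[OF comp_Hom[OF SC(1) l(1)]] by blast
  note tp = comp_Hom[OF SN(2) t(1)]
  let ?d = "l \<oplus> neg (t \<bullet> p1)"
  have "l \<bullet> c = (t \<bullet> p1) \<bullet> c" using comp_assoc[OF SC(1) SN(2) t(1)] c(2) t(2) by simp
  then have "?d \<bullet> c = zer C A' B" using minus_Hom(4)[OF l(1) tp SC(1)] minus_Hom(2)[OF comp_Hom[OF SC(1) l(1)] comp_Hom[OF SC(1) tp]]
    by simp
  then obtain e where e: "e \<in> Hom C E B" "e \<bullet> \<phi> = ?d" using SC(7)[OF minus_Hom(1)[OF l(1) tp]] by blast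
  have "e \<bullet> i = ?d \<bullet> i1" using comp_reassoc[OF e(2) N(3) e(1) SN(1)] N(4) by simp
  also have "\<dots> = l \<bullet> i1 \<oplus> neg (t \<bullet> p1 \<bullet> i1)"
    using minus_Hom(4)[OF l(1) tp SN(1)] comp_assoc[OF SN(1,2) t(1)] by simp
  also have "\<dots> = idm C B" unfolding SN(3) l(2) using t(1) B by (simp add: in_Hom_iff)
  finally show "vanishes C S B B (idm C B)"
    using vanishes_extends[OF S(1)[unfolded S0] e(1)] S0 by simp
qed

end


section \<open>Comparison with Yoneda equivalence\<close>

text \<open>The complex is cut at the image of its second map: d 1 = k p factors through the
  cokernel K of d 0, and the rest of the list represents the complex that starts with k. In the last
  step K is the end term itself and nothing is left to factor.\<close>

fun represents :: "('o,'m) abcat \<Rightarrow> ('o \<times> 'o \<times> 'm \<times> 'm) list \<Rightarrow> (nat \<Rightarrow> 'o) \<Rightarrow> (nat \<Rightarrow> 'm) \<Rightarrow> bool" where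
  "represents C [] E d \<longleftrightarrow> False"
| "represents C ((F,K,i,p) # S) E d \<longleftrightarrow> E (Suc 0) = F \<and> d 0 = i \<and>
     (if S = [] then E (Suc (Suc 0)) = K \<and> d (Suc 0) = p
      else \<exists>k. d (Suc 0) = cmp C k p \<and>
             represents C S (case_nat K (\<lambda>j. E (Suc (Suc j)))) (case_nat k (\<lambda>j. d (Suc (Suc j)))))"

lemma case_nat_Suc_eta: "f 0 = a \<Longrightarrow> case_nat a (\<lambda>j. f (Suc j)) = f"
  by (auto split: nat.split)

context abelian_cat begin

section \<open>Cutting complexes into short exact sequences and splicing them\<close>

lemmas exact_at_mono = abelian_cat.exact_at_epi[OF abelian_cat_opc, simplified]
lemmas exact_at_cokernelI = abelian_cat.exact_atI[OF abelian_cat_opc, simplified]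

text \<open>Exactness depends only on the image of f, which an epi in front does not change.\<close>

lemma exact_at_comp_epi:
  assumes "exact_at C a b c f g" "is_epi C a' a e"
  shows "exact_at C a' b c (f \<bullet> e) g"
proof -
  have f: "f \<in> Hom C a b" and g: "g \<in> Hom C b c" "g \<bullet> f = zer C a c" using assms(1) by (auto simp: exact_at_def)
  obtain L k where k: "is_kernel C b c g L k" using kernel_ex[OF g(1)] by metis
  obtain t where t: "t \<in> Hom C a L" "k \<bullet> t = f" using is_kernelD(4)[OF k f g(2)] by blast
  have "is_epi C a L t" using exact_at_epi[OF assms(1) k t] .
  then have "exact_at C a' b c (k \<bullet> t \<bullet> e) g" using exact_atI[OF g(1) k epi_comp[OF assms(2)]] by blast
  then show ?thesis using comp_assoc[OF is_epiD(1)[OF assms(2)] t(1) is_kernelD(2)[OF k]] t(2) by simp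
qed

lemma exact_at_epi_cancel:
  assumes "exact_at C a' b c (f \<bullet> e) g" "is_epi C a' a e" "f \<in> Hom C a b"
  shows "exact_at C a b c f g"
proof -
  note f = assms(3) and e = is_epiD(1)[OF assms(2)]
  have g: "g \<in> Hom C b c" "g \<bullet> f \<bullet> e = zer C a' c" using assms(1) by (auto simp: exact_at_def)
  have "(g \<bullet> f) \<bullet> e = zer C a' c" using g(2) comp_assoc[OF e f g(1)] by simp
  then have gf: "g \<bullet> f = zer C a c" using is_epiD(3)[OF assms(2) comp_Hom[OF f g(1)]] by blast
  obtain L k where k: "is_kernel C b c g L k" using kernel_ex[OF g(1)] by metis
  obtain t where t: "t \<in> Hom C a L" "k \<bullet> t = f" using is_kernelD(4)[OF k f gf] by blast
  have "k \<bullet> t \<bullet> e = f \<bullet> e" using comp_assoc[OF e t(1) is_kernelD(2)[OF k]] t(2) by simp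
  then have "is_epi C a' L (t \<bullet> e)" using exact_at_epi[OF assms(1) k comp_Hom[OF e t(1)]] by blast
  then have "is_epi C a L t" using epi_of_comp e t(1) by blast
  then show ?thesis using exact_atI[OF g(1) k] t(2) by blast
qed

lemma exact_complex_2:
  "exact_complex C (Suc (Suc 0)) E d \<longleftrightarrow> short_exact C (E 0) (E (Suc 0)) (E (Suc (Suc 0))) (d 0) (d (Suc 0))"
  unfolding exact_complex_def short_exact_def
  by (auto simp: less_Suc_eq dest: is_monoD(1) is_epiD(1))

text \<open>K is the cokernel of d 0. Exactness at the next term makes the induced map k out of K
  mono, so k can begin the shorter complex.\<close>

lemma exact_complex_split:
  assumes x: "exact_complex C (Suc (Suc m)) E d"
  obtains K e k where "short_exact C (E 0) (E (Suc 0)) K (d 0) e" "k \<in> Hom C K (E (Suc (Suc 0)))"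
    "d (Suc 0) = k \<bullet> e" "is_mono C K (E (Suc (Suc 0))) k"
    "exact_complex C (Suc m) (case_nat K (\<lambda>j. E (Suc (Suc j)))) (case_nat k (\<lambda>j. d (Suc (Suc j))))"
proof -
  have H: "\<And>j. j < Suc (Suc m) \<Longrightarrow> d j \<in> Hom C (E j) (E (Suc j))"
    and m0: "is_mono C (E 0) (E (Suc 0)) (d 0)"
    and ep: "is_epi C (E (Suc m)) (E (Suc (Suc m))) (d (Suc m))"
    and ex: "\<And>j. Suc j < Suc (Suc m) \<Longrightarrow> exact_at C (E j) (E (Suc j)) (E (Suc (Suc j))) (d j) (d (Suc j))"
    using x by (auto simp: exact_complex_def)
  have d0: "d 0 \<in> Hom C (E 0) (E (Suc 0))" and d1: "d (Suc 0) \<in> Hom C (E (Suc 0)) (E (Suc (Suc 0)))"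
    using H by auto
  have x0: "exact_at C (E 0) (E (Suc 0)) (E (Suc (Suc 0))) (d 0) (d (Suc 0))" using ex by auto
  obtain K e where e: "is_cokernel C (E 0) (E (Suc 0)) (d 0) K e" using cokernel_ex[OF d0] by metis
  have se: "short_exact C (E 0) (E (Suc 0)) K (d 0) e" using short_exact_cokernelI[OF m0 e] .
  note S = short_exact_props[OF se]
  obtain k where k: "k \<in> Hom C K (E (Suc (Suc 0)))" "k \<bullet> e = d (Suc 0)"
    using S(7)[OF d1] x0 by (auto simp: exact_at_def)
  have km: "is_mono C K (E (Suc (Suc 0))) k" using exact_at_mono[OF x0 e k] .
  let ?E = "case_nat K (\<lambda>j. E (Suc (Suc j)))" and ?d = "case_nat k (\<lambda>j. d (Suc (Suc j)))"
  have "exact_complex C (Suc m) ?E ?d"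
    unfolding exact_complex_def
  proof (intro conjI allI impI)
    fix j assume "j < Suc m"
    then show "?d j \<in> Hom C (?E j) (?E (Suc j))" using H[of "Suc j"] k by (cases j) auto
  next
    show "is_mono C (?E 0) (?E 1) (?d 0)" using km by simp
    show "is_epi C (?E (Suc m - 1)) (?E (Suc m)) (?d (Suc m - 1))"
    proof (cases m)
      case 0
      then have "is_epi C (E (Suc 0)) (E (Suc (Suc 0))) (k \<bullet> e)" using ep k by simp
      then show ?thesis using epi_of_comp[OF _ S(2) k(1)] 0 by simp
    qed (use ep in simp)
    fix j assume j: "Suc j < Suc m"
    show "exact_at C (?E j) (?E (Suc j)) (?E (Suc (Suc j))) (?d j) (?d (Suc j))"
    proof (cases j)
      case 0
      have "exact_at C (E (Suc 0)) (E (Suc (Suc 0))) (E (Suc (Suc (Suc 0)))) (k \<bullet> e) (d (Suc (Suc 0)))"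
        using ex[of "Suc 0"] j k 0 by simp
      then show ?thesis using exact_at_epi_cancel[OF _ S(5) k(1)] 0 by simp
    qed (use ex[of "Suc j"] j in simp)
  qed simp
  then show thesis using that se k km by metis
qed

lemma exact_complex_Cons:
  assumes se: "short_exact C M Y (E 0) f e" and x: "exact_complex C (Suc m) E d"
  shows "exact_complex C (Suc (Suc m)) (case_nat M (case_nat Y (\<lambda>j. E (Suc j))))
    (case_nat f (case_nat (d 0 \<bullet> e) (\<lambda>j. d (Suc j))))" (is "exact_complex C _ ?E ?d")
proof -
  note S = short_exact_props[OF se]
  have H: "\<And>j. j < Suc m \<Longrightarrow> d j \<in> Hom C (E j) (E (Suc j))"
    and m0: "is_mono C (E 0) (E (Suc 0)) (d 0)"
    and ep: "is_epi C (E m) (E (Suc m)) (d m)"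
    and ex: "\<And>j. Suc j < Suc m \<Longrightarrow> exact_at C (E j) (E (Suc j)) (E (Suc (Suc j))) (d j) (d (Suc j))"
    using x by (auto simp: exact_complex_def)
  have d0: "d 0 \<in> Hom C (E 0) (E (Suc 0))" using H by auto
  show ?thesis
    unfolding exact_complex_def
  proof (intro conjI allI impI)
    fix j assume "j < Suc (Suc m)"
    then show "?d j \<in> Hom C (?E j) (?E (Suc j))"
      using H comp_Hom[OF S(2) d0] S(1) by (auto split: nat.split)
  next
    show "is_mono C (?E 0) (?E 1) (?d 0)" using S(4) by simp
    show "is_epi C (?E (Suc (Suc m) - 1)) (?E (Suc (Suc m))) (?d (Suc (Suc m) - 1))"
      using ep epi_comp[OF S(5)] by (cases m) auto
    fix j assume j: "Suc j < Suc (Suc m)"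
    show "exact_at C (?E j) (?E (Suc j)) (?E (Suc (Suc j))) (?d j) (?d (Suc j))"
    proof (cases j)
      case 0
      then show ?thesis using exact_at_cokernelI[OF S(1) short_exactD(2)[OF se] m0] by simp
    next
      case (Suc l)
      then have l: "Suc l < Suc m" using j by simp
      show ?thesis
      proof (cases l)
        case 0
        then show ?thesis using Suc exact_at_comp_epi[OF ex[OF l] ] S(5) by simp
      qed (use Suc ex[OF l] in simp)
    qed
  qed simp
qed

lemma represents_ex_list:
  assumes "exact_complex C (Suc n) E d" "n \<ge> 1"
  shows "\<exists>S. represents C S E d \<and> ext_list C (E 0) S (E (Suc n)) \<and> length S = n"
  using assms(2,1)
proof (induction n arbitrary: E d rule: nat_induct_at_least)
  case base
  then have se: "short_exact C (E 0) (E (Suc 0)) (E (Suc (Suc 0))) (d 0) (d (Suc 0))"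
    using exact_complex_2 by simp
  then show ?case using short_exact_Ob[OF se]
    by (intro exI[of _ "[(E (Suc 0), E (Suc (Suc 0)), d 0, d (Suc 0))]"]) simp
next
  case (Suc n)
  obtain K e k where k: "short_exact C (E 0) (E (Suc 0)) K (d 0) e" "d (Suc 0) = k \<bullet> e"
    "exact_complex C (Suc n) (case_nat K (\<lambda>j. E (Suc (Suc j)))) (case_nat k (\<lambda>j. d (Suc (Suc j))))"
    using exact_complex_split[OF Suc.prems] by metis
  obtain S where "represents C S (case_nat K (\<lambda>j. E (Suc (Suc j)))) (case_nat k (\<lambda>j. d (Suc (Suc j))))"
    "ext_list C K S (E (Suc (Suc n)))" "length S = n" using Suc.IH[OF k(3)] by auto
  moreover from this have "S \<noteq> []" by auto
  ultimately show ?case using k(1,2)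
    by (intro exI[of _ "(E (Suc 0), K, d 0, e) # S"]) auto
qed

lemma represents_ex_complex:
  assumes "ext_list C B S A" "S \<noteq> []"
  shows "\<exists>E d. represents C S E d \<and> exact_complex C (Suc (length S)) E d \<and> E 0 = B \<and> E (Suc (length S)) = A"
  using assms
proof (induction S arbitrary: B)
  case (Cons s S)
  obtain F K i p where s: "s = (F,K,i,p)" by (cases s)
  have se: "short_exact C B F K i p" and S: "ext_list C K S A" using Cons.prems s by auto
  show ?case
  proof (cases "S = []")
    case True
    let ?E = "case_nat B (case_nat F (\<lambda>_. A))" and ?d = "case_nat i (\<lambda>_. p)"
    have "K = A" using S True by simp
    then show ?thesis using se True s by (intro exI[of _ ?E] exI[of _ ?d]) (simp add: exact_complex_2)
  next
    case False
    then obtain E d where E: "represents C S E d" "exact_complex C (Suc (length S)) E d" "E 0 = K"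
      "E (Suc (length S)) = A" using Cons.IH[OF S] by blast
    let ?E = "case_nat B (case_nat F (\<lambda>j. E (Suc j)))" and ?d = "case_nat i (case_nat (d 0 \<bullet> p) (\<lambda>j. d (Suc j)))"
    have "exact_complex C (Suc (Suc (length S))) ?E ?d" using exact_complex_Cons[of B F E i p] se E by simp
    moreover have "represents C (s # S) ?E ?d"
      using False E(1) case_nat_Suc_eta[of E K, OF E(3)] case_nat_Suc_eta[of d "d 0"] unfolding s
      by (auto intro!: exI[of _ "d 0"])
    ultimately show ?thesis using E(4) by (intro exI[of _ ?E] exI[of _ ?d]) simp
  qed
qed simp

section \<open>Morphisms of lists and morphisms of complexes\<close>

lemma ext_mor_represents:
  assumes "represents C S E d" "represents C S' E' d'" "length S = length S'"
    "ext_list C (E 0) S A" "ext_list C (E' 0) S' A'"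
    "\<And>j. j \<le> Suc (length S) \<Longrightarrow> \<phi> j \<in> Hom C (E j) (E' j)"
    "\<And>j. j \<le> length S \<Longrightarrow> d' j \<bullet> \<phi> j = \<phi> (Suc j) \<bullet> d j"
  shows "ext_mor C S S' (\<phi> 0) (\<phi> (Suc (length S)))"
  using assms
proof (induction S arbitrary: S' E E' d d' \<phi>)
  case (Cons s S)
  obtain F K i p where s: "s = (F,K,i,p)" by (cases s)
  obtain F' K' i' p' S0 where S': "S' = (F',K',i',p') # S0" using Cons.prems(3) by (cases S') auto
  have se: "short_exact C (E 0) F K i p" "short_exact C (E' 0) F' K' i' p'"
    and S: "ext_list C K S A" "ext_list C K' S0 A'" using Cons.prems(4,5) s S' by auto
  note H = short_exact_props[OF se(1)] and H' = short_exact_props[OF se(2)]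
  have F: "E (Suc 0) = F" "d 0 = i" "E' (Suc 0) = F'" "d' 0 = i'" using Cons.prems(1,2) s S' by auto
  have \<phi>0: "\<phi> 0 \<in> Hom C (E 0) (E' 0)" and \<phi>1: "\<phi> (Suc 0) \<in> Hom C F F'" and \<phi>2: "\<phi> (Suc (Suc 0)) \<in> Hom C (E (Suc (Suc 0))) (E' (Suc (Suc 0)))"
    using Cons.prems(6)[of 0] Cons.prems(6)[of "Suc 0"] Cons.prems(6)[of "Suc (Suc 0)"] F by auto
  have c0: "i' \<bullet> \<phi> 0 = \<phi> (Suc 0) \<bullet> i" and c1: "d' (Suc 0) \<bullet> \<phi> (Suc 0) = \<phi> (Suc (Suc 0)) \<bullet> d (Suc 0)"
    using Cons.prems(7)[of 0] Cons.prems(7)[of "Suc 0"] F by auto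
  show ?case
  proof (cases "S = []")
    case True
    then have "S0 = []" using Cons.prems(3) S' by simp
    moreover from this True have "E (Suc (Suc 0)) = K" "d (Suc 0) = p" "E' (Suc (Suc 0)) = K'" "d' (Suc 0) = p'"
      using Cons.prems(1,2) s S' by auto
    ultimately show ?thesis using True c0 c1 \<phi>1 \<phi>2 unfolding s S' by auto
  next
    case False
    then have "S0 \<noteq> []" using Cons.prems(3) S' by auto
    then obtain k k' where k: "d (Suc 0) = k \<bullet> p" "d' (Suc 0) = k' \<bullet> p'"
      "represents C S (case_nat K (\<lambda>j. E (Suc (Suc j)))) (case_nat k (\<lambda>j. d (Suc (Suc j))))"
      "represents C S0 (case_nat K' (\<lambda>j. E' (Suc (Suc j)))) (case_nat k' (\<lambda>j. d' (Suc (Suc j))))"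
      using Cons.prems(1,2) s S' False by auto
    have kH: "k \<in> Hom C K (E (Suc (Suc 0)))" using k(3) S(1) False by (cases S) (auto dest: short_exact_props)
    have kH': "k' \<in> Hom C K' (E' (Suc (Suc 0)))" using k(4) S(2) \<open>S0 \<noteq> []\<close> by (cases S0) (auto dest: short_exact_props)
    have "(p' \<bullet> \<phi> (Suc 0)) \<bullet> i = (p' \<bullet> i') \<bullet> \<phi> 0"
      using comp_assoc[OF H(1) \<phi>1 H'(2)] comp_assoc[OF \<phi>0 H'(1,2)] c0 by simp
    then have "(p' \<bullet> \<phi> (Suc 0)) \<bullet> i = zer C (E 0) K'"
      unfolding H'(3) using \<phi>0 short_exact_Ob[OF se(2)] by (simp add: in_Hom_iff)
    then obtain m where m: "m \<in> Hom C K K'" "m \<bullet> p = p' \<bullet> \<phi> (Suc 0)" using H(7)[OF comp_Hom[OF \<phi>1 H'(2)]] by blast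
    have "(k' \<bullet> m) \<bullet> p = (\<phi> (Suc (Suc 0)) \<bullet> k) \<bullet> p"
      using comp_assoc[OF H(2) m(1) kH'] m(2) comp_assoc[OF \<phi>1 H'(2) kH'] c1 k comp_assoc[OF H(2) kH \<phi>2] by simp
    then have km: "k' \<bullet> m = \<phi> (Suc (Suc 0)) \<bullet> k"
      using epi_cancel[OF H(5) comp_Hom[OF m(1) kH'] comp_Hom[OF kH \<phi>2]] by blast
    let ?\<phi> = "case_nat m (\<lambda>j. \<phi> (Suc (Suc j)))"
    have "ext_mor C S S0 (?\<phi> 0) (?\<phi> (Suc (length S)))"
    proof (rule Cons.IH[OF k(3,4)])
      fix j
      show "j \<le> Suc (length S) \<Longrightarrow> ?\<phi> j \<in> Hom C (case_nat K (\<lambda>j. E (Suc (Suc j))) j) (case_nat K' (\<lambda>j. E' (Suc (Suc j))) j)"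
        using m(1) Cons.prems(6)[of "Suc j"] by (cases j) auto
      show "j \<le> length S \<Longrightarrow> case_nat k' (\<lambda>j. d' (Suc (Suc j))) j \<bullet> ?\<phi> j = ?\<phi> (Suc j) \<bullet> case_nat k (\<lambda>j. d (Suc (Suc j))) j"
        using km Cons.prems(7)[of "Suc j"] by (cases j) auto
    qed (use S Cons.prems(3) S' in auto)
    then show ?thesis unfolding s S' using \<phi>1 c0 m by auto
  qed
qed simp

lemma represents_ext_mor:
  assumes "represents C S E d" "represents C S' E' d'" "ext_list C (E 0) S A" "ext_list C (E' 0) S' A'"
    "ext_mor C S S' g h" "g \<in> Hom C (E 0) (E' 0)"
  shows "\<exists>\<phi>. (\<forall>j\<le>Suc (length S). \<phi> j \<in> Hom C (E j) (E' j)) \<and> \<phi> 0 = g \<and> \<phi> (Suc (length S)) = h \<and>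
    (\<forall>j\<le>length S. d' j \<bullet> \<phi> j = \<phi> (Suc j) \<bullet> d j)"
  using assms
proof (induction S arbitrary: S' E E' d d' g)
  case (Cons s S)
  obtain F K i p where s: "s = (F,K,i,p)" by (cases s)
  obtain F' K' i' p' S0 \<phi>1 m where m: "S' = (F',K',i',p') # S0" "\<phi>1 \<in> Hom C F F'" "m \<in> Hom C K K'"
    "\<phi>1 \<bullet> i = i' \<bullet> g" "m \<bullet> p = p' \<bullet> \<phi>1" "ext_mor C S S0 m h"
    using Cons.prems(5) unfolding s ext_mor_Cons by metis
  have se: "short_exact C (E 0) F K i p" "short_exact C (E' 0) F' K' i' p'"
    and S: "ext_list C K S A" "ext_list C K' S0 A'" using Cons.prems(3,4) s m(1) by auto
  note H = short_exact_props[OF se(1)] and H' = short_exact_props[OF se(2)]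
  have F: "E (Suc 0) = F" "d 0 = i" "E' (Suc 0) = F'" "d' 0 = i'" using Cons.prems(1,2) s m(1) by auto
  show ?case
  proof (cases "S = []")
    case True
    then have S0: "S0 = []" "m = h" using m(6) by (auto simp: ext_mor_Nil)
    then have K: "E (Suc (Suc 0)) = K" "d (Suc 0) = p" "E' (Suc (Suc 0)) = K'" "d' (Suc 0) = p'"
      using Cons.prems(1,2) True s m(1) by auto
    show ?thesis using True S0 K F m(2-5) Cons.prems(6)
      by (intro exI[of _ "case_nat g (case_nat \<phi>1 (\<lambda>_. m))"]) (auto simp: le_Suc_eq)
  next
    case False
    then have S0: "S0 \<noteq> []" using m(6) by (cases S; cases S0) auto
    then obtain k k' where k: "d (Suc 0) = k \<bullet> p" "d' (Suc 0) = k' \<bullet> p'"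
      "represents C S (case_nat K (\<lambda>j. E (Suc (Suc j)))) (case_nat k (\<lambda>j. d (Suc (Suc j))))"
      "represents C S0 (case_nat K' (\<lambda>j. E' (Suc (Suc j)))) (case_nat k' (\<lambda>j. d' (Suc (Suc j))))"
      using Cons.prems(1,2) s m(1) False by auto
    have kH: "k \<in> Hom C K (E (Suc (Suc 0)))" using k(3) S(1) False by (cases S) (auto dest: short_exact_props)
    have kH': "k' \<in> Hom C K' (E' (Suc (Suc 0)))" using k(4) S(2) S0 by (cases S0) (auto dest: short_exact_props)
    obtain \<phi> where \<phi>: "\<And>j. j\<le>Suc (length S) \<Longrightarrow> \<phi> j \<in> Hom C (case_nat K (\<lambda>j. E (Suc (Suc j))) j) (case_nat K' (\<lambda>j. E' (Suc (Suc j))) j)"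
      "\<phi> 0 = m" "\<phi> (Suc (length S)) = h"
      "\<And>j. j\<le>length S \<Longrightarrow> case_nat k' (\<lambda>j. d' (Suc (Suc j))) j \<bullet> \<phi> j = \<phi> (Suc j) \<bullet> case_nat k (\<lambda>j. d (Suc (Suc j))) j"
      using Cons.IH[OF k(3,4) _ _ m(6)] S m(3) by auto
    have \<phi>1: "\<phi> (Suc 0) \<in> Hom C (E (Suc (Suc 0))) (E' (Suc (Suc 0)))" using \<phi>(1)[of "Suc 0"] by simp
    have km: "k' \<bullet> m = \<phi> (Suc 0) \<bullet> k" using \<phi>(4)[of 0] \<phi>(2) by simp
    have c1: "d' (Suc 0) \<bullet> \<phi>1 = \<phi> (Suc 0) \<bullet> d (Suc 0)"
      using k(1,2) comp_assoc[OF m(2) H'(2) kH'] m(5) comp_reassoc[OF km m(3) kH' H(2)] comp_assoc[OF H(2) kH \<phi>1] by simp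
    let ?\<phi> = "case_nat g (case_nat \<phi>1 (\<lambda>j. \<phi> (Suc j)))"
    have "?\<phi> j \<in> Hom C (E j) (E' j)" if "j \<le> Suc (Suc (length S))" for j
      using that Cons.prems(6) m(2) F \<phi>(1)[of "j - 1"] by (auto split: nat.split)
    moreover have "d' j \<bullet> ?\<phi> j = ?\<phi> (Suc j) \<bullet> d j" if "j \<le> Suc (length S)" for j
      using that m(4) F c1 \<phi>(4)[of "j - 1"] by (auto split: nat.split)
    ultimately show ?thesis using \<phi>(3) by (intro exI[of _ ?\<phi>]) simp
  qed
qed simp

section \<open>The zero element of Yoneda Ext\<close>

lemma ext_mor_replicate_zero:
  assumes "ext_list C L R J" "length R = n" "z \<in> Ob C"
  shows "ext_mor C (replicate n (z, z, zer C z z, idm C z)) R (zer C z L) (zer C z J)"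
  using assms
proof (induction R arbitrary: L n)
  case (Cons r R)
  obtain F K a b where r: "r = (F,K,a,b)" by (cases r)
  have se: "short_exact C L F K a b" and R: "ext_list C K R J" using Cons.prems(1) r by auto
  note H = short_exact_props[OF se] and O = short_exact_Ob[OF se]
  obtain n' where n: "n = Suc n'" "length R = n'" using Cons.prems(2) by auto
  show ?case unfolding n(1) r replicate_Suc ext_mor.simps
    by (rule bexI[of _ "zer C z F"], rule bexI[of _ "zer C z K"])
      (use Cons.IH[OF R n(2) Cons.prems(3)] Cons.prems(3) O H(1,2) in \<open>simp_all add: in_Hom_iff\<close>)
qed simp

lemma ext_list_replicate_zero:
  "short_exact C z z z (zer C z z) (idm C z) \<Longrightarrow> ext_list C z (replicate n (z, z, zer C z z, idm C z)) z"
  by (induction n) (auto dest: short_exact_Ob)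

text \<open>The map with components l and p into the biproduct of J and A. It trades the zero
  component at A, which vanishing supplies, for an identity, at the price of a split last
  step.\<close>

lemma split_target:
  assumes se: "short_exact C K E A i p" and l: "l \<in> Hom C E J"
  obtains q i1 i2 p1 p2 \<phi> where "short_exact C J q A i1 p2" "p1 \<in> Hom C q J" "p1 \<bullet> i1 = idm C J"
    "i2 \<in> Hom C A q" "p2 \<bullet> i2 = idm C A" "\<phi> \<in> Hom C E q" "\<phi> \<bullet> i = i1 \<bullet> l \<bullet> i" "p2 \<bullet> \<phi> = p"
proof -
  note H = short_exact_props[OF se]
  have J: "J \<in> Ob C" and A: "A \<in> Ob C" using Hom_Ob[OF l] Hom_Ob[OF H(2)] by auto
  obtain q i1 i2 p1 p2 where b: "i1 \<in> Hom C J q" "i2 \<in> Hom C A q" "p1 \<in> Hom C q J" "p2 \<in> Hom C q A"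
    "p1 \<bullet> i1 = idm C J" "p2 \<bullet> i2 = idm C A" "p2 \<bullet> i1 = zer C J A" "short_exact C J q A i1 p2"
    using biprod[OF J A] by metis
  let ?\<phi> = "i1 \<bullet> l \<oplus> i2 \<bullet> p"
  have \<phi>: "?\<phi> \<in> Hom C E q" using b l H(2) by (simp add: in_Hom_iff)
  have "?\<phi> \<bullet> i = i1 \<bullet> l \<bullet> i \<oplus> i2 \<bullet> p \<bullet> i" using b l H(1,2) by (simp add: in_Hom_iff)
  then have 1: "?\<phi> \<bullet> i = i1 \<bullet> l \<bullet> i" unfolding H(3) using b l H(1) by (simp add: in_Hom_iff)
  have "p2 \<bullet> ?\<phi> = (p2 \<bullet> i1) \<bullet> l \<oplus> (p2 \<bullet> i2) \<bullet> p" using b(1-4) l H(2) by (simp add: in_Hom_iff)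
  then have "p2 \<bullet> ?\<phi> = p" unfolding b(6,7) using l H(2) A by (simp add: in_Hom_iff)
  then show thesis using that[OF b(8,3,5,2,6) \<phi> 1] by blast
qed

text \<open>T is the split sequence for n = 1 and B = B -> 0 -> ... -> 0 -> A = A for n > 1. A
  vanishing S is two Yoneda steps from T: both map to the extension S1, whose last step is split,
  with identities at both ends.\<close>

lemma trivial_ext_list:
  assumes A: "A \<in> Ob C" and B: "B \<in> Ob C" and n: "n \<ge> 1"
  obtains T where "ext_list C B T A" "length T = n" "vanishes C T B B (idm C B)"
    "\<And>S. ext_list C B S A \<Longrightarrow> length S = n \<Longrightarrow> vanishes C S B B (idm C B) \<Longrightarrow>
       \<exists>S1. ext_list C B S1 A \<and> length S1 = n \<and> ext_mor C S S1 (idm C B) (idm C A) \<and>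
         ext_mor C T S1 (idm C B) (idm C A)"
proof (cases "n = 1")
  case True
  obtain q i1 i2 p1 p2 where b: "i1 \<in> Hom C B q" "i2 \<in> Hom C A q" "p1 \<in> Hom C q B" "p2 \<in> Hom C q A"
    "p1 \<bullet> i1 = idm C B" "p2 \<bullet> i2 = idm C A" "p2 \<bullet> i1 = zer C B A" "short_exact C B q A i1 p2"
    using biprod[OF B A] by metis
  let ?T = "[(q,A,i1,p2)]"
  have T: "ext_list C B ?T A" using b(8) A by simp
  show thesis
  proof (rule that[OF T])
    show "length ?T = n" using True by simp
    show "vanishes C ?T B B (idm C B)" using vanishes_extends[OF T b(3)] b(5) by simp
    fix S assume S: "ext_list C B S A" "length S = n" "vanishes C S B B (idm C B)"
    obtain E i p where S0: "S = [(E,A,i,p)]" and se: "short_exact C B E A i p"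
      using S(1,2) True by (auto simp: length_Suc_conv)
    note H = short_exact_props[OF se]
    obtain R J l where R: "ext_list C B R J" "length R = length ([] :: ('a\<times>'a\<times>'b\<times>'b) list)" "l \<in> Hom C E J"
      "ext_mor C [] R (idm C B) (l \<bullet> i)"
      using vanishes_snoc[of B "[]" B E A i p "idm C B" B] se id_Hom[OF B] S(3) B unfolding S0 by auto
    then have l: "l \<in> Hom C E B" "l \<bullet> i = idm C B" by auto
    let ?\<phi> = "i1 \<bullet> l \<oplus> i2 \<bullet> p"
    have \<phi>: "?\<phi> \<in> Hom C E q" using b l H(2) by (simp add: in_Hom_iff)
    have "?\<phi> \<bullet> i = i1 \<bullet> l \<bullet> i \<oplus> i2 \<bullet> p \<bullet> i" using b l(1) H(1,2) by (simp add: in_Hom_iff)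
    then have 1: "?\<phi> \<bullet> i = i1 \<bullet> idm C B" unfolding H(3) l(2) using b l H(1) by (simp add: in_Hom_iff)
    have "p2 \<bullet> ?\<phi> = (p2 \<bullet> i1) \<bullet> l \<oplus> (p2 \<bullet> i2) \<bullet> p" using b(1-4) l(1) H(2) by (simp add: in_Hom_iff)
    then have "p2 \<bullet> ?\<phi> = p" unfolding b(6,7) using l(1) H(2) A by (simp add: in_Hom_iff)
    then have "idm C A \<bullet> p = p2 \<bullet> ?\<phi>" using H(2) by (simp add: in_Hom_iff)
    then have "ext_mor C S ?T (idm C B) (idm C A)" unfolding S0 using \<phi> 1 id_Hom[OF A] by auto
    then show "\<exists>S1. ext_list C B S1 A \<and> length S1 = n \<and> ext_mor C S S1 (idm C B) (idm C A) \<and>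
         ext_mor C ?T S1 (idm C B) (idm C A)" using T True ext_mor_refl[OF T] by (intro exI[of _ ?T]) auto
  qed
next
  case False
  then have "n = Suc (Suc (n - 2))" using n by simp
  then obtain n' where n': "n = Suc (Suc n')" by blast
  obtain z where z: "z \<in> Ob C" "\<And>a. a \<in> Ob C \<Longrightarrow> short_exact C a a z (idm C a) (zer C a z)"
    "\<And>a. a \<in> Ob C \<Longrightarrow> short_exact C z a a (zer C z a) (idm C a)"
    using zero_object by metis
  let ?U = "(B,z,idm C B,zer C B z) # replicate n' (z, z, zer C z z, idm C z)"
  let ?T = "?U @ [(A,A,zer C z A,idm C A)]"
  have T0: "ext_list C B ?U z" using z(2)[OF B] ext_list_replicate_zero[OF z(3)[OF z(1)]] by simp
  have T: "ext_list C B ?T A" using ext_list_snocI[OF T0 z(3)[OF A]] .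
  show thesis
  proof (rule that[OF T])
    show "length ?T = n" using n' by simp
    show "vanishes C ?T B B (idm C B)"
      using vanishes_extends[OF T[unfolded append_Cons] id_Hom[OF B]] B by simp
    fix S assume S: "ext_list C B S A" "length S = n" "vanishes C S B B (idm C B)"
    have "S \<noteq> []" using S(2) n' by auto
    then obtain S0 E i p K where S0: "S = S0 @ [(E,A,i,p)]" "ext_list C B S0 K" "short_exact C K E A i p"
      using ext_list_snocE[OF S(1)] by metis
    obtain R J l where R: "ext_list C B R J" "length R = length S0" "l \<in> Hom C E J"
      "ext_mor C S0 R (idm C B) (l \<bullet> i)"
      using vanishes_snoc[OF S0(2,3) id_Hom[OF B]] S(3) unfolding S0(1) by metis
    obtain q i1 i2 p1 p2 \<phi> where q: "short_exact C J q A i1 p2"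
      "i2 \<in> Hom C A q" "p2 \<bullet> i2 = idm C A" "\<phi> \<in> Hom C E q" "\<phi> \<bullet> i = i1 \<bullet> l \<bullet> i" "p2 \<bullet> \<phi> = p"
      using split_target[OF S0(3) R(3)] by metis
    note SQ = short_exact_props[OF q(1)]
    let ?S1 = "R @ [(q,A,i1,p2)]"
    have S1: "ext_list C B ?S1 A" using ext_list_snocI[OF R(1) q(1)] .
    have "idm C A \<bullet> p = p2 \<bullet> \<phi>" using q(6) short_exact_props(2)[OF S0(3)] by (simp add: in_Hom_iff)
    then have 1: "ext_mor C S ?S1 (idm C B) (idm C A)"
      unfolding ext_mor_snoc S0(1) using R(4) q(4,5) id_Hom[OF A] by metis
    obtain F L a b R' where R': "R = (F,L,a,b) # R'" "length R' = n'"
      using R(2) S(2) S0(1) n' by (cases R) auto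
    have se: "short_exact C B F L a b" and R'x: "ext_list C L R' J" using R(1) R'(1) by auto
    note SF = short_exact_props[OF se] and OF' = short_exact_Ob[OF se]
    have "ext_mor C ?U R (idm C B) (zer C z J)"
      unfolding R'(1) ext_mor.simps
      by (rule bexI[of _ a], rule bexI[of _ "zer C z L"])
        (use ext_mor_replicate_zero[OF R'x R'(2) z(1)] SF(1-3) z(1) OF' in \<open>simp_all add: in_Hom_iff\<close>)
    moreover have "i2 \<bullet> zer C z A = i1 \<bullet> zer C z J" using q(2) SQ(1) z(1) by (simp add: in_Hom_iff)
    moreover have "idm C A \<bullet> idm C A = p2 \<bullet> i2" using q(3) A by simp
    ultimately have "ext_mor C ?T ?S1 (idm C B) (idm C A)"
      unfolding ext_mor_snoc using q(2) id_Hom[OF A] by blast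
    then show "\<exists>S1. ext_list C B S1 A \<and> length S1 = n \<and> ext_mor C S S1 (idm C B) (idm C A) \<and>
         ext_mor C ?T S1 (idm C B) (idm C A)" using S1 1 R(2) S(2) S0(1) by (intro exI[of _ ?S1]) simp
  qed
qed

lemma yext_mor_iff:
  assumes "represents C S (fst X) (snd X)" "represents C S' (fst X') (snd X')"
    "ext_list C B S A" "ext_list C B S' A" "length S = n" "length S' = n"
    "yext C n A B X" "yext C n A B X'"
  shows "yext_mor C n A B X X' \<longleftrightarrow> ext_mor C S S' (idm C B) (idm C A)"
proof
  have X: "fst X 0 = B" "fst X' 0 = B" using assms(7,8) by (auto simp: yext_def)
  {
    assume "yext_mor C n A B X X'"
    then obtain \<phi> where \<phi>: "\<forall>j\<le>Suc n. \<phi> j \<in> Hom C (fst X j) (fst X' j)" "\<phi> 0 = idm C B" "\<phi> (Suc n) = idm C A"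
      "\<forall>j<Suc n. snd X' j \<bullet> \<phi> j = \<phi> (Suc j) \<bullet> snd X j" unfolding yext_mor_def by auto
    have "ext_mor C S S' (\<phi> 0) (\<phi> (Suc (length S)))"
      using \<phi>(1,4) assms X by (intro ext_mor_represents[OF assms(1,2)]) auto
    then show "ext_mor C S S' (idm C B) (idm C A)" using \<phi> assms(5) by simp
  }
  assume "ext_mor C S S' (idm C B) (idm C A)"
  then have "\<exists>\<phi>. (\<forall>j\<le>Suc (length S). \<phi> j \<in> Hom C (fst X j) (fst X' j)) \<and> \<phi> 0 = idm C B \<and> \<phi> (Suc (length S)) = idm C A \<and>
    (\<forall>j\<le>length S. snd X' j \<bullet> \<phi> j = \<phi> (Suc j) \<bullet> snd X j)"
    using represents_ext_mor[OF assms(1,2)] assms(3,4) X id_Hom ext_list_Ob[OF assms(3)] by metis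
  then show "yext_mor C n A B X X'" unfolding yext_mor_def using assms(5,7,8) by (auto simp: less_Suc_eq_le)
qed

lemma yext_list:
  assumes "yext C n A B X" "n \<ge> 1"
  obtains S where "represents C S (fst X) (snd X)" "ext_list C B S A" "length S = n"
  using represents_ex_list[of n "fst X" "snd X"] assms unfolding yext_def by metis

lemma list_yext:
  assumes "ext_list C B S A" "length S = n" "n \<ge> 1"
  obtains X where "represents C S (fst X) (snd X)" "yext C n A B X"
proof -
  have "S \<noteq> []" using assms by auto
  then obtain E d where "represents C S E d" "exact_complex C (Suc n) E d" "E 0 = B" "E (Suc n) = A"
    using represents_ex_complex[OF assms(1)] assms(2) by auto
  then show thesis using that[of "(E,d)"] by (simp add: yext_def)
qed

text \<open>If all extensions are equivalent, vanishing is carried from the trivial extension along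
  the zigzag, in both directions of its arrows. Conversely, vanishing links every extension to the
  trivial one in two steps.\<close>

lemma Ext_zero_iff:
  assumes n: "n \<ge> 1"
  shows "Ext_zero C n A B \<longleftrightarrow> ext_vanishes C n A B"
proof
  assume z: "Ext_zero C n A B"
  show "ext_vanishes C n A B" unfolding ext_vanishes_def
  proof (intro allI impI)
    fix S assume S: "ext_list C B S A" "length S = n"
    then have O: "A \<in> Ob C" "B \<in> Ob C" using ext_list_Ob by auto
    obtain T where T: "ext_list C B T A" "length T = n" "vanishes C T B B (idm C B)"
      using trivial_ext_list[OF O n] by metis
    obtain X where X: "represents C S (fst X) (snd X)" "yext C n A B X" using list_yext[OF S n] by metis
    obtain Y where Y: "represents C T (fst Y) (snd Y)" "yext C n A B Y" using list_yext[OF T(1,2) n] by metis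
    have "yoneda_equiv C n A B Y X" using z X Y unfolding Ext_zero_def by blast
    then have "(\<lambda>S S'. yext_mor C n A B S S' \<or> yext_mor C n A B S' S)\<^sup>*\<^sup>* Y X" unfolding yoneda_equiv_def .
    then have "\<exists>R. represents C R (fst X) (snd X) \<and> ext_list C B R A \<and> length R = n \<and> vanishes C R B B (idm C B)"
    proof (induction rule: rtranclp_induct)
      case base
      then show ?case using T Y by blast
    next
      case (step Z W)
      then obtain R where R: "represents C R (fst Z) (snd Z)" "ext_list C B R A" "length R = n" "vanishes C R B B (idm C B)"
        by blast
      have ZW: "yext C n A B Z" "yext C n A B W" using step(2) by (auto simp: yext_mor_def)
      obtain Q where Q: "represents C Q (fst W) (snd W)" "ext_list C B Q A" "length Q = n" using yext_list[OF ZW(2) n] by metis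
      from step(2) have "vanishes C Q B B (idm C B)"
      proof
        assume "yext_mor C n A B Z W"
        then have "ext_mor C R Q (idm C B) (idm C A)" using yext_mor_iff[OF R(1) Q(1) R(2) Q(2) R(3) Q(3) ZW] by blast
        then show ?thesis using vanishes_id_ext_mor_id R(2,4) Q(2) by blast
      next
        assume "yext_mor C n A B W Z"
        then have "ext_mor C Q R (idm C B) (idm C A)" using yext_mor_iff[OF Q(1) R(1) Q(2) R(2) Q(3) R(3) ZW(2,1)] by blast
        then show ?thesis using vanishes_id_ext_mor R(2,4) Q(2) by blast
      qed
      then show ?case using Q by blast
    qed
    then obtain R where R: "represents C R (fst X) (snd X)" "ext_list C B R A" "length R = n" "vanishes C R B B (idm C B)"
      by blast
    \<comment> \<open>The chosen cokernels make the list of a complex non-unique, so R need not be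
      S; the identity of X compares the two.\<close>
    have "yext_mor C n A B X X"
      using yext_mor_iff[OF X(1) X(1) S(1) S(1) S(2) S(2) X(2) X(2)] ext_mor_refl[OF S(1)] by blast
    then have "ext_mor C R S (idm C B) (idm C A)" using yext_mor_iff[OF R(1) X(1) R(2) S(1) R(3) S(2) X(2) X(2)] by blast
    then show "vanishes C S B B (idm C B)" using vanishes_id_ext_mor_id R(2,4) S(1) by blast
  qed
next
  assume v: "ext_vanishes C n A B"
  show "Ext_zero C n A B" unfolding Ext_zero_def
  proof (intro allI impI)
    fix X X' assume X: "yext C n A B X" and X': "yext C n A B X'"
    obtain S where S: "represents C S (fst X) (snd X)" "ext_list C B S A" "length S = n" using yext_list[OF X n] by metis
    have O: "A \<in> Ob C" "B \<in> Ob C" using ext_list_Ob S by auto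
    obtain T where T: "ext_list C B T A" "length T = n" "vanishes C T B B (idm C B)"
      "\<And>S. ext_list C B S A \<Longrightarrow> length S = n \<Longrightarrow> vanishes C S B B (idm C B) \<Longrightarrow>
       \<exists>S1. ext_list C B S1 A \<and> length S1 = n \<and> ext_mor C S S1 (idm C B) (idm C A) \<and>
         ext_mor C T S1 (idm C B) (idm C A)"
      using trivial_ext_list[OF O n] by metis
    obtain Y where Y: "represents C T (fst Y) (snd Y)" "yext C n A B Y" using list_yext[OF T(1,2) n] by metis
    let ?r = "\<lambda>S S'. yext_mor C n A B S S' \<or> yext_mor C n A B S' S"
    have *: "?r\<^sup>*\<^sup>* X Y \<and> ?r\<^sup>*\<^sup>* Y X" if X: "yext C n A B X" for X
    proof -
      obtain S where S: "represents C S (fst X) (snd X)" "ext_list C B S A" "length S = n" using yext_list[OF X n] by metis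
      then have "vanishes C S B B (idm C B)" using v unfolding ext_vanishes_def by blast
      then obtain S1 where S1: "ext_list C B S1 A" "length S1 = n" "ext_mor C S S1 (idm C B) (idm C A)"
        "ext_mor C T S1 (idm C B) (idm C A)" using T(4) S by blast
      obtain Z where Z: "represents C S1 (fst Z) (snd Z)" "yext C n A B Z" using list_yext[OF S1(1,2) n] by metis
      have "yext_mor C n A B X Z" using yext_mor_iff[OF S(1) Z(1) S(2) S1(1) S(3) S1(2) X Z(2)] S1(3) by blast
      moreover have "yext_mor C n A B Y Z" using yext_mor_iff[OF Y(1) Z(1) T(1) S1(1) T(2) S1(2) Y(2) Z(2)] S1(4) by blast
      ultimately have r: "?r X Z" "?r Z Y" "?r Y Z" "?r Z X" by blast+
      show ?thesis
        using rtranclp_trans[OF r_into_rtranclp[of ?r, OF r(1)] r_into_rtranclp[of ?r, OF r(2)]]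
          rtranclp_trans[OF r_into_rtranclp[of ?r, OF r(3)] r_into_rtranclp[of ?r, OF r(4)]] by (rule conjI)
    qed
    have "?r\<^sup>*\<^sup>* X X'" using *[OF X] *[OF X'] rtranclp_trans[of ?r X Y X'] by blast
    then show "yoneda_equiv C n A B X X'" unfolding yoneda_equiv_def .
  qed
qed

end


section \<open>Extensions in the opposite category\<close>

text \<open>There are n + 2 objects but only n + 1 maps, hence the two different offsets.\<close>

definition reverse_complex :: "nat \<Rightarrow> (nat \<Rightarrow> 'o) \<times> (nat \<Rightarrow> 'm) \<Rightarrow> (nat \<Rightarrow> 'o) \<times> (nat \<Rightarrow> 'm)" where
  "reverse_complex n X = (\<lambda>j. fst X (Suc n - j), \<lambda>j. snd X (n - j))"

lemma yext_rev:
  assumes "yext C n A B X" shows "yext (opc C) n B A (reverse_complex n X)"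
proof -
  let ?E = "fst X" and ?d = "snd X"
  have x: "exact_complex C (Suc n) ?E ?d" and AB: "?E 0 = B" "?E (Suc n) = A" using assms by (auto simp: yext_def)
  have "exact_complex (opc C) (Suc n) (\<lambda>j. ?E (Suc n - j)) (\<lambda>j. ?d (n - j))"
    unfolding exact_complex_def
  proof (intro conjI allI impI)
    fix j assume "j < Suc n"
    then show "?d (n - j) \<in> Hom (opc C) (?E (Suc n - j)) (?E (Suc n - Suc j))"
      using x by (auto simp: exact_complex_def Suc_diff_le)
  next
    show "is_mono (opc C) (?E (Suc n - 0)) (?E (Suc n - 1)) (?d (n - 0))"
      "is_epi (opc C) (?E (Suc n - (Suc n - 1))) (?E (Suc n - Suc n)) (?d (n - (Suc n - 1)))"
      using x by (auto simp: exact_complex_def)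
    fix j assume j: "Suc j < Suc n"
    define i where "i = n - Suc j"
    then have i: "n - j = Suc i" "Suc n - j = Suc (Suc i)" "n - Suc j = i" "Suc i < Suc n" using j by auto
    show "exact_at (opc C) (?E (Suc n - j)) (?E (Suc n - Suc j)) (?E (Suc n - Suc (Suc j))) (?d (n - j)) (?d (n - Suc j))"
      using x i unfolding exact_complex_def by simp
  qed simp
  then show ?thesis using AB by (simp add: yext_def reverse_complex_def)
qed

lemma yext_mor_rev:
  assumes "yext_mor C n A B X Y" shows "yext_mor (opc C) n B A (reverse_complex n Y) (reverse_complex n X)"
proof -
  obtain \<phi> where \<phi>: "\<forall>j\<le>Suc n. \<phi> j \<in> Hom C (fst X j) (fst Y j)" "\<phi> 0 = idm C B" "\<phi> (Suc n) = idm C A"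
    "\<forall>j<Suc n. cmp C (snd Y j) (\<phi> j) = cmp C (\<phi> (Suc j)) (snd X j)"
    using assms unfolding yext_mor_def by blast
  have "cmp C (\<phi> (Suc n - j)) (snd X (n - j)) = cmp C (snd Y (n - j)) (\<phi> (n - j))" if "j < Suc n" for j
    using \<phi>(4)[rule_format, of "n - j"] that by (simp add: Suc_diff_le)
  then show ?thesis unfolding yext_mor_def
    using assms \<phi>(1-3) yext_rev[of C n A B] 
    by (intro conjI exI[of _ "\<lambda>j. \<phi> (Suc n - j)"]) (auto simp: yext_mor_def reverse_complex_def)
qed

lemma yoneda_equiv_rev:
  assumes "yoneda_equiv C n A B X Y" shows "yoneda_equiv (opc C) n B A (reverse_complex n X) (reverse_complex n Y)"
  using assms unfolding yoneda_equiv_def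
proof (induction rule: rtranclp_induct)
  case (step Y Z)
  from step(2) have "yext_mor (opc C) n B A (reverse_complex n Y) (reverse_complex n Z) \<or> yext_mor (opc C) n B A (reverse_complex n Z) (reverse_complex n Y)"
    using yext_mor_rev[of C n A B Y Z] yext_mor_rev[of C n A B Z Y] by blast
  then show ?case using step(3) by (rule rtranclp.rtrancl_into_rtrancl[rotated])
qed simp

context abelian_cat begin

text \<open>Because of truncated subtraction, reversing twice restores X only on the indices in
  range. The two are therefore linked by identity components and not by an equation.\<close>

lemma yext_mor_rev_rev:
  assumes "yext C n A B X" shows "yext_mor C n A B X (reverse_complex n (reverse_complex n X))"
  unfolding yext_mor_def
proof (intro conjI exI[of _ "\<lambda>j. idm C (fst X j)"] allI impI)
  have H: "snd X j \<in> Hom C (fst X j) (fst X (Suc j))" if "j < Suc n" for j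
    using assms that by (auto simp: yext_def exact_complex_def)
  have O: "fst X j \<in> Ob C" if "j \<le> Suc n" for j
    using Hom_Ob(1)[OF H[of j]] Hom_Ob(2)[OF H[of n]] that by (cases "j = Suc n") auto
  show "yext C n A B X" by fact
  show "yext C n A B (reverse_complex n (reverse_complex n X))" using yext_rev[OF yext_rev[OF assms]] by simp
  fix j
  show "j \<le> Suc n \<Longrightarrow> idm C (fst X j) \<in> Hom C (fst X j) (fst (reverse_complex n (reverse_complex n X)) j)"
    using O id_Hom by (simp add: reverse_complex_def)
  assume j: "j < Suc n"
  then show "snd (reverse_complex n (reverse_complex n X)) j \<bullet> idm C (fst X j) = idm C (fst X (Suc j)) \<bullet> snd X j"
    using H[OF j] by (simp add: reverse_complex_def in_Hom_iff)
qed (use assms in \<open>auto simp: yext_def\<close>)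

lemma Ext_zero_opcD:
  assumes "Ext_zero (opc C) n A B" shows "Ext_zero C n B A"
  unfolding Ext_zero_def
proof (intro allI impI)
  fix X Y assume X: "yext C n B A X" and Y: "yext C n B A Y"
  have "yoneda_equiv (opc C) n A B (reverse_complex n X) (reverse_complex n Y)"
    using assms yext_rev[OF X] yext_rev[OF Y] unfolding Ext_zero_def by blast
  then have "yoneda_equiv C n B A (reverse_complex n (reverse_complex n X)) (reverse_complex n (reverse_complex n Y))"
    using yoneda_equiv_rev[of "opc C" n A B] by simp
  then have r: "(\<lambda>S S'. yext_mor C n B A S S' \<or> yext_mor C n B A S' S)\<^sup>*\<^sup>*
      (reverse_complex n (reverse_complex n X)) (reverse_complex n (reverse_complex n Y))" (is "?r\<^sup>*\<^sup>* _ _") unfolding yoneda_equiv_def .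
  have "?r\<^sup>*\<^sup>* X (reverse_complex n (reverse_complex n Y))"
    by (rule converse_rtranclp_into_rtranclp[OF _ r]) (rule disjI1[OF yext_mor_rev_rev[OF X]])
  then have "?r\<^sup>*\<^sup>* X Y"
    by (rule rtranclp.rtrancl_into_rtrancl) (rule disjI2[OF yext_mor_rev_rev[OF Y]])
  then show "yoneda_equiv C n B A X Y" unfolding yoneda_equiv_def .
qed

lemma Ext_zero_opc: "Ext_zero (opc C) n A B = Ext_zero C n B A"
  using Ext_zero_opcD abelian_cat.Ext_zero_opcD[OF abelian_cat_opc] by auto

section \<open>Vanishing of Ext in short exact sequences, in both variables\<close>

lemma Ext_kernel1:
  "short_exact C A' A A'' f g \<Longrightarrow> n \<ge> 1 \<Longrightarrow> Ext_zero C n A B \<Longrightarrow> Ext_zero C (Suc n) A'' B \<Longrightarrow> Ext_zero C n A' B"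
  using ext_vanishes_kernel Ext_zero_iff by simp

lemma Ext_extension1:
  "short_exact C A' A A'' f g \<Longrightarrow> n \<ge> 1 \<Longrightarrow> Ext_zero C n A' B \<Longrightarrow> Ext_zero C n A'' B \<Longrightarrow> Ext_zero C n A B"
  using ext_vanishes_extension Ext_zero_iff by simp

lemma Ext_cokernel1:
  "short_exact C A' A A'' f g \<Longrightarrow> n \<ge> 1 \<Longrightarrow> Ext_zero C n A' B \<Longrightarrow> Ext_zero C (Suc n) A B \<Longrightarrow>
    Ext_zero C (Suc n) A'' B"
  using ext_vanishes_cokernel Ext_zero_iff by simp

lemma Ext_cokernel1_1:
  "short_exact C A' A A'' f g \<Longrightarrow> (\<And>h. h \<in> Hom C A' B \<Longrightarrow> \<exists>h'\<in>Hom C A B. h' \<bullet> f = h) \<Longrightarrow>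
    Ext_zero C 1 A B \<Longrightarrow> Ext_zero C 1 A'' B"
  using ext_vanishes_cokernel_1[of A' A A'' f g B] Ext_zero_iff[of 1] by simp

lemma Ext1_extend:
  "Ext_zero C 1 c x \<Longrightarrow> short_exact C a b c f g \<Longrightarrow> h \<in> Hom C a x \<Longrightarrow> \<exists>h'\<in>Hom C b x. h' \<bullet> f = h"
  using ext_vanishes_extend[of c x] Ext_zero_iff[of 1] by simp

text \<open>Duality reverses the sequence, so a statement about the kernel in the first variable
  becomes one about the cokernel in the second, and conversely.\<close>

lemmas Ext_cokernel2 = abelian_cat.Ext_kernel1[OF abelian_cat_opc, unfolded Ext_zero_opc, simplified]
lemmas Ext_extension2 = abelian_cat.Ext_extension1[OF abelian_cat_opc, unfolded Ext_zero_opc, simplified]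
lemmas Ext_kernel2 = abelian_cat.Ext_cokernel1[OF abelian_cat_opc, unfolded Ext_zero_opc, simplified]
lemmas Ext_kernel2_1 = abelian_cat.Ext_cokernel1_1[OF abelian_cat_opc, unfolded Ext_zero_opc, simplified]

section \<open>Coresolutions\<close>

lemma kernel_comp_mono:
  assumes "is_kernel C a b e K k" "is_mono C b c m"
  shows "is_kernel C a c (m \<bullet> e) K k"
proof (rule is_kernelI)
  note k = is_kernelD[OF assms(1)] and m = is_monoD(1)[OF assms(2)]
  show "m \<bullet> e \<in> Hom C a c" using comp_Hom[OF k(1) m] .
  show "is_mono C K a k" by (rule k)
  show "(m \<bullet> e) \<bullet> k = zer C K c" using comp_assoc[OF k(2,1) m] k(3) m Hom_Ob[OF k(2)] by (simp add: in_Hom_iff)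
  fix Y g assume g: "g \<in> Hom C Y a" "(m \<bullet> e) \<bullet> g = zer C Y c"
  have "e \<bullet> g = zer C Y b" using is_monoD(3)[OF assms(2) comp_Hom[OF g(1) k(1)]] comp_assoc[OF g(1) k(1) m] g(2) by simp
  then show "\<exists>h\<in>Hom C Y K. k \<bullet> h = g" using k(4) g(1) by blast
qed

lemma kernel_unique:
  assumes "is_kernel C a b f K k" "is_kernel C a b f L l"
  obtains s r where "s \<in> Hom C K L" "r \<in> Hom C L K" "r \<bullet> s = idm C K"
proof -
  note K = is_kernelD[OF assms(1)] and L = is_kernelD[OF assms(2)]
  obtain s where s: "s \<in> Hom C K L" "l \<bullet> s = k" using L(4)[OF K(2,3)] by blast
  obtain r where r: "r \<in> Hom C L K" "k \<bullet> r = l" using K(4)[OF L(2,3)] by blast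
  have "k \<bullet> r \<bullet> s = k \<bullet> idm C K" using comp_reassoc[OF r(2) r(1) K(2) s(1)] s(2) K(2) by (simp add: in_Hom_iff)
  then have "r \<bullet> s = idm C K" using mono_cancel[OF K(5) comp_Hom[OF s(1) r(1)] id_Hom] Hom_Ob[OF s(1)] by blast
  then show thesis using that s r by blast
qed

lemma exact_complex_1:
  "exact_complex C (Suc 0) E d \<longleftrightarrow> is_mono C (E 0) (E (Suc 0)) (d 0) \<and> is_epi C (E 0) (E (Suc 0)) (d 0)"
  by (auto simp: exact_complex_def is_mono_def)

text \<open>The case m = 0, where the coresolution is a single isomorphism.\<close>

lemma coresol_iso:
  assumes "is_mono C M Y e" "is_epi C M Y e" "Y \<in> \<Y>" "Y \<in> \<X>"
  shows "M \<in> coresol C \<Y> \<X>"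
  unfolding coresol_def
  using assms Hom_Ob(1)[OF is_monoD(1)[OF assms(1)]]
  by (auto simp: exact_complex_1 intro!: exI[of _ 0] exI[of _ "case_nat M (\<lambda>_. Y)"] exI[of _ "\<lambda>_. e"]
      split: nat.split)

text \<open>After splicing, K is the image of the map at index 1, so K in X is exactly the new image
  condition.\<close>

lemma coresol_Cons:
  assumes se: "short_exact C M Y K f e" and "Y \<in> \<Y>" "K \<in> coresol C \<Y> \<X>" "K \<in> \<X>"
  shows "M \<in> coresol C \<Y> \<X>"
proof -
  obtain m E d where E: "exact_complex C (Suc m) E d" "E 0 = K" "\<forall>j\<in>{1..Suc m}. E j \<in> \<Y>" "E (Suc m) \<in> \<X>"
    "\<forall>i. 1 \<le> i \<and> i < m \<longrightarrow> image_in C (E i) (E (Suc i)) (d i) \<X>"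
    using assms(3) unfolding coresol_def by blast
  let ?E = "case_nat M (case_nat Y (\<lambda>j. E (Suc j)))" and ?d = "case_nat f (case_nat (d 0 \<bullet> e) (\<lambda>j. d (Suc j)))"
  have "exact_complex C (Suc (Suc m)) ?E ?d" using exact_complex_Cons[of M Y E f e] se E by simp
  moreover have "?E j \<in> \<Y>" if "j \<in> {1..Suc (Suc m)}" for j
    using that assms(2) E(3) by (auto split: nat.split)
  moreover have "image_in C (?E i) (?E (Suc i)) (?d i) \<X>" if "1 \<le> i" "i < Suc m" for i
  proof (cases "i = 1")
    case True
    have "is_mono C K (E (Suc 0)) (d 0)" using E(1,2) by (auto simp: exact_complex_def)
    then show ?thesis unfolding image_in_def using short_exact_props(5)[OF se] assms(4) True by auto
  next
    case False
    then have "i = Suc (Suc (i - 2))" using that by simp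
    then obtain l where l: "i = Suc (Suc l)" by blast
    then show ?thesis using E(5)[rule_format, of "Suc l"] that by simp
  qed
  ultimately show ?thesis unfolding coresol_def using short_exact_Ob(1)[OF se] E(4)
    by (auto intro!: exI[of _ "Suc m"] exI[of _ ?E] exI[of _ ?d])
qed

text \<open>Peels off the first cosyzygy K together with the fact that it lies in X. If only one
  term follows, no image condition is available, but K is isomorphic to that last term; otherwise K
  is isomorphic to the image supplied by \<open>image_in\<close>. Both cases rely on closure of X
  under isomorphism.\<close>

lemma coresol_induct [consumes 2, case_names iso Cons]:
  assumes M: "M \<in> coresol C \<Y> \<X>" and X: "\<forall>a b e. is_mono C a b e \<longrightarrow> is_epi C a b e \<longrightarrow> b \<in> \<X> \<longrightarrow> a \<in> \<X>"
    and iso: "\<And>M Y e. is_mono C M Y e \<Longrightarrow> is_epi C M Y e \<Longrightarrow> Y \<in> \<Y> \<Longrightarrow> Y \<in> \<X> \<Longrightarrow> P M"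
    and Cons: "\<And>M Y K f e. short_exact C M Y K f e \<Longrightarrow> Y \<in> \<Y> \<Longrightarrow> K \<in> coresol C \<Y> \<X> \<Longrightarrow> K \<in> \<X> \<Longrightarrow> P K \<Longrightarrow> P M"
  shows "P M"
proof -
  have "P (E 0)" if "exact_complex C (Suc m) E d" "\<forall>j\<in>{1..Suc m}. E j \<in> \<Y>" "E (Suc m) \<in> \<X>"
    "\<forall>i. 1 \<le> i \<and> i < m \<longrightarrow> image_in C (E i) (E (Suc i)) (d i) \<X>" for m E d
    using that
  proof (induction m arbitrary: E d)
    case 0
    then show ?case using iso[of "E 0" "E 1" "d 0"] by (simp add: exact_complex_1)
  next
    case (Suc m)
    obtain K e k where k: "short_exact C (E 0) (E (Suc 0)) K (d 0) e" "k \<in> Hom C K (E (Suc (Suc 0)))"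
      "d (Suc 0) = k \<bullet> e" "is_mono C K (E (Suc (Suc 0))) k"
      "exact_complex C (Suc m) (case_nat K (\<lambda>j. E (Suc (Suc j)))) (case_nat k (\<lambda>j. d (Suc (Suc j))))"
      using exact_complex_split[OF Suc.prems(1)] by metis
    note S = short_exact_props[OF k(1)]
    let ?E = "case_nat K (\<lambda>j. E (Suc (Suc j)))" and ?d = "case_nat k (\<lambda>j. d (Suc (Suc j)))"
    have y: "?E j \<in> \<Y>" if "j \<in> {1..Suc m}" for j using that Suc.prems(2) by (auto split: nat.split)
    have x: "?E (Suc m) \<in> \<X>" using Suc.prems(3) by simp
    have im: "image_in C (?E i) (?E (Suc i)) (?d i) \<X>" if i: "1 \<le> i" "i < m" for i
    proof -
      obtain l where l: "i = Suc l" using i by (cases i) auto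
      then show ?thesis using i Suc.prems(4)[rule_format, of "Suc (Suc l)"] by simp
    qed
    have KX: "K \<in> \<X>"
    proof (cases "m = 0")
      case True
      then have "is_epi C K (E (Suc (Suc 0))) k" using k(5) by (simp add: exact_complex_1)
      then show ?thesis using X k(4) x True by simp
    next
      case False
      then obtain I e' m' where I: "is_epi C (E (Suc 0)) I e'" "is_mono C I (E (Suc (Suc 0))) m'" "m' \<bullet> e' = d (Suc 0)" "I \<in> \<X>"
        using Suc.prems(4)[rule_format, of 1] unfolding image_in_def by auto
      note e' = is_epiD(1)[OF I(1)] and m' = is_monoD(1)[OF I(2)]
      have "m' \<bullet> e' \<bullet> d 0 = k \<bullet> e \<bullet> d 0" using comp_reassoc[OF I(3) e' m' S(1)] comp_assoc[OF S(1,2) k(2)] k(3) by simp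
      then have "m' \<bullet> e' \<bullet> d 0 = zer C (E 0) (E (Suc (Suc 0)))" unfolding S(3) using k(2) Hom_Ob[OF S(1)] by (simp add: in_Hom_iff)
      then have "e' \<bullet> d 0 = zer C (E 0) I" using is_monoD(3)[OF I(2) comp_Hom[OF S(1) e']] by blast
      then obtain t where t: "t \<in> Hom C K I" "t \<bullet> e = e'" using S(7)[OF e'] by blast
      have "is_epi C K I t" using epi_of_comp[of "E (Suc 0)" I t e K] I(1) t S(2) by simp
      moreover have "(m' \<bullet> t) \<bullet> e = k \<bullet> e" using comp_assoc[OF S(2) t(1) m'] t(2) I(3) k(3) by simp
      then have "m' \<bullet> t = k" using epi_cancel[OF S(5) comp_Hom[OF t(1) m'] k(2)] by blast
      then have "is_mono C K I t" using mono_of_comp[of K "E (Suc (Suc 0))" m' t I] k(4) t m' by simp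
      ultimately show ?thesis using X I(4) by blast
    qed
    have "P K" using Suc.IH[OF k(5)] y x im by simp
    moreover have "K \<in> coresol C \<Y> \<X>" unfolding coresol_def
      using Hom_Ob(1)[OF k(2)] k(5) y x im by (auto intro!: exI[of _ m] exI[of _ ?E] exI[of _ ?d])
    ultimately show ?case using Cons[OF k(1)] KX Suc.prems(2) by simp
  qed
  then show ?thesis using M unfolding coresol_def by blast
qed

text \<open>Each of the k short exact sequences shifts the degree by one, so degree i at the right
  end is controlled by degree i + k > k at E 0.\<close>

lemma Ext_zero_complex:
  assumes "exact_complex C (Suc k) E d" "k \<ge> 1" "\<And>j i. j \<in> {1..k} \<Longrightarrow> i \<ge> 1 \<Longrightarrow> Ext_zero C i M (E j)"
    "\<And>i. i > k \<Longrightarrow> Ext_zero C i M (E 0)" "i \<ge> 1"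
  shows "Ext_zero C i M (E (Suc k))"
  using assms(2,1,3-)
proof (induction k arbitrary: E d rule: nat_induct_at_least)
  case base
  then have "short_exact C (E 0) (E 1) (E (Suc 1)) (d 0) (d 1)" using exact_complex_2 by simp
  then show ?case by (rule Ext_cokernel2) (use base in auto)
next
  case (Suc k)
  obtain K e k' where k: "short_exact C (E 0) (E (Suc 0)) K (d 0) e"
    "exact_complex C (Suc k) (case_nat K (\<lambda>j. E (Suc (Suc j)))) (case_nat k' (\<lambda>j. d (Suc (Suc j))))"
    using exact_complex_split[OF Suc.prems(1)] by metis
  let ?E = "case_nat K (\<lambda>j. E (Suc (Suc j)))"
  have "Ext_zero C i M (?E (Suc k))"
  proof (rule Suc.IH[OF k(2)])
    fix i assume "i > k"
    then show "Ext_zero C i M (?E 0)" using Ext_cokernel2[OF k(1)] Suc.prems(2,3) by auto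
  next
    fix j i :: nat assume "j \<in> {1..k}" "1 \<le> i"
    then show "Ext_zero C i M (?E j)" using Suc.prems(2)[of "Suc j" i] by (cases j) auto
  qed (rule Suc.prems)
  then show ?case by simp
qed

end

section \<open>Tilting classes\<close>

locale tilting_class = abelian_cat C for C :: "('o,'m) abcat" +
  fixes X T :: "'o set" and n :: nat
  assumes ext_closed_X: "ext_closed C X" and smd_X: "X = smd C X" and tilting_T: "tilting C X n T"
begin

section \<open>Direct consequences of the tilting conditions\<close>

lemma smd_T: "T = smd C T" using tilting_T unfolding tilting_def by blast

lemma X_Ob: "M \<in> X \<Longrightarrow> M \<in> Ob C" using smd_X unfolding smd_def by blast
lemma T_Ob: "M \<in> T \<Longrightarrow> M \<in> Ob C" using smd_T unfolding smd_def by blast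

lemma X_retract: "N \<in> X \<Longrightarrow> s \<in> Hom C M N \<Longrightarrow> r \<in> Hom C N M \<Longrightarrow> r \<bullet> s = idm C M \<Longrightarrow> M \<in> X"
  by (subst smd_X) (auto simp: smd_def intro: Hom_Ob)

lemma T_retract: "N \<in> T \<Longrightarrow> s \<in> Hom C M N \<Longrightarrow> r \<in> Hom C N M \<Longrightarrow> r \<bullet> s = idm C M \<Longrightarrow> M \<in> T"
  by (subst smd_T) (auto simp: smd_def intro: Hom_Ob)

lemma X_extension: "short_exact C a b c f g \<Longrightarrow> a \<in> X \<Longrightarrow> c \<in> X \<Longrightarrow> b \<in> X"
  using ext_closed_X unfolding ext_closed_def by blast

lemma X_iso: "\<forall>a b e. is_mono C a b e \<longrightarrow> is_epi C a b e \<longrightarrow> b \<in> X \<longrightarrow> a \<in> X"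
  using mono_epi_iso X_retract is_monoD(1) by metis

lemma T_iso: "is_mono C a b e \<Longrightarrow> is_epi C a b e \<Longrightarrow> b \<in> T \<Longrightarrow> a \<in> T"
  using mono_epi_iso[of a b e] T_retract is_monoD(1) by metis

lemma perpI: "M \<in> Ob C \<Longrightarrow> (\<And>N i. N \<in> T \<Longrightarrow> i \<ge> 1 \<Longrightarrow> Ext_zero C i N M) \<Longrightarrow> M \<in> perp_right C T"
  unfolding perp_right_def by blast

lemma perpD: "M \<in> perp_right C T \<Longrightarrow> N \<in> T \<Longrightarrow> i \<ge> 1 \<Longrightarrow> Ext_zero C i N M"
  unfolding perp_right_def by blast

lemma TX_perp: "M \<in> T \<Longrightarrow> M \<in> X \<Longrightarrow> M \<in> perp_right C T"
  using tilting_T unfolding tilting_def by blast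

text \<open>The infimum of the empty set in \<open>enat\<close> is infinite. A finite bound
  therefore makes the set of admissible degrees nonempty, and its infimum is attained.\<close>

lemma pd_bound:
  assumes "pd_class C X T \<le> enat k" "M \<in> T" "Y \<in> X" "i > k"
  shows "Ext_zero C i M Y"
proof -
  let ?S = "{enat n | n. \<forall>k>n. \<forall>Y\<in>X. Ext_zero C k M Y}"
  have "pd C X M \<le> enat k" using assms(1,2) unfolding pd_class_def by (meson SUP_upper order_trans image_eqI Sup_upper)
  then have le: "Inf ?S \<le> enat k" unfolding pd_def .
  have "?S \<noteq> {}"
  proof
    assume "?S = {}"
    then have "Inf ?S = top" by (simp only: Inf_empty)
    then show False using le by (simp add: top_enat_def)
  qed
  then have "Inf ?S \<in> ?S" by (metis (no_types, lifting) Inf_enat_def LeastI_ex ex_in_conv)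
  then obtain m where "Inf ?S = enat m" "\<forall>k>m. \<forall>Y\<in>X. Ext_zero C k M Y" by blast
  then show ?thesis using le assms(3,4) by auto
qed

lemma ext_high: "M \<in> T \<Longrightarrow> Y \<in> X \<Longrightarrow> i > n \<Longrightarrow> Ext_zero C i M Y"
  using pd_bound tilting_T unfolding tilting_def by blast

text \<open>Ext^i(M,Y) sits between Ext^i(N,Y) and Ext^(i+1)(K,Y), so the degree must vary in the
  induction.\<close>

lemma coresol_perp:
  assumes "M \<in> coresol C T X" "Y \<in> perp_right C T" "i \<ge> 1" shows "Ext_zero C i M Y"
  using assms(1) X_iso assms(3)
proof (induction arbitrary: i rule: coresol_induct)
  case (iso M N e)
  then show ?case using T_iso perpD assms(2) by blast
next
  case (Cons M N K f e)
  then show ?case using Ext_kernel1[OF Cons(1)] perpD[OF assms(2)] by simp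
qed

lemma generator:
  assumes "Y \<in> X"
  obtains W X' f g where "W \<in> coresol C T X" "W \<in> X" "X' \<in> X" "short_exact C X' W Y f g"
  using tilting_T assms unfolding tilting_def rel_generator_def by (meson subsetD)

lemma cogenerator:
  assumes "Y \<in> X"
  obtains W X' f g where "W \<in> perp_right C T" "W \<in> X" "X' \<in> X" "short_exact C Y W X' f g"
  using tilting_T assms unfolding tilting_def rel_cogenerator_def by (meson subsetD Int_iff)

text \<open>The zero object is a retract of every object, so it suffices that T and X are inhabited.
  For T this is read off the coresolution of a generator covering Y.\<close>

lemma zero_TX:
  assumes "Y \<in> X" "z \<in> Ob C" "\<And>a f. f \<in> Hom C a z \<Longrightarrow> f = zer C a z"
  shows "z \<in> T" "z \<in> X" "z \<in> coresol C T X"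
proof -
  have id: "idm C z = zer C z z" using assms(3)[OF id_Hom[OF assms(2)]] .
  have r: "zer C M z \<bullet> zer C z M = idm C z" "zer C z M \<in> Hom C z M" "zer C M z \<in> Hom C M z" if "M \<in> Ob C" for M
    using id that assms(2) by (simp_all add: in_Hom_iff)
  obtain W where "W \<in> coresol C T X" using generator[OF assms(1)] by metis
  then have "\<exists>N. N \<in> T" unfolding coresol_def by force
  then show zT: "z \<in> T" using T_retract r T_Ob by metis
  show zX: "z \<in> X" using X_retract[OF assms(1)] r X_Ob[OF assms(1)] by metis
  show "z \<in> coresol C T X"
    by (rule coresol_iso[of z z "idm C z"]) (use zT zX assms(2) in \<open>auto simp: is_mono_def is_epi_def in_Hom_iff\<close>)
qed

text \<open>An object of T that is its own coresolution is given the cokernel 0, so that both forms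
  of coresolution begin with a short exact sequence.\<close>

lemma coresol_short_exact:
  assumes "M \<in> coresol C T X"
  obtains N K f e where "short_exact C M N K f e" "N \<in> T" "K \<in> coresol C T X" "K \<in> X"
proof -
  have "\<exists>N K f e. short_exact C M N K f e \<and> N \<in> T \<and> K \<in> coresol C T X \<and> K \<in> X"
    using assms X_iso
  proof (induction rule: coresol_induct)
    case (iso M N e)
    obtain z where z: "z \<in> Ob C" "\<And>a. a \<in> Ob C \<Longrightarrow> short_exact C a a z (idm C a) (zer C a z)"
      "\<And>a f. f \<in> Hom C a z \<Longrightarrow> f = zer C a z" using zero_object by metis
    have "M \<in> T" using T_iso iso by blast
    then show ?case using z(2)[of M] zero_TX[OF iso(4) z(1,3)] T_Ob by blast
  next
    case (Cons M N K f e)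
    then show ?case by blast
  qed
  then show thesis using that by blast
qed

text \<open>The precover v : N -> Z is not assumed to be epi, nor its kernel K to lie in X. Both
  follow from an epi u : Y0 -> Z with Y0 in T and kernel L in X. As u factors through v, v is epi.
  The pullback P of v and u is an extension of N by L, hence in X, and K is a direct summand of
  P.\<close>

lemma perp_approximation:
  assumes Z: "Z \<in> perp_right C T" "Z \<in> X"
  obtains K N f g where "short_exact C K N Z f g" "N \<in> T" "N \<in> X" "K \<in> perp_right C T" "K \<in> X"
proof -
  obtain W X' x w where W: "W \<in> coresol C T X" "W \<in> X" "X' \<in> X" "short_exact C X' W Z x w" using generator[OF Z(2)] by metis
  obtain Y0 C1 a e where Y0: "short_exact C W Y0 C1 a e" "Y0 \<in> T" "C1 \<in> coresol C T X" "C1 \<in> X"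
    using coresol_short_exact[OF W(1)] by metis
  have Y0X: "Y0 \<in> X" using X_extension[OF Y0(1) W(2) Y0(4)] .
  note SW = short_exact_props[OF W(4)] and SY = short_exact_props[OF Y0(1)]
  obtain Q l' f' g' where Q: "is_pushout C W Y0 Z a w Q l' f'" "short_exact C Z Q C1 f' g'" "l' \<in> Hom C Y0 Q"
    using push_out[OF Y0(1) SW(2)] by metis
  have XQ: "short_exact C X' Y0 Q (a \<bullet> x) l'" using pushout_short_exact_epi[OF Q(1) W(4) SY(4)] .
  obtain r where r: "r \<in> Hom C Q Z" "r \<bullet> f' = idm C Z"
    using Ext1_extend[OF coresol_perp[OF Y0(3) Z(1)] Q(2) id_Hom[OF X_Ob[OF Z(2)]]] by auto
  \<comment> \<open>The pushout Q is split by r with complement C1, so the kernel of u = r l' is the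
    preimage L of C1 in Y0, an extension of C1 by X'.\<close>
  obtain s where s: "short_exact C C1 Q Z s r" using split_retraction[OF Q(2) r] by blast
  obtain L h' p' i' where L: "is_pullback C Q Y0 C1 l' s L h' p'" "short_exact C X' L C1 i' p'"
    using pull_back[OF XQ short_exact_props(1)[OF s]] by metis
  have LX: "L \<in> X" using X_extension[OF L(2) W(3) Y0(4)] .
  define u where "u = r \<bullet> l'"
  have LY: "short_exact C L Y0 Z h' u"
    unfolding u_def using pullback_short_exact_mono[OF L(1) s short_exact_props(5)[OF XQ]] .
  note SL = short_exact_props[OF LY]
  obtain N v where N: "N \<in> X" "is_precover C T v N Z" using tilting_T Z unfolding tilting_def by blast
  have NT: "N \<in> T" and vH: "v \<in> Hom C N Z" and pc: "\<And>M g. M \<in> T \<Longrightarrow> g \<in> Hom C M Z \<Longrightarrow> \<exists>h\<in>Hom C M N. v \<bullet> h = g"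
    using N(2) unfolding is_precover_def by auto
  obtain h where h: "h \<in> Hom C Y0 N" "v \<bullet> h = u" using pc[OF Y0(2) SL(2)] by blast
  have ve: "is_epi C N Z v" using epi_of_comp[of Y0 Z v h N] h SL(5) vH by simp
  obtain K k where "is_kernel C N Z v K k" using kernel_ex[OF vH] by metis
  then have K: "short_exact C K N Z k v" using short_exactI[OF ve] by blast
  obtain P p1 p2 k' where P: "is_pullback C Z N Y0 v u P p1 p2" "short_exact C K P Y0 k' p2"
    using pull_back[OF K SL(2)] by metis
  obtain j where "short_exact C L P N j p1" using pullback_short_exact[OF is_pullbackD(8)[OF P(1)] LY] by metis
  then have PX: "P \<in> X" using X_extension LX N(1) by blast
  note Y0O = Hom_Ob(1)[OF h(1)]
  have "v \<bullet> h = u \<bullet> idm C Y0" using h(2) SL(2) by (simp add: in_Hom_iff)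
  \<comment> \<open>The lift h of u through v is a section of the base change p2 of v; this splits K
    off P.\<close>
  then obtain t where t: "t \<in> Hom C Y0 P" "p2 \<bullet> t = idm C Y0" using is_pullbackD(6)[OF P(1) h(1) id_Hom[OF Y0O]] by blast
  obtain \<rho> where \<rho>: "short_exact C Y0 P K t \<rho>" "\<rho> \<bullet> k' = idm C K" using split_section[OF P(2) t] by blast
  have KX: "K \<in> X" using X_retract[OF PX short_exact_props(1)[OF P(2)] short_exact_props(2)[OF \<rho>(1)] \<rho>(2)] .
  have "K \<in> perp_right C T"
  proof (rule perpI[OF X_Ob[OF KX]])
    fix M and i :: nat assume M: "M \<in> T" and i: "i \<ge> 1"
    have NE: "Ext_zero C j M N" if "j \<ge> 1" for j using perpD[OF TX_perp[OF NT N(1)] M that] .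
    show "Ext_zero C i M K"
    proof (cases "i = 1")
      case True
      \<comment> \<open>In degree one there is no Ext term to shift from; the precover property
        provides surjectivity on Hom instead.\<close>
      then show ?thesis using Ext_kernel2_1[OF K pc[OF M]] NE by simp
    next
      case False
      then obtain j where j: "i = Suc j" "j \<ge> 1" using i by (cases i) auto
      then show ?thesis using Ext_kernel2[OF K] perpD[OF Z(1) M] NE by simp
    qed
  qed
  then show thesis using that K NT N(1) KX by blast
qed

text \<open>Salce's argument: the approximation of B is pulled back along Y -> B. The pullback D
  retains the kernel Z, and it sits in N with quotient A, so N followed by a coresolution of A
  coresolves D.\<close>

lemma coresol_approximation_left:
  assumes "short_exact C Y B A f g" "B \<in> perp_right C T" "B \<in> X" "A \<in> coresol C T X" "A \<in> X" "Y \<in> X"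
  obtains Z D z d where "short_exact C Z D Y z d" "Z \<in> perp_right C T" "Z \<in> X" "D \<in> coresol C T X" "D \<in> X"
proof -
  obtain Z N z t where N: "short_exact C Z N B z t" "N \<in> T" "N \<in> X" "Z \<in> perp_right C T" "Z \<in> X"
    using perp_approximation[OF assms(2,3)] by metis
  obtain D h' p' z' where D: "is_pullback C B N Y t f D h' p'" "short_exact C Z D Y z' p'"
    using pull_back[OF N(1) short_exact_props(1)[OF assms(1)]] by metis
  have "short_exact C D N A h' (g \<bullet> t)"
    using pullback_short_exact_mono[OF D(1) assms(1) short_exact_props(5)[OF N(1)]] .
  then have "D \<in> coresol C T X" using coresol_Cons N(2) assms(4,5) by blast
  moreover have "D \<in> X" using X_extension[OF D(2) N(5) assms(6)] .
  ultimately show thesis using that D(2) N(4,5) by blast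
qed

text \<open>Induction on the last degree m in which Ext(T,Y) may be nonzero; the cosyzygy Y' in the
  cogenerator lowers it by one. The approximation D -> Y' is pulled back along W -> Y': the result E
  contains Y with quotient D, and it is an extension of W by Z, hence orthogonal to T.\<close>

lemma perp_approximation_right_aux:
  assumes "Y \<in> X" "\<And>M i. M \<in> T \<Longrightarrow> i > m \<Longrightarrow> Ext_zero C i M Y"
  shows "\<exists>B A f g. short_exact C Y B A f g \<and> B \<in> perp_right C T \<and> B \<in> X \<and> A \<in> coresol C T X \<and> A \<in> X"
  using assms
proof (induction m arbitrary: Y)
  case 0
  obtain z where z: "z \<in> Ob C" "\<And>a. a \<in> Ob C \<Longrightarrow> short_exact C a a z (idm C a) (zer C a z)"
    "\<And>a f. f \<in> Hom C a z \<Longrightarrow> f = zer C a z" using zero_object by metis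
  have "Y \<in> perp_right C T" using 0 by (intro perpI X_Ob) auto
  then show ?case using z(2)[OF X_Ob[OF 0(1)]] zero_TX[OF 0(1) z(1,3)] 0(1) by blast
next
  case (Suc m)
  obtain W Y' a b where W: "W \<in> perp_right C T" "W \<in> X" "Y' \<in> X" "short_exact C Y W Y' a b"
    using cogenerator[OF Suc.prems(1)] by metis
  have "Ext_zero C i M Y'" if "M \<in> T" "i > m" for M i
    using Ext_cokernel2[OF W(4)] perpD[OF W(1) that(1)] Suc.prems(2)[OF that(1)] that(2) by simp
  then obtain B A f g where B: "short_exact C Y' B A f g" "B \<in> perp_right C T" "B \<in> X" "A \<in> coresol C T X" "A \<in> X"
    using Suc.IH[OF W(3)] by blast
  obtain Z D z d where D: "short_exact C Z D Y' z d" "Z \<in> perp_right C T" "Z \<in> X" "D \<in> coresol C T X" "D \<in> X"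
    using coresol_approximation_left[OF B W(3)] by metis
  obtain E h' p' a' where E: "is_pullback C Y' W D b d E h' p'" "short_exact C Y E D a' p'"
    using pull_back[OF W(4) short_exact_props(2)[OF D(1)]] by metis
  obtain z' where z': "short_exact C Z E W z' h'" using pullback_short_exact[OF is_pullbackD(8)[OF E(1)] D(1)] by metis
  have "E \<in> X" using X_extension[OF z' D(3) W(2)] .
  moreover have "E \<in> perp_right C T"
    using Ext_extension2[OF z'] perpD[OF D(2)] perpD[OF W(1)] X_Ob[OF \<open>E \<in> X\<close>] by (intro perpI) auto
  ultimately show ?case using E(2) D(4,5) by blast
qed

lemma perp_approximation_right:
  assumes "Y \<in> X"
  obtains B A f g where "short_exact C Y B A f g" "B \<in> perp_right C T" "B \<in> X" "A \<in> coresol C T X" "A \<in> X"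
  using perp_approximation_right_aux[OF assms ext_high[OF _ assms]] by blast

section \<open>The left orthogonal class and the classes Fac\<close>

lemma coresol_Ob: "M \<in> coresol C Y Z \<Longrightarrow> M \<in> Ob C" unfolding coresol_def by blast

lemma coresol_perp_left: "M \<in> coresol C T X \<Longrightarrow> M \<in> perp_left C (perp_right C T)"
  using coresol_perp coresol_Ob unfolding perp_left_def by blast

lemma perp_left_coresol:
  assumes M: "M \<in> perp_left C (perp_right C T \<inter> X)" "M \<in> X"
  shows "M \<in> coresol C T X"
proof -
  obtain B A f g where B: "short_exact C M B A f g" "B \<in> perp_right C T" "B \<in> X" "A \<in> coresol C T X" "A \<in> X"
    using perp_approximation_right[OF M(2)] by metis
  obtain K N k t where N: "short_exact C K N B k t" "N \<in> T" "N \<in> X" "K \<in> perp_right C T" "K \<in> X"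
    using perp_approximation[OF B(2,3)] by metis
  have "Ext_zero C 1 M K" using M(1) N(4,5) unfolding perp_left_def by blast
  \<comment> \<open>B is an extension of A by M, and both have no Ext^1 into K; hence N -> B
    splits.\<close>
  then have "Ext_zero C 1 B K" using Ext_extension1[OF B(1)] coresol_perp[OF B(4) N(4)] by simp
  then obtain r where r: "r \<in> Hom C N K" "r \<bullet> k = idm C K"
    using Ext1_extend[OF _ N(1) id_Hom[OF X_Ob[OF N(5)]]] by blast
  obtain s where s: "short_exact C B N K s r" "t \<bullet> s = idm C B" using split_retraction[OF N(1) r] by blast
  have "B \<in> T" using T_retract[OF N(2) short_exact_props(1)[OF s(1)] short_exact_props(2)[OF N(1)] s(2)] .
  then show ?thesis using coresol_Cons[OF B(1)] B(4,5) by blast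
qed

lemma coresol_mono: "Y \<subseteq> Y' \<Longrightarrow> coresol C Y X \<subseteq> coresol C Y' X"
  unfolding coresol_def by blast

text \<open>Each term N is an extension of the cosyzygy K by M, both in X, so extension closure puts
  the terms in X.\<close>

lemma coresol_inter:
  assumes "M \<in> coresol C T X" "M \<in> X" shows "M \<in> coresol C (T \<inter> X) X"
  using assms(1) X_iso assms(2)
proof (induction rule: coresol_induct)
  case (iso M N e)
  then show ?case using coresol_iso[OF iso(1,2)] by blast
next
  case (Cons M N K f e)
  then show ?case using coresol_Cons[OF Cons(1)] X_extension[OF Cons(1)] by blast
qed

text \<open>The leftmost kernel E 0 lies in X, so Ext^i(T,E 0) = 0 for i > k by the bound on the
  projective dimension; shifting along the k terms in T then kills all positive degrees at
  Z.\<close>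

lemma Fac_perp:
  assumes k: "k \<ge> 1" "pd_class C X T \<le> enat k" and Z: "Z \<in> Fac C X k T"
  shows "Z \<in> perp_right C T"
proof -
  obtain E d where E: "exact_complex C (Suc k) E d" "E (Suc k) = Z"
    "\<forall>j\<in>{1..k}. E j \<in> T \<inter> X \<and> kernel_in C (E j) (E (Suc j)) (d j) X" and O: "Z \<in> Ob C"
    using Z unfolding Fac_def by blast
  obtain m where m: "k = Suc m" using k(1) by (cases k) auto
  obtain K e l where K: "short_exact C (E 0) (E (Suc 0)) K (d 0) e" "d (Suc 0) = l \<bullet> e" "is_mono C K (E (Suc (Suc 0))) l"
    using exact_complex_split[OF E(1)[unfolded m]] by metis
  \<comment> \<open>The condition \<open>kernel_in\<close> gives some kernel of d 1 in X. As l is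
    mono, E 0 is also a kernel of d 1 = l e, and kernels are retracts of each other.\<close>
  have ker: "is_kernel C (E (Suc 0)) (E (Suc (Suc 0))) (d (Suc 0)) (E 0) (d 0)"
    unfolding K(2) using kernel_comp_mono[OF short_exactD(1)[OF K(1)] K(3)] .
  obtain L x where L: "is_kernel C (E (Suc 0)) (E (Suc (Suc 0))) (d (Suc 0)) L x" "L \<in> X"
    using E(3) k(1) unfolding kernel_in_def by force
  have "E 0 \<in> X" using kernel_unique[OF ker L(1)] X_retract[OF L(2)] by metis
  then have "Ext_zero C i M (E (Suc k))" if "M \<in> T" "i \<ge> 1" for M i
    using E(3) perpD[OF TX_perp, OF _ _ that(1)] pd_bound[OF k(2) that(1)] that(2)
    by (intro Ext_zero_complex[OF E(1) k(1)]) auto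
  then show ?thesis using O E(2) by (intro perpI) auto
qed

text \<open>The conclusions on E 0 drive the induction: E 0 can be approximated again and the new
  sequence spliced on at the left.\<close>

lemma perp_Fac_aux:
  assumes "k \<ge> 1" "Z \<in> perp_right C T" "Z \<in> X"
  shows "\<exists>E d. exact_complex C (Suc k) E d \<and> E (Suc k) = Z \<and>
      (\<forall>j\<in>{1..k}. E j \<in> T \<inter> X \<and> kernel_in C (E j) (E (Suc j)) (d j) X) \<and> E 0 \<in> perp_right C T \<and> E 0 \<in> X"
  using assms(1)
proof (induction k rule: nat_induct_at_least)
  case base
  obtain K N k g where N: "short_exact C K N Z k g" "N \<in> T" "N \<in> X" "K \<in> perp_right C T" "K \<in> X"
    using perp_approximation[OF assms(2,3)] by metis
  let ?E = "case_nat K (case_nat N (\<lambda>_. Z))" and ?d = "case_nat k (\<lambda>_. g)"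
  have "kernel_in C N Z g X" unfolding kernel_in_def using short_exactD(1)[OF N(1)] N(5) by blast
  then show ?case using N by (intro exI[of _ ?E] exI[of _ ?d]) (auto simp: exact_complex_2)
next
  case (Suc k)
  then obtain E d where E: "exact_complex C (Suc k) E d" "E (Suc k) = Z"
    "\<forall>j\<in>{1..k}. E j \<in> T \<inter> X \<and> kernel_in C (E j) (E (Suc j)) (d j) X" "E 0 \<in> perp_right C T" "E 0 \<in> X" by blast
  obtain K N f e where N: "short_exact C K N (E 0) f e" "N \<in> T" "N \<in> X" "K \<in> perp_right C T" "K \<in> X"
    using perp_approximation[OF E(4,5)] by metis
  let ?E = "case_nat K (case_nat N (\<lambda>j. E (Suc j)))" and ?d = "case_nat f (case_nat (d 0 \<bullet> e) (\<lambda>j. d (Suc j)))"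
  have x: "exact_complex C (Suc (Suc k)) ?E ?d" using exact_complex_Cons[OF N(1) E(1)] .
  have "is_mono C (E 0) (E (Suc 0)) (d 0)" using E(1) by (auto simp: exact_complex_def)
  then have "kernel_in C N (E (Suc 0)) (d 0 \<bullet> e) X"
    unfolding kernel_in_def using kernel_comp_mono[OF short_exactD(1)[OF N(1)]] N(5) by blast
  then have "?E j \<in> T \<inter> X \<and> kernel_in C (?E j) (?E (Suc j)) (?d j) X" if "j \<in> {1..Suc k}" for j
    using that N(2,3) E(3) by (auto split: nat.split)
  then show ?case using x E(2) N(4,5) by (intro exI[of _ ?E] exI[of _ ?d]) simp
qed

lemma perp_Fac:
  assumes "k \<ge> 1" "Z \<in> perp_right C T" "Z \<in> X" shows "Z \<in> Fac C X k T"
  using perp_Fac_aux[OF assms] X_Ob[OF assms(3)] unfolding Fac_def by blast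

end

theorem theorem3p12:
  fixes C :: "('o, 'm) abcat" and X T :: "'o set" and n :: nat
  assumes "abelian C"
    and "ext_closed C X"
    and "X = smd C X"
    and "tilting C X n T"
  shows "(perp_left C (perp_right C T \<inter> X) \<inter> X = perp_left C (perp_right C T) \<inter> X \<and>
          perp_left C (perp_right C T) \<inter> X = coresol C T X \<inter> X \<and>
          coresol C T X \<inter> X = coresol C (T \<inter> X) X \<inter> X)
       \<and> (\<forall>k::nat. max 1 (pd_class C X T) \<le> enat k \<longrightarrow>
            perp_right C T \<inter> X = Fac C X k T \<inter> X)
       \<and> X_complete C X (perp_left C (perp_right C T)) (perp_right C T)
       \<and> hereditary_pair C (perp_left C (perp_right C T)) (perp_right C T)"
proof -
  interpret tilting_class C X T n using assms by unfold_locales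
  \<comment> \<open>This closes a circle: within X, coresolved objects lie in the smaller left
    orthogonal, which lies in the larger one, whose objects are coresolved by T.\<close>
  have 1: "perp_left C (perp_right C T) \<subseteq> perp_left C (perp_right C T \<inter> X)" unfolding perp_left_def by blast
  have "perp_left C (perp_right C T \<inter> X) \<inter> X = perp_left C (perp_right C T) \<inter> X"
    using 1 perp_left_coresol coresol_perp_left by blast
  moreover have "perp_left C (perp_right C T) \<inter> X = coresol C T X \<inter> X"
    using 1 perp_left_coresol coresol_perp_left by blast
  moreover have "coresol C T X \<inter> X = coresol C (T \<inter> X) X \<inter> X"
    using coresol_inter coresol_mono[of "T \<inter> X" T] by blast
  moreover have "perp_right C T \<inter> X = Fac C X k T \<inter> X" if "max 1 (pd_class C X T) \<le> enat k" for k
  proof -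
    have "1 \<le> enat k" "pd_class C X T \<le> enat k" using that by auto
    moreover from this have "k \<ge> 1" by (simp add: one_enat_def)
    ultimately show ?thesis using Fac_perp perp_Fac by blast
  qed
  moreover have "X_complete C X (perp_left C (perp_right C T)) (perp_right C T)"
    unfolding X_complete_def
  proof (intro ballI)
    fix Y assume Y: "Y \<in> X"
    obtain B A f g where B: "short_exact C Y B A f g" "B \<in> perp_right C T" "B \<in> X" "A \<in> coresol C T X" "A \<in> X"
      using perp_approximation_right[OF Y] by metis
    obtain Z D z d where D: "short_exact C Z D Y z d" "Z \<in> perp_right C T" "Z \<in> X" "D \<in> coresol C T X" "D \<in> X"
      using coresol_approximation_left[OF B Y] by metis
    show "(\<exists>b a f g. a \<in> perp_left C (perp_right C T) \<inter> X \<and> b \<in> perp_right C T \<inter> X \<and> short_exact C b a Y f g) \<and>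
      (\<exists>b a f g. a \<in> perp_left C (perp_right C T) \<inter> X \<and> b \<in> perp_right C T \<inter> X \<and> short_exact C Y b a f g)"
      using B D coresol_perp_left by blast
  qed
  moreover have "hereditary_pair C (perp_left C (perp_right C T)) (perp_right C T)"
    unfolding hereditary_pair_def perp_left_def by blast
  ultimately show ?thesis by blast
qed

end
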